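(* Let $0<\alpha<1$, $T>0$, $s\ge0$ and $u_0\in H_s$. There exists a unique weak solution $u\in C([0,T];H_s)$ to $$\mathrm{i}^\alpha\partial_t^\alpha u(t)+Au(t)=0,\quad t\in(0,T),\qquad u(0)=u_0, \tag{P}$$ such that, for a constant $C>0$ independent of $u_0$, $$\|u\|_{C([0,T];H_s)}\le C\|u_0\|_s.$$ Moreover, the unique weak solution to (P) is given by $$u(t)=\sum_{n=1}^\infty\langle u_0,\varphi_n\rangle E_{\alpha,1}(\mathrm{i}^{-\alpha}\lambda_nt^\alpha)\varphi_n.$$
   Context: $(H,\langle\cdot,\cdot\rangle)$ is a (complex) Hilbert space with norm $\|\cdot\|$; $A:D(A)\subset H\to H$ is a negative-definite self-adjoint operator with compact resolvent. The eigenvalues of $-A$ are $0<\lambda_1\le\lambda_2\le\cdots\to\infty$, with a corresponding Hilbert (orthonormal) basis of eigenvectors $\{\varphi_n\}_{n\ge1}\subset D(A)$. For $s\ge0$, $H_s=\{u\in H:\sum_n\lambda_n^{2s}|\langle u,\varphi_n\rangle|^2<\infty\}$ with $\|u\|_s^2=\sum_n\lambda_n^{2s}|\langle u,\varphi_n\rangle|^2$; $H_{-s}=H_s'$ is its dual (identifying $H=H'$) with norm $\|u\|_{-s}^2=\sum_n\lambda_n^{-2s}|\langle u,\varphi_n\rangle_{-s,s}|^2$, where $\langle\cdot,\cdot\rangle_{-s,s}$ is the duality bracket between $H_{-s}$ and $H_s$, with $\langle u,v\rangle_{-s,s}=\langle u,v\rangle$ if $u\in H$ and $v\in H_s$. For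 $u=\sum_nu_n\varphi_n\in H$, $Au=-\sum_n\lambda_nu_n\varphi_n$ (as an element of a space $H_{-s}$). Powers: $\mathrm{i}^{\alpha}=e^{\mathrm{i}\pi\alpha/2}$, $\mathrm{i}^{-\alpha}=e^{-\mathrm{i}\pi\alpha/2}$. Mittag-Leffler function: $E_{\alpha,\beta}(z)=\sum_{k\ge0}z^k/\Gamma(\alpha k+\beta)$, $z\in\mathbb{C}$. Caputo derivative for $0<\alpha<1$: $\partial_t^\alpha u(t)=\frac{1}{\Gamma(1-\alpha)}\int_0^t(t-s)^{-\alpha}\partial_su(s)\,\mathrm{d}s$, whenever the right-hand side is well-defined. Weak solution of (P) for $u_0\in H$: a function $u$ such that (1) $u\in C([0,T];H)$; (2) $\partial_t^\alpha u(t),Au(t)\in H_{-1/\alpha}$ for almost all $t\in(0,T)$ and the equation holds in $H_{-1/\alpha}$ for almost all $t\in(0,T)$; (3) $\lim_{t\to0^+}\|u(t)-u_0\|=0$. *)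

theory Defs
  imports "HOL-Analysis.Analysis"
begin

section \<open>Complex Hilbert spaces\<close>

text \<open>The inner product is linear in its first argument. Positive definiteness follows from
  the norm axiom, because the real square root is negative on negative reals.\<close>

class complex_inner = real_normed_vector +
  fixes scaleC :: "complex \<Rightarrow> 'a \<Rightarrow> 'a" (infixr \<open>*\<^sub>C\<close> 75)
    and cinner :: "'a \<Rightarrow> 'a \<Rightarrow> complex"
  assumes scaleC_add_right: "c *\<^sub>C (x + y) = c *\<^sub>C x + c *\<^sub>C y"
    and scaleC_add_left: "(c + d) *\<^sub>C x = c *\<^sub>C x + d *\<^sub>C x"
    and scaleC_scaleC: "c *\<^sub>C d *\<^sub>C x = (c * d) *\<^sub>C x"
    and scaleC_of_real: "complex_of_real r *\<^sub>C x = r *\<^sub>R x"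
    and cinner_commute: "cinner x y = cnj (cinner y x)"
    and cinner_add_left: "cinner (x + y) z = cinner x z + cinner y z"
    and cinner_scaleC_left: "cinner (c *\<^sub>C x) y = c * cinner x y"
    and norm_eq_sqrt_cinner: "norm x = sqrt (Re (cinner x x))"

class chilbert_space = complex_inner + banach

section \<open>Unbounded operators\<close>

definition linear_operator_on :: "'a::complex_inner set \<Rightarrow> ('a \<Rightarrow> 'a) \<Rightarrow> bool" where
  "linear_operator_on D A \<longleftrightarrow> module.subspace scaleC D \<and>
     (\<forall>u\<in>D. \<forall>v\<in>D. A (u + v) = A u + A v) \<and> (\<forall>c. \<forall>u\<in>D. A (c *\<^sub>C u) = c *\<^sub>C A u)"

definition adjoint_domain :: "'a::complex_inner set \<Rightarrow> ('a \<Rightarrow> 'a) \<Rightarrow> 'a set" where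
  "adjoint_domain D A = {v. \<exists>w. \<forall>u\<in>D. cinner (A u) v = cinner u w}"

definition self_adjoint :: "'a::complex_inner set \<Rightarrow> ('a \<Rightarrow> 'a) \<Rightarrow> bool" where
  "self_adjoint D A \<longleftrightarrow> linear_operator_on D A \<and> closure D = UNIV \<and>
     adjoint_domain D A = D \<and> (\<forall>u\<in>D. \<forall>v\<in>D. cinner (A u) v = cinner u (A v))"

definition negative_definite :: "'a::complex_inner set \<Rightarrow> ('a \<Rightarrow> 'a) \<Rightarrow> bool" where
  "negative_definite D A \<longleftrightarrow> (\<forall>u\<in>D. u \<noteq> 0 \<longrightarrow> Re (cinner (A u) u) < 0)"

text \<open>Boundedness of the resolvent operator is implied by its compactness.\<close>

definition compact_resolvent :: "'a::complex_inner set \<Rightarrow> ('a \<Rightarrow> 'a) \<Rightarrow> bool" where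
  "compact_resolvent D A \<longleftrightarrow> (\<exists>z. bij_betw (\<lambda>u. z *\<^sub>C u - A u) D UNIV \<and>
     compact (closure (inv_into D (\<lambda>u. z *\<^sub>C u - A u) ` cball 0 1)))"

definition hilbert_basis :: "(nat \<Rightarrow> 'a::complex_inner) \<Rightarrow> bool" where
  "hilbert_basis phi \<longleftrightarrow> (\<forall>m n. cinner (phi m) (phi n) = (if m = n then 1 else 0)) \<and>
     closure (module.span scaleC (range phi)) = UNIV"

text \<open>The eigenvalues of \<open>-A\<close>, repeated according to multiplicity, and the eigenvectors
  are indexed from 0.\<close>

definition eigensystem ::
    "'a::complex_inner set \<Rightarrow> ('a \<Rightarrow> 'a) \<Rightarrow> (nat \<Rightarrow> real) \<Rightarrow> (nat \<Rightarrow> 'a) \<Rightarrow> bool" where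
  "eigensystem D A lam phi \<longleftrightarrow> 0 < lam 0 \<and> mono lam \<and> filterlim lam at_top sequentially \<and>
     hilbert_basis phi \<and> range phi \<subseteq> D \<and> (\<forall>n. - A (phi n) = lam n *\<^sub>R phi n)"

section \<open>The scale of spaces\<close>

definition H_pos :: "(nat \<Rightarrow> real) \<Rightarrow> (nat \<Rightarrow> 'a::complex_inner) \<Rightarrow> real \<Rightarrow> 'a set" where
  "H_pos lam phi s = {u. summable (\<lambda>n. lam n powr (2 * s) * (cmod (cinner u (phi n)))\<^sup>2)}"

definition norm_pos :: "(nat \<Rightarrow> real) \<Rightarrow> (nat \<Rightarrow> 'a::complex_inner) \<Rightarrow> real \<Rightarrow> 'a \<Rightarrow> real" where
  "norm_pos lam phi s u = sqrt (\<Sum>n. lam n powr (2 * s) * (cmod (cinner u (phi n)))\<^sup>2)"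

text \<open>An element \<open>F\<close> of the dual of \<open>H_pos lam phi s\<close> is represented by the map
  sending \<open>v\<close> to the duality bracket of \<open>F\<close> and \<open>v\<close>. The bracket extends the inner product
  of \<open>H\<close>, so it is conjugate-linear in \<open>v\<close>. Functionals are set to 0 outside
  \<open>H_pos lam phi s\<close>, so that equality of functionals is equality of HOL functions.\<close>

definition H_neg ::
    "(nat \<Rightarrow> real) \<Rightarrow> (nat \<Rightarrow> 'a::complex_inner) \<Rightarrow> real \<Rightarrow> ('a \<Rightarrow> complex) set" where
  "H_neg lam phi s = {F.
     (\<forall>v\<in>H_pos lam phi s. \<forall>w\<in>H_pos lam phi s. F (v + w) = F v + F w) \<and>
     (\<forall>c. \<forall>v\<in>H_pos lam phi s. F (c *\<^sub>C v) = cnj c * F v) \<and>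
     (\<exists>K. \<forall>v\<in>H_pos lam phi s. cmod (F v) \<le> K * norm_pos lam phi s v) \<and>
     (\<forall>v. v \<notin> H_pos lam phi s \<longrightarrow> F v = 0)}"

definition norm_neg ::
    "(nat \<Rightarrow> real) \<Rightarrow> (nat \<Rightarrow> 'a::complex_inner) \<Rightarrow> real \<Rightarrow> ('a \<Rightarrow> complex) \<Rightarrow> real" where
  "norm_neg lam phi s F = sqrt (\<Sum>n. lam n powr (- 2 * s) * (cmod (F (phi n)))\<^sup>2)"

definition embed ::
    "(nat \<Rightarrow> real) \<Rightarrow> (nat \<Rightarrow> 'a::complex_inner) \<Rightarrow> real \<Rightarrow> 'a \<Rightarrow> 'a \<Rightarrow> complex" where
  "embed lam phi s u = (\<lambda>v. if v \<in> H_pos lam phi s then cinner u v else 0)"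

text \<open>\<open>A u\<close> exists in \<open>H_neg lam phi s\<close> and equals \<open>F\<close>: the series
  \<open>- (\<Sum>n. lam n * u\<^sub>n * phi n)\<close> converges to \<open>F\<close> in the norm of that space. The operator
  enters only through its eigensystem.\<close>

definition has_A_value :: "(nat \<Rightarrow> real) \<Rightarrow> (nat \<Rightarrow> 'a::complex_inner) \<Rightarrow> real \<Rightarrow>
    'a \<Rightarrow> ('a \<Rightarrow> complex) \<Rightarrow> bool" where
  "has_A_value lam phi s u F \<longleftrightarrow> F \<in> H_neg lam phi s \<and>
     (\<lambda>N. norm_neg lam phi s (\<lambda>v. F v -
        (- (\<Sum>n<N. of_real (lam n) * cinner u (phi n) * embed lam phi s (phi n) v)))) \<longlonglongrightarrow> 0"

section \<open>Caputo derivative\<close>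

text \<open>Bochner integration in \<open>H_neg lam phi s\<close>. This space is a separable Hilbert space with
  dual \<open>H_pos lam phi s\<close>, so by Pettis' theorem strong measurability is
  measurability of all brackets, and the integral is determined by its brackets.\<close>

definition H_neg_integrable :: "(nat \<Rightarrow> real) \<Rightarrow> (nat \<Rightarrow> 'a::complex_inner) \<Rightarrow> real \<Rightarrow>
    real set \<Rightarrow> (real \<Rightarrow> 'a \<Rightarrow> complex) \<Rightarrow> bool" where
  "H_neg_integrable lam phi s I g \<longleftrightarrow> (\<forall>r\<in>I. g r \<in> H_neg lam phi s) \<and>
     (\<forall>v\<in>H_pos lam phi s. set_borel_measurable lborel I (\<lambda>r. g r v)) \<and>
     set_integrable lborel I (\<lambda>r. norm_neg lam phi s (g r))"

definition H_neg_integral :: "real set \<Rightarrow> (real \<Rightarrow> 'a \<Rightarrow> complex) \<Rightarrow> 'a \<Rightarrow> complex" where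
  "H_neg_integral I g = (\<lambda>v. set_lebesgue_integral lborel I (\<lambda>r. g r v))"

text \<open>The Caputo derivative of order \<open>\<alpha>\<close> of \<open>w\<close> at \<open>t\<close> is well-defined and equals \<open>F\<close>.
  The derivative of \<open>w\<close> is the a.e. defined density \<open>g\<close> of the absolutely continuous
  function \<open>w\<close>. Integrability of \<open>(t - r) powr (- \<alpha>) * g r\<close> on \<open>(0, t)\<close> already forces that
  of \<open>g\<close>, as \<open>(t - r) powr (- \<alpha>) \<ge> t powr (- \<alpha>)\<close> there. A derivative that exists merely
  pointwise a.e. would not do: Cantor-type functions then destroy uniqueness.\<close>

definition has_caputo_derivative :: "(nat \<Rightarrow> real) \<Rightarrow> (nat \<Rightarrow> 'a::complex_inner) \<Rightarrow> real \<Rightarrow>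
    real \<Rightarrow> (real \<Rightarrow> 'a \<Rightarrow> complex) \<Rightarrow> real \<Rightarrow> ('a \<Rightarrow> complex) \<Rightarrow> bool" where
  "has_caputo_derivative lam phi s \<alpha> w t F \<longleftrightarrow>
     (\<exists>g. H_neg_integrable lam phi s {0..t} g \<and>
        (\<forall>r\<in>{0..t}. \<forall>v. w r v = w 0 v + H_neg_integral {0..r} g v) \<and>
        H_neg_integrable lam phi s {0..t} (\<lambda>r v. of_real ((t - r) powr (- \<alpha>)) * g r v) \<and>
        (\<forall>v. F v = of_real (1 / Gamma (1 - \<alpha>)) *
           H_neg_integral {0..t} (\<lambda>r v. of_real ((t - r) powr (- \<alpha>)) * g r v) v))"

section \<open>The fractional Schroedinger problem\<close>

definition i_pow :: "real \<Rightarrow> complex" where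
  "i_pow \<alpha> = exp (\<i> * of_real (pi * \<alpha> / 2))"

definition mittag_leffler :: "real \<Rightarrow> real \<Rightarrow> complex \<Rightarrow> complex" where
  "mittag_leffler \<alpha> \<beta> z = (\<Sum>k. z ^ k / of_real (Gamma (\<alpha> * real k + \<beta>)))"

definition weak_solution :: "(nat \<Rightarrow> real) \<Rightarrow> (nat \<Rightarrow> 'a::complex_inner) \<Rightarrow>
    real \<Rightarrow> real \<Rightarrow> 'a \<Rightarrow> (real \<Rightarrow> 'a) \<Rightarrow> bool" where
  "weak_solution lam phi \<alpha> T u0 u \<longleftrightarrow>
     continuous_on {0..T} u \<and>
     (AE t in lborel. t \<in> {0<..<T} \<longrightarrow>
        (\<exists>F\<in>H_neg lam phi (1 / \<alpha>). \<exists>G\<in>H_neg lam phi (1 / \<alpha>).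
           has_caputo_derivative lam phi (1 / \<alpha>) \<alpha> (\<lambda>r. embed lam phi (1 / \<alpha>) (u r)) t F \<and>
           has_A_value lam phi (1 / \<alpha>) (u t) G \<and>
           (\<forall>v. i_pow \<alpha> * F v + G v = 0))) \<and>
     ((\<lambda>t. norm (u t - u0)) \<longlongrightarrow> 0) (at_right 0)"

definition C_pos :: "(nat \<Rightarrow> real) \<Rightarrow> (nat \<Rightarrow> 'a::complex_inner) \<Rightarrow> real \<Rightarrow> real \<Rightarrow>
    (real \<Rightarrow> 'a) set" where
  "C_pos lam phi s T = {u. \<forall>t\<in>{0..T}. u t \<in> H_pos lam phi s \<and>
     ((\<lambda>r. norm_pos lam phi s (u r - u t)) \<longlongrightarrow> 0) (at t within {0..T})}"

definition norm_C_pos :: "(nat \<Rightarrow> real) \<Rightarrow> (nat \<Rightarrow> 'a::complex_inner) \<Rightarrow> real \<Rightarrow> real \<Rightarrow>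
    (real \<Rightarrow> 'a) \<Rightarrow> real" where
  "norm_C_pos lam phi s T u = (SUP t\<in>{0..T}. norm_pos lam phi s (u t))"

end

theory Submission
  imports Defs "HOL-Complex_Analysis.Complex_Analysis" "HOL-Real_Asymp.Real_Asymp"
begin

text \<open>In the basis \<open>phi\<close> the problem decouples into the scalar equations
  \<open>i\<^sup>\<alpha> \<partial>\<^sub>t\<^sup>\<alpha> y = \<lambda> y\<close>, solved by \<open>E\<^sub>\<alpha>\<^sub>,\<^sub>1 (i\<^sup>-\<^sup>\<alpha> \<lambda> t\<^sup>\<alpha>)\<close>.
  The point is that this function is bounded uniformly in \<open>\<lambda>\<close> although its argument lies on the
  ray that bounds the sector of exponential growth. By scaling take \<open>\<lambda> = 1\<close>. The Laplace
  transform \<open>p\<^sup>\<alpha>\<^sup>-\<^sup>1 / (p\<^sup>\<alpha> - i\<^sup>-\<^sup>\<alpha>)\<close> has a simple pole at \<open>- i\<close> and a cut along the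
  negative half-line, so Cauchy's theorem and uniqueness of Laplace transforms give
  \<open>E\<^sub>\<alpha>\<^sub>,\<^sub>1 (i\<^sup>-\<^sup>\<alpha> t\<^sup>\<alpha>) = e\<^sup>-\<^sup>i\<^sup>t / \<alpha> + \<integral>\<^sub>0\<^sup>\<infinity> e\<^sup>-\<^sup>r\<^sup>t K(r) dr\<close> with \<open>K\<close>
  integrable. The same formula bounds the time derivative by
  \<open>C (\<lambda>\<^sup>1\<^sup>/\<^sup>\<alpha> + \<lambda> t\<^sup>\<alpha>\<^sup>-\<^sup>1)\<close>, so the series may be differentiated termwise in the dual of
  \<open>H_pos lam phi (1 / \<alpha>)\<close>. For uniqueness, apply the Abel operator of order \<open>\<alpha>\<close> to each
  coefficient equation: the coefficients of the difference of two weak solutions solve a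
  homogeneous Abel equation, whose integral operator is a contraction in a weighted
  supremum norm.\<close>

section \<open>The Mittag-Leffler function\<close>

text \<open>The Laplace transform is never inverted along a Bromwich line. The oscillation and the
  cut integral form a candidate whose transform is computed, and uniqueness identifies it with the
  series. By Fubini the transform of the cut integral is a Stieltjes integral with kernel
  \<open>1 / (p + r)\<close>; the contour only has to evaluate this one, at real p. In the variable
  \<open>w = ln \<zeta>\<close> the branch cut disappears: powers become entire exponentials, and
  the keyhole becomes a rectangle with two simple poles inside.

  Estimating the power series term by term gives exponential growth only, since the cancellation on
  the critical ray is invisible there. The oscillation has constant modulus, so boundedness without
  decay is the best possible.

  In the uniqueness part, the definition of the Caputo derivative lets its density depend on the
  time at which the equation is stated, and the equation holds only almost everywhere. The densities
  therefore have to be identified with each other before the Abel operator, which is blind to null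
  sets, can be applied.\<close>

lemma has_bochner_integral_Gamma_kernel:
  fixes a p :: real
  assumes a: "a > 0" and p: "p > 0"
  shows "has_bochner_integral lborel (\<lambda>t. indicator {0<..} t *\<^sub>R (t powr (a - 1) * exp (- p * t)))
           (Gamma a / p powr a)"
proof -
  have "has_bochner_integral lborel (\<lambda>t. indicator {0..} t *\<^sub>R (t powr (a - 1) / exp t)) (Gamma a)"
  proof (rule has_bochner_integral_nn_integral)
    show "(\<integral>\<^sup>+x. ennreal (indicator {0..} x *\<^sub>R (x powr (a - 1) / exp x)) \<partial>lborel) = ennreal (Gamma a)"
      using Gamma_conv_nn_integral_real[OF a] a by (auto simp: Gamma_real_pos)
  qed (use a in \<open>auto simp: less_imp_le[OF Gamma_real_pos] intro!: AE_I2\<close>)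
  hence "has_bochner_integral lborel
     (\<lambda>x. indicator {0..} (0 + p * x) *\<^sub>R ((0 + p * x) powr (a - 1) / exp (0 + p * x))) (Gamma a /\<^sub>R \<bar>p\<bar>)"
    by (subst (asm) lborel_has_bochner_integral_real_affine_iff[of p _ _ 0]) (use p in auto)
  hence "has_bochner_integral lborel (\<lambda>x. (1 / p powr (a - 1)) * 
     (indicator {0..} (0 + p * x) *\<^sub>R ((0 + p * x) powr (a - 1) / exp (0 + p * x))))
     ((1 / p powr (a - 1)) * (Gamma a /\<^sub>R \<bar>p\<bar>))"
    by (rule has_bochner_integral_mult_right)
  also have "(\<lambda>x. (1 / p powr (a - 1)) * (indicator {0..} (0 + p * x) *\<^sub>R ((0 + p * x) powr (a - 1) / exp (0 + p * x))))
     = (\<lambda>t. indicator {0<..} t *\<^sub>R (t powr (a - 1) * exp (- p * t)))"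
    using p by (auto simp: fun_eq_iff indicator_def powr_mult zero_le_mult_iff exp_minus field_simps split: if_splits)
  also have "((1 / p powr (a - 1)) * (Gamma a /\<^sub>R \<bar>p\<bar>)) = Gamma a / p powr a"
    using p by (simp add: powr_diff field_simps)
  finally show ?thesis .
qed

lemma has_bochner_integral_Beta_kernel:
  fixes a b t :: real
  assumes a: "a > 0" and b: "b > 0" and t: "t > 0"
  shows "has_bochner_integral lborel (\<lambda>r. indicator {0..t} r *\<^sub>R ((t - r) powr (b - 1) * r powr (a - 1)))
           (Gamma a * Gamma b / Gamma (a + b) * t powr (a + b - 1))"
proof -
  have 1: "set_integrable lborel {0..1} (\<lambda>t. t powr (a - 1) * (1 - t) powr (b - 1))"
    by (rule integrable_Beta[OF a b])
  have "has_bochner_integral lborel (\<lambda>x. indicator {0..1} x *\<^sub>R (x powr (a - 1) * (1 - x) powr (b - 1))) (Beta a b)"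
    using set_borel_integral_eq_integral[OF 1] has_integral_Beta_real[OF a b] 1
    by (simp add: has_bochner_integral_iff set_integrable_def set_lebesgue_integral_def has_integral_iff)
  hence "has_bochner_integral lborel (\<lambda>x. indicator {0..1} (0 + (1/t) * x) *\<^sub>R
       ((0 + (1/t) * x) powr (a - 1) * (1 - (0 + (1/t) * x)) powr (b - 1))) (Beta a b /\<^sub>R \<bar>1/t\<bar>)"
    by (subst (asm) lborel_has_bochner_integral_real_affine_iff[of "1/t" _ _ 0]) (use t in auto)
  hence "has_bochner_integral lborel (\<lambda>x. t powr (a + b - 2) * (indicator {0..1} (0 + (1/t) * x) *\<^sub>R
       ((0 + (1/t) * x) powr (a - 1) * (1 - (0 + (1/t) * x)) powr (b - 1)))) (t powr (a + b - 2) * (Beta a b /\<^sub>R \<bar>1/t\<bar>))"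
    by (rule has_bochner_integral_mult_right)
  also have "(\<lambda>x. t powr (a + b - 2) * (indicator {0..1} (0 + (1/t) * x) *\<^sub>R
       ((0 + (1/t) * x) powr (a - 1) * (1 - (0 + (1/t) * x)) powr (b - 1))))
     = (\<lambda>r. indicator {0..t} r *\<^sub>R ((t - r) powr (b - 1) * r powr (a - 1)))"
  proof (rule ext, goal_cases)
    case (1 r)
    show ?case
    proof (cases "r \<in> {0..t}")
      case True
      have "1 - r / t = (t - r) / t" using t by (simp add: field_simps)
      hence "(1 - r / t) powr (b - 1) = (t - r) powr (b - 1) / t powr (b - 1)"
        using True t by (simp add: powr_divide)
      moreover have "(r / t) powr (a - 1) = r powr (a - 1) / t powr (a - 1)"
        using True t by (simp add: powr_divide)
      moreover have "t powr (a + b - 2) = t powr (a - 1) * t powr (b - 1)"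
        by (simp add: powr_add[symmetric])
      ultimately show ?thesis using True t by (simp add: field_simps)
    next
      case False
      thus ?thesis using t by (auto simp: indicator_def field_simps split: if_splits)
    qed
  qed
  also have "t powr (a + b - 2) * (Beta a b /\<^sub>R \<bar>1/t\<bar>) = Gamma a * Gamma b / Gamma (a + b) * t powr (a + b - 1)"
    using t by (simp add: Beta_def powr_diff powr_add field_simps power2_eq_square)
  finally show ?thesis .
qed

text \<open>On the half-line beyond t the integrand of \<open>Gamma (x + 1)\<close> is at least
  \<open>t powr x * exp (- s)\<close>, whose integral there is \<open>t powr x * exp (- t)\<close>.
  This crude lower bound on Gamma takes the place of Stirling's formula.\<close>

lemma powr_le_exp_mult_Gamma:
  fixes x t :: real
  assumes x: "x \<ge> 0" and t: "t \<ge> 0"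
  shows "t powr x \<le> exp t * Gamma (x + 1)"
proof -
  have 1: "has_bochner_integral lborel (\<lambda>s. indicator {0<..} s *\<^sub>R (s powr x * exp (- s))) (Gamma (x + 1))"
    using has_bochner_integral_Gamma_kernel[of "x + 1" 1] x by simp
  have "(\<lambda>s::real. indicator {0<..} s *\<^sub>R (s powr (1 - 1) * exp (- 1 * s))) = (\<lambda>s. indicator {0<..} s *\<^sub>R exp (- s))"
    by (auto simp: fun_eq_iff indicator_def)
  hence 0: "has_bochner_integral lborel (\<lambda>s::real. indicator {0<..} s *\<^sub>R exp (- s)) (1::real)"
    using has_bochner_integral_Gamma_kernel[of 1 1] by simp
  have "has_bochner_integral lborel (\<lambda>s. indicator {0<..} (- t + 1 * s) *\<^sub>R exp (- (- t + 1 * s))) (1 /\<^sub>R \<bar>1\<bar>)"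
    using lborel_has_bochner_integral_real_affine_iff[of 1 "\<lambda>s. indicator {0<..} s *\<^sub>R exp (- s)" "1::real" "- t"] 0 by simp
  hence "has_bochner_integral lborel (\<lambda>s. (t powr x * exp (-t)) * (indicator {0<..} (- t + 1 * s) *\<^sub>R exp (- (- t + 1 * s))))
     ((t powr x * exp (-t)) * (1 /\<^sub>R \<bar>1\<bar>))"
    by (rule has_bochner_integral_mult_right)
  hence 2: "has_bochner_integral lborel (\<lambda>s. indicator {t<..} s *\<^sub>R (t powr x * exp (- s))) (t powr x * exp (-t))"
    by (simp add: indicator_def exp_diff exp_minus field_simps)
  have "t powr x * exp (-t) \<le> Gamma (x + 1)"
    unfolding has_bochner_integral_integral_eq[OF 1, symmetric] has_bochner_integral_integral_eq[OF 2, symmetric]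
  proof (rule integral_mono)
    fix s :: real
    show "indicat_real {t<..} s *\<^sub>R (t powr x * exp (- s)) \<le> indicat_real {0<..} s *\<^sub>R (s powr x * exp (- s))"
      using t x by (auto simp: indicator_def intro!: mult_right_mono powr_mono2)
  qed (use 1 2 in \<open>auto simp: has_bochner_integral_iff\<close>)
  thus ?thesis by (simp add: exp_minus field_simps)
qed

section \<open>Convergence and derivative of the Mittag-Leffler series\<close>

lemma summable_mittag_leffler_1_abs:
  fixes \<alpha> r :: real
  assumes \<alpha>: "\<alpha> > 0" and r: "r \<ge> 0"
  shows "summable (\<lambda>k. r ^ k / Gamma (\<alpha> * real k + 1))"
proof (rule summable_comparison_test')
  \<comment> \<open>With base \<open>2 * r + 1\<close> instead of r, dividing by Gamma leaves a
    geometric ratio of at most 1/2. The summand 1 keeps t positive when r = 0.\<close>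
  define t where "t = (2 * r + 1) powr (1 / \<alpha>)"
  have t: "t > 0" "t powr \<alpha> = 2 * r + 1"
    using \<alpha> r by (auto simp: t_def powr_powr)
  show "summable (\<lambda>k. exp t * (1 / 2) ^ k :: real)"
    by (intro summable_mult summable_geometric) auto
  fix k :: nat assume "k \<ge> 0"
  have "(2 * r + 1) ^ k = t powr (\<alpha> * real k)"
    using t r by (simp add: powr_powr[symmetric] powr_realpow)
  also have "\<dots> \<le> exp t * Gamma (\<alpha> * real k + 1)"
    by (rule powr_le_exp_mult_Gamma) (use \<alpha> t in auto)
  finally have *: "(2 * r + 1) ^ k \<le> exp t * Gamma (\<alpha> * real k + 1)" .
  have G: "Gamma (\<alpha> * real k + 1) > 0" using \<alpha> by (intro Gamma_real_pos) (auto intro: add_nonneg_pos)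
  have "2 ^ k * r ^ k \<le> (2 * r + 1) ^ k"
    unfolding power_mult_distrib[symmetric] by (rule power_mono) (use r in auto)
  with * have "2 ^ k * r ^ k \<le> exp t * Gamma (\<alpha> * real k + 1)" by linarith
  thus "norm (r ^ k / Gamma (\<alpha> * real k + 1)) \<le> exp t * (1 / 2) ^ k"
    using r G by (simp add: field_simps power_divide)
qed

lemma summable_mittag_leffler_1:
  fixes z :: complex
  assumes \<alpha>: "\<alpha> > 0"
  shows "summable (\<lambda>k. norm (z ^ k / of_real (Gamma (\<alpha> * real k + 1))))"
    and "summable (\<lambda>k. z ^ k / of_real (Gamma (\<alpha> * real k + 1)))"
proof -
  have "norm (z ^ k / of_real (Gamma (\<alpha> * real k + 1))) = norm z ^ k / Gamma (\<alpha> * real k + 1)" for k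
    using \<alpha> Gamma_real_pos[of "\<alpha> * real k + 1"]
    by (simp add: norm_divide norm_power add_nonneg_pos)
  thus 1: "summable (\<lambda>k. norm (z ^ k / of_real (Gamma (\<alpha> * real k + 1))))"
    using summable_mittag_leffler_1_abs[OF \<alpha>, of "norm z"] by simp
  show "summable (\<lambda>k. z ^ k / of_real (Gamma (\<alpha> * real k + 1)))"
    using 1 by (rule summable_norm_cancel)
qed

text \<open>The factor \<open>k + 1\<close> of termwise differentiation cancels against
  \<open>Gamma (x + 1) = x * Gamma x\<close> at \<open>x = \<alpha> * (k + 1)\<close>. Thus
  differentiation moves the second parameter from 1 to \<alpha>, up to the factor
  \<open>1 / \<alpha>\<close>.\<close>

lemma diffs_mittag_leffler_1:
  fixes \<alpha> :: real
  assumes \<alpha>: "\<alpha> > 0"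
  shows "diffs (\<lambda>k. 1 / of_real (Gamma (\<alpha> * real k + 1))) k =
    (1 / of_real (\<alpha> * Gamma (\<alpha> * real k + \<alpha>)) :: complex)"
proof -
  have pos: "\<alpha> * real (Suc k) > 0" using \<alpha> by simp
  have "Gamma (\<alpha> * real (Suc k) + 1) = \<alpha> * real (Suc k) * Gamma (\<alpha> * real (Suc k))"
    by (intro Gamma_plus1, rule notI, drule nonpos_Ints_nonpos) (use pos in auto)
  hence "diffs (\<lambda>k. 1 / of_real (Gamma (\<alpha> * real k + 1))) k = 
    (of_nat (Suc k) / of_real (\<alpha> * real (Suc k) * Gamma (\<alpha> * real (Suc k))) :: complex)"
    by (simp add: diffs_def)
  also have "\<dots> = 1 / of_real (\<alpha> * Gamma (\<alpha> * real (Suc k)))"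
    by (simp only: of_real_mult of_real_of_nat_eq) (simp del: of_nat_Suc)
  finally show ?thesis by (simp add: algebra_simps)
qed

lemma has_field_derivative_mittag_leffler_1:
  fixes z :: complex
  assumes \<alpha>: "\<alpha> > 0"
  shows "(mittag_leffler \<alpha> 1 has_field_derivative mittag_leffler \<alpha> \<alpha> z / of_real \<alpha>) (at z)"
    and "summable (\<lambda>k. z ^ k / of_real (Gamma (\<alpha> * real k + \<alpha>)))"
proof -
  define c :: "nat \<Rightarrow> complex" where "c k = 1 / of_real (Gamma (\<alpha> * real k + 1))" for k
  have sm: "summable (\<lambda>k. c k * z ^ k)" for z
    using summable_mittag_leffler_1(2)[OF \<alpha>, of z] by (simp add: c_def)
  have d: "diffs c k * z ^ k = (z ^ k / of_real (Gamma (\<alpha> * real k + \<alpha>))) / of_real \<alpha>" for k z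
    unfolding c_def diffs_mittag_leffler_1[OF \<alpha>] by simp
  have "summable (\<lambda>k. diffs c k * z ^ k)"
    by (rule termdiff_converges_all[OF sm])
  from summable_mult[OF this, of "of_real \<alpha>"] 
  show s2: "summable (\<lambda>k. z ^ k / of_real (Gamma (\<alpha> * real k + \<alpha>)))"
    using \<alpha> unfolding d by simp
  have "((\<lambda>z. \<Sum>k. c k * z ^ k) has_field_derivative (\<Sum>k. diffs c k * z ^ k)) (at z)"
    by (rule termdiffs_strong_converges_everywhere[OF sm])
  thus "(mittag_leffler \<alpha> 1 has_field_derivative mittag_leffler \<alpha> \<alpha> z / of_real \<alpha>) (at z)"
    unfolding d using suminf_divide[OF s2, of "of_real \<alpha>"]
    by (simp add: mittag_leffler_def[abs_def] c_def)
qed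

text \<open>The coefficients are positive, so convergence at the real point \<open>norm z\<close> is
  absolute convergence at z.\<close>

lemma summable_mittag_leffler_self_norm:
  fixes z :: complex
  assumes \<alpha>: "\<alpha> > 0"
  shows "summable (\<lambda>k. norm (z ^ k / of_real (Gamma (\<alpha> * real k + \<alpha>))))"
proof -
  have "norm (complex_of_real (norm z) ^ k / of_real (Gamma (\<alpha> * real k + \<alpha>))) = 
     norm (z ^ k / of_real (Gamma (\<alpha> * real k + \<alpha>)))" for k
    by (simp add: norm_divide norm_power)
  moreover have "complex_of_real (norm z) ^ k / of_real (Gamma (\<alpha> * real k + \<alpha>)) = 
     of_real (norm (z ^ k / of_real (Gamma (\<alpha> * real k + \<alpha>))))" for k
    using \<alpha> Gamma_real_pos[of "\<alpha> * real k + \<alpha>"]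
    by (simp add: norm_divide norm_power add_nonneg_pos)
  ultimately show ?thesis
    using has_field_derivative_mittag_leffler_1(2)[OF \<alpha>, of "of_real (norm z)"]
    by (simp only: summable_complex_of_real)
qed

lemma continuous_on_mittag_leffler_1 [continuous_intros]:
  assumes "\<alpha> > 0" "continuous_on S f"
  shows "continuous_on S (\<lambda>x. mittag_leffler \<alpha> 1 (f x))"
proof -
  have "continuous_on UNIV (mittag_leffler \<alpha> 1)"
    using DERIV_isCont[OF has_field_derivative_mittag_leffler_1(1)[OF assms(1)]]
    by (simp add: continuous_on_eq_continuous_at)
  from continuous_on_compose2[OF this assms(2)] show ?thesis by auto
qed

lemma mittag_leffler_0 [simp]: "mittag_leffler \<alpha> 1 0 = 1"
proof -
  have "(\<lambda>k. 0 ^ k / of_real (Gamma (\<alpha> * real k + 1)) :: complex) = (\<lambda>k. if k = 0 then 1 else 0)"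
    by auto
  thus ?thesis unfolding mittag_leffler_def using sums_single[of 0 "\<lambda>_. 1::complex"] by (simp add: sums_iff)
qed

text \<open>The derivative of \<open>t \<mapsto> E\<^sub>\<alpha>\<^sub>,\<^sub>1 (c t\<^sup>\<alpha>)\<close>. At the singularity \<open>t = 0\<close> it is 0,
  because \<open>0 powr x = 0\<close> also for negative \<open>x\<close>.\<close>

definition ml_density :: "real \<Rightarrow> complex \<Rightarrow> real \<Rightarrow> complex" where
  "ml_density \<alpha> c t = c * of_real (t powr (\<alpha> - 1)) * mittag_leffler \<alpha> \<alpha> (c * of_real (t powr \<alpha>))"

lemma borel_measurable_ml_density [measurable]: "ml_density \<alpha> c \<in> borel_measurable borel"
  unfolding ml_density_def[abs_def] mittag_leffler_def[abs_def] by measurable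

section \<open>The density and its fractional integrals\<close>

lemma has_vector_derivative_mittag_leffler_powr:
  assumes \<alpha>: "\<alpha> > 0" and t: "t > 0"
  shows "((\<lambda>t. mittag_leffler \<alpha> 1 (c * of_real (t powr \<alpha>))) has_vector_derivative ml_density \<alpha> c t) (at t)"
proof -
  have "((\<lambda>t. t powr \<alpha>) has_real_derivative \<alpha> * t powr (\<alpha> - 1)) (at t)"
    using t by (auto intro!: derivative_eq_intros simp: powr_diff field_simps)
  hence 1: "((\<lambda>t. c * of_real (t powr \<alpha>)) has_vector_derivative c * of_real (\<alpha> * t powr (\<alpha> - 1))) (at t)"
    by (intro has_vector_derivative_mult_right has_vector_derivative_of_real) 
       (simp add: has_real_derivative_iff_has_vector_derivative)
  from field_vector_diff_chain_at[OF 1 has_field_derivative_mittag_leffler_1(1)[OF \<alpha>]]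
  show ?thesis using \<alpha> by (simp add: o_def ml_density_def mult_ac)
qed

text \<open>Splitting each term into a complex constant and a nonnegative kernel makes the integral
  of its norm equal to the norm of its integral. The integrability condition for exchanging sum and
  integral then becomes absolute convergence of the integrated series, which is explicit for Gamma
  and Beta kernels.\<close>

lemma has_bochner_integral_nonneg_series:
  fixes A :: "nat \<Rightarrow> complex" and h :: "nat \<Rightarrow> real \<Rightarrow> real"
  assumes h: "\<And>k. has_bochner_integral lborel (h k) (B k)" and hn: "\<And>k r. h k r \<ge> 0"
    and sh: "\<And>r. summable (\<lambda>k. norm (A k * of_real (h k r)))"
    and sB: "summable (\<lambda>k. norm (A k * of_real (B k)))"
  shows "has_bochner_integral lborel (\<lambda>r. \<Sum>k. A k * of_real (h k r)) (\<Sum>k. A k * of_real (B k))"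
proof -
  have f: "has_bochner_integral lborel (\<lambda>r. A k * of_real (h k r)) (A k * of_real (B k))" for k
    by (intro has_bochner_integral_mult_right has_bochner_integral_of_real h)
  have B: "B k \<ge> 0" for k
    unfolding has_bochner_integral_integral_eq[OF h, symmetric] by (rule integral_nonneg_AE) (use hn in auto)
  have nf: "has_bochner_integral lborel (\<lambda>r. norm (A k * of_real (h k r))) (norm (A k * of_real (B k)))" for k
    unfolding norm_mult norm_of_real using hn[of k] h[of k] B[of k]
    by (auto intro!: has_bochner_integral_mult_right)
  have i: "integrable lborel (\<lambda>r. A k * of_real (h k r))" for k using f by (auto simp: has_bochner_integral_iff)
  have s: "summable (\<lambda>k. \<integral>r. norm (A k * of_real (h k r)) \<partial>lborel)"
    unfolding has_bochner_integral_integral_eq[OF nf] by (rule sB)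
  show ?thesis
    using integrable_suminf[OF i AE_I2[OF sh] s] integral_suminf[OF i AE_I2[OF sh] s]
    unfolding has_bochner_integral_integral_eq[OF f] has_bochner_integral_iff ..
qed

text \<open>Each term is a Beta integral whose factor \<open>Gamma (\<alpha> * k + \<alpha>)\<close>
  cancels the coefficient, so a fractional integral of order b raises the second parameter from
  \<alpha> to \<open>\<alpha> + b\<close>. The choice b = 1 gives the primitive;
  \<open>b = 1 - \<alpha>\<close> leads back to parameter 1, which is why the function solves the
  fractional equation.\<close>

lemma integral_Abel_ml_density:
  assumes \<alpha>: "\<alpha> > 0" and b: "b > 0" and t: "t > 0"
    and sm: "summable (\<lambda>k. norm ((c * of_real (t powr \<alpha>)) ^ k / of_real (Gamma (\<alpha> * real k + (\<alpha> + b)))))"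
  shows "has_bochner_integral lborel
           (\<lambda>r. indicator {0..t} r *\<^sub>R (of_real ((t - r) powr (b - 1)) * ml_density \<alpha> c r))
           (of_real (Gamma b) * c * of_real (t powr (\<alpha> + b - 1)) * mittag_leffler \<alpha> (\<alpha> + b) (c * of_real (t powr \<alpha>)))"
proof -
  define A where "A k = c ^ Suc k / of_real (Gamma (\<alpha> * real k + \<alpha>))" for k
  define B where "B k = Gamma (\<alpha> * real k + \<alpha>) * Gamma b / Gamma (\<alpha> * real k + \<alpha> + b) * t powr (\<alpha> * real k + \<alpha> + b - 1)" for k
  define h where "h k r = indicator {0..t} r *\<^sub>R ((t - r) powr (b - 1) * r powr (\<alpha> * real k + \<alpha> - 1))" for k r
  define f where "f k r = A k * of_real (h k r)" for k r
  have pos: "\<alpha> * real k + \<alpha> > 0" for k using \<alpha> by (simp add: add_nonneg_pos)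
  have Gp: "Gamma (\<alpha> * real k + \<alpha>) > 0" "Gamma (\<alpha> * real k + \<alpha> + b) > 0" for k
    using pos[of k] b by (auto intro!: Gamma_real_pos)
  have h: "has_bochner_integral lborel (h k) (B k)" for k
    unfolding h_def[abs_def] B_def by (rule has_bochner_integral_Beta_kernel[OF pos b t])
  have hn: "h k r \<ge> 0" for k r by (auto simp: h_def)
  have pw: "f k r = (indicator {0..t} r * (t - r) powr (b - 1) * r powr (\<alpha> - 1)) *\<^sub>R 
      (c * ((c * of_real (r powr \<alpha>)) ^ k / of_real (Gamma (\<alpha> * real k + \<alpha>))))" for k r
  proof (cases "r > 0")
    case True
    have "r powr (\<alpha> * real k + \<alpha> - 1) = r powr (\<alpha> - 1) * (r powr \<alpha>) ^ k"
      using True by (simp add: powr_add[symmetric] powr_realpow[symmetric] powr_powr algebra_simps)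
    thus ?thesis by (auto simp: f_def h_def A_def scaleR_conv_of_real power_mult_distrib)
  next
    case False
    thus ?thesis by (cases "r = 0") (auto simp: f_def h_def)
  qed
  have AB: "A k * of_real (B k) = of_real (Gamma b * t powr (\<alpha> + b - 1)) * c *
      ((c * of_real (t powr \<alpha>)) ^ k / of_real (Gamma (\<alpha> * real k + (\<alpha> + b))))" for k
  proof -
    have "t powr (\<alpha> * real k + \<alpha> + b - 1) = t powr (\<alpha> + b - 1) * (t powr \<alpha>) ^ k"
      using t by (simp add: powr_add[symmetric] powr_realpow[symmetric] powr_powr algebra_simps)
    thus ?thesis using Gp[of k] by (simp add: A_def B_def power_mult_distrib add.assoc)
  qed
  have s: "summable (\<lambda>k. norm (A k * of_real (B k)))"
    unfolding AB norm_mult[of "of_real (Gamma b * t powr (\<alpha> + b - 1)) * c"] by (rule summable_mult[OF sm])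
  have "summable (\<lambda>k. norm (A k * of_real (h k r)))" for r
    unfolding f_def[symmetric] pw norm_scaleR norm_mult[of c] by (intro summable_mult summable_mittag_leffler_self_norm \<alpha>)
  from has_bochner_integral_nonneg_series[OF h hn this s]
  have I: "has_bochner_integral lborel (\<lambda>r. \<Sum>k. f k r) (\<Sum>k. A k * of_real (B k))" unfolding f_def .
  have e1: "(\<Sum>k. f k r) = indicator {0..t} r *\<^sub>R (of_real ((t - r) powr (b - 1)) * ml_density \<alpha> c r)" for r
  proof -
    note s = has_field_derivative_mittag_leffler_1(2)[OF \<alpha>, of "c * of_real (r powr \<alpha>)"]
    have "(\<Sum>k. f k r) = (indicator {0..t} r * (t - r) powr (b - 1) * r powr (\<alpha> - 1)) *\<^sub>R 
      (c * mittag_leffler \<alpha> \<alpha> (c * of_real (r powr \<alpha>)))"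
      unfolding pw mittag_leffler_def
      by (subst suminf_scaleR_right[symmetric] suminf_mult; (intro summable_mult s)?)+ (rule refl)
    thus ?thesis by (simp add: ml_density_def scaleR_conv_of_real)
  qed
  have "(\<Sum>k. A k * of_real (B k)) = of_real (Gamma b * t powr (\<alpha> + b - 1)) * c * 
     mittag_leffler \<alpha> (\<alpha> + b) (c * of_real (t powr \<alpha>))"
    unfolding AB mittag_leffler_def
    by (subst suminf_mult) (use summable_norm_cancel[OF sm] in auto)
  with I show ?thesis unfolding e1 by (simp add: mult_ac)
qed

text \<open>The case b = 1 of the fractional integral, combined with the index shift \<open>z *
  mittag_leffler \<alpha> (\<alpha> + 1) z = mittag_leffler \<alpha> 1 z - 1\<close>.\<close>

lemma integral_ml_density:
  assumes \<alpha>: "\<alpha> > 0" and t: "t \<ge> 0"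
  shows "has_bochner_integral lborel (\<lambda>r. indicator {0..t} r *\<^sub>R ml_density \<alpha> c r)
           (mittag_leffler \<alpha> 1 (c * of_real (t powr \<alpha>)) - 1)"
proof (cases "t = 0")
  case True
  hence "(\<lambda>r. indicator {0..t} r *\<^sub>R ml_density \<alpha> c r) = (\<lambda>_. 0)"
    by (auto simp: ml_density_def indicator_def)
  thus ?thesis using True by (simp add: has_bochner_integral_zero)
next
  case False
  hence t: "t > 0" using t by simp
  define z where "z = c * of_real (t powr \<alpha>)"
  note sm = summable_mittag_leffler_1[OF \<alpha>, of z]
  have e: "z * (z ^ k / of_real (Gamma (\<alpha> * real k + (\<alpha> + 1)))) = 
     z ^ Suc k / of_real (Gamma (\<alpha> * real (Suc k) + 1))" for k
    by (simp add: algebra_simps)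
  have e': "norm z * norm (z ^ k / of_real (Gamma (\<alpha> * real k + (\<alpha> + 1)))) = 
     norm (z ^ Suc k / of_real (Gamma (\<alpha> * real (Suc k) + 1)))" for k
    by (simp only: norm_mult[symmetric] e)
  have s1: "summable (\<lambda>k. norm (z ^ k / of_real (Gamma (\<alpha> * real k + (\<alpha> + 1)))))"
  proof (cases "z = 0")
    case True
    have "(\<lambda>k. norm ((0::complex) ^ k / of_real (Gamma (\<alpha> * real k + (\<alpha> + 1))))) = 
      (\<lambda>k. if k = 0 then norm (1 / of_real (Gamma (\<alpha> + 1)) :: complex) else 0)" by auto
    with True show ?thesis using sums_summable[OF sums_single[of 0 "\<lambda>_. norm (1 / of_real (Gamma (\<alpha> + 1)) :: complex)"]]
      by simp
  next
    case False
    have "summable (\<lambda>k. norm (z ^ Suc k / of_real (Gamma (\<alpha> * real (Suc k) + 1))))"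
      using sm(1) by (subst (asm) summable_Suc_iff[symmetric])
    hence "summable (\<lambda>k. norm z * norm (z ^ k / of_real (Gamma (\<alpha> * real k + (\<alpha> + 1)))))"
      by (simp only: e')
    thus ?thesis using False by simp
  qed
  have "z * mittag_leffler \<alpha> (\<alpha> + 1) z = (\<Sum>k. z ^ Suc k / of_real (Gamma (\<alpha> * real (Suc k) + 1)))"
    unfolding mittag_leffler_def e[symmetric] by (rule suminf_mult[symmetric]) (rule summable_norm_cancel[OF s1])
  also have "\<dots> = mittag_leffler \<alpha> 1 z - 1"
    unfolding mittag_leffler_def by (subst suminf_split_head[OF sm(2)]) simp
  finally have z: "z * mittag_leffler \<alpha> (\<alpha> + 1) z = mittag_leffler \<alpha> 1 z - 1" .
  have "has_bochner_integral lborel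
           (\<lambda>r. indicator {0..t} r *\<^sub>R (of_real ((t - r) powr (1 - 1)) * ml_density \<alpha> c r))
           (z * mittag_leffler \<alpha> (\<alpha> + 1) z)"
    using integral_Abel_ml_density[OF \<alpha> _ t, of 1 c] s1 by (simp add: z_def mult_ac)
  \<comment> \<open>At r = t the kernel is \<open>0 powr 0 = 0\<close> instead of 1, hence equality
    only almost everywhere.\<close>
  moreover have "AE r in lborel. indicator {0..t} r *\<^sub>R (of_real ((t - r) powr (1 - 1)) * ml_density \<alpha> c r)
      = indicator {0..t} r *\<^sub>R ml_density \<alpha> c r"
    using AE_lborel_singleton[of t] by eventually_elim auto
  ultimately show ?thesis unfolding z[unfolded z_def, symmetric]
    by (subst has_bochner_integral_cong_AE[symmetric]) (auto simp: z_def)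
qed

lemma integral_caputo_ml_density:
  assumes \<alpha>: "0 < \<alpha>" "\<alpha> < 1" and t: "t > 0"
  shows "has_bochner_integral lborel
           (\<lambda>r. indicator {0..t} r *\<^sub>R (of_real ((t - r) powr (- \<alpha>)) * ml_density \<alpha> c r))
           (of_real (Gamma (1 - \<alpha>)) * c * mittag_leffler \<alpha> 1 (c * of_real (t powr \<alpha>)))"
  using integral_Abel_ml_density[of \<alpha> "1 - \<alpha>" t c] summable_mittag_leffler_1(1)[of \<alpha>] assms by simp

section \<open>Contour integration in logarithmic coordinates\<close>

text \<open>For |z| = 1 the square of the left-hand side is
  \<open>(1 - Re z) / 2 * (1 + q)^2 + (1 + Re z) / 2 * (1 - q)^2\<close>. The second summand is
  dropped, and \<open>norm (z - 1)^2 = 2 * (1 - Re z)\<close>.\<close>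

lemma norm_of_real_mult_unit_diff_1_ge:
  fixes z :: complex and q :: real
  assumes z: "norm z = 1" and q: "q \<ge> 0"
  shows "norm (of_real q * z - 1) \<ge> norm (z - 1) / 2 * (1 + q)"
proof (rule power2_le_imp_le)
  have e: "(Re z)\<^sup>2 + (Im z)\<^sup>2 = 1" using z by (simp add: cmod_def)
  have "(norm (z - 1) / 2 * (1 + q))\<^sup>2 = (norm (z - 1))\<^sup>2 * (1 + q)\<^sup>2 / 4"
    by (simp add: power_mult_distrib power_divide)
  also have "\<dots> = (((Re z)\<^sup>2 + (Im z)\<^sup>2) - 2 * Re z + 1) * (1 + q)\<^sup>2 / 4"
    by (simp add: cmod_power2) (simp add: power2_eq_square algebra_simps)
  also have "\<dots> = (1 - Re z) / 2 * (1 + q)\<^sup>2" unfolding e by (simp add: field_simps)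
  also have "\<dots> \<le> (1 - Re z) / 2 * (1 + q)\<^sup>2 + (1 + Re z) / 2 * (1 - q)\<^sup>2"
    using abs_Re_le_cmod[of z] z by auto
  also have "\<dots> = q\<^sup>2 * 1 - 2 * q * Re z + 1" by (simp add: power2_eq_square field_simps)
  also have "\<dots> = q\<^sup>2 * ((Re z)\<^sup>2 + (Im z)\<^sup>2) - 2 * q * Re z + 1" unfolding e ..
  also have "\<dots> = (norm (of_real q * z - 1))\<^sup>2"
    by (simp add: cmod_power2) (simp add: power2_eq_square algebra_simps)
  finally show "(norm (z - 1) / 2 * (1 + q))\<^sup>2 \<le> (norm (of_real q * z - 1))\<^sup>2" .
qed auto

text \<open>The integrand is the derivative of a bounded monotone function. It is the common
  majorant below: with \<beta> = \<alpha> for the spectral density, with \<beta> = 1 - \<alpha> for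
  the time increments of its Laplace integral.\<close>

lemma integrable_logistic:
  fixes \<beta> :: real
  assumes \<beta>: "\<beta> > 0"
  shows "integrable lborel (\<lambda>x. exp (\<beta> * x) / (1 + exp (\<beta> * x))\<^sup>2)"
proof -
  have pos: "1 + exp (\<beta> * x) \<noteq> 0" for x :: real using exp_gt_zero[of "\<beta> * x"] by linarith
  have "set_integrable lborel (einterval (-\<infinity>) \<infinity>) (\<lambda>x. exp (\<beta> * x) / (1 + exp (\<beta> * x))\<^sup>2)"
  proof (rule interval_integral_FTC_nonneg(1))
    show "DERIV (\<lambda>x. - 1 / (\<beta> * (1 + exp (\<beta> * x)))) x :> exp (\<beta> * x) / (1 + exp (\<beta> * x))\<^sup>2" for x
      using \<beta> pos by (auto intro!: derivative_eq_intros simp: power2_eq_square)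
    show "isCont (\<lambda>x. exp (\<beta> * x) / (1 + exp (\<beta> * x))\<^sup>2) x" for x
      using pos by (auto intro!: continuous_intros)
    have "((\<lambda>x. - 1 / (\<beta> * (1 + exp (\<beta> * x)))) \<longlongrightarrow> - 1 / \<beta>) at_bot"
      using \<beta> by (real_asymp simp: field_simps)
    thus "(((\<lambda>x. - 1 / (\<beta> * (1 + exp (\<beta> * x)))) \<circ> real_of_ereal) \<longlongrightarrow> - 1 / \<beta>) (at_right (-\<infinity>))"
      by (simp add: ereal_tendsto_simps)
    have "((\<lambda>x. - 1 / (\<beta> * (1 + exp (\<beta> * x)))) \<longlongrightarrow> 0) at_top"
      using \<beta> by real_asymp
    thus "(((\<lambda>x. - 1 / (\<beta> * (1 + exp (\<beta> * x)))) \<circ> real_of_ereal) \<longlongrightarrow> 0) (at_left \<infinity>)"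
      by (simp add: ereal_tendsto_simps)
  qed auto
  thus ?thesis by (simp add: set_integrable_def)
qed

text \<open>The function \<open>\<zeta>\<^sup>\<alpha> / (\<zeta>\<^sup>\<alpha> - i\<^sup>-\<^sup>\<alpha>)\<close> in the variable \<open>w = ln \<zeta>\<close>.\<close>

definition log_symbol :: "real \<Rightarrow> complex \<Rightarrow> complex" where
  "log_symbol \<alpha> w = exp (of_real \<alpha> * w) / (exp (of_real \<alpha> * w) - i_pow (- \<alpha>))"

text \<open>The jump of \<^term>\<open>log_symbol \<alpha>\<close> across the cut, in the variable \<open>x = ln r\<close> on the
  negative half-line.\<close>

definition spectral_density :: "real \<Rightarrow> real \<Rightarrow> complex" where
  "spectral_density \<alpha> x = (log_symbol \<alpha> (of_real x + \<i> * of_real pi) - log_symbol \<alpha> (of_real x - \<i> * of_real pi)) / (2 * \<i> * of_real pi)"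

lemma norm_i_pow [simp]: "norm (i_pow \<alpha>) = 1"
  by (simp add: i_pow_def)

lemma i_pow_minus_mult [simp]: "i_pow \<alpha> * i_pow (- \<alpha>) = 1" "i_pow (- \<alpha>) * i_pow \<alpha> = 1"
  by (simp_all add: i_pow_def exp_minus field_simps mult_exp_exp)

lemma exp_i_times_neq_1:
  fixes \<theta> :: real
  assumes "\<bar>\<theta>\<bar> < 2 * pi" "\<theta> \<noteq> 0"
  shows "exp (\<i> * of_real \<theta>) \<noteq> 1"
proof
  assume "exp (\<i> * of_real \<theta>) = 1"
  then obtain n :: int where n: "\<theta> = of_int (2 * n) * pi" by (auto simp: exp_eq_1)
  with assms have "\<bar>real_of_int n\<bar> * (2 * pi) < 1 * (2 * pi)" by (simp add: abs_mult)
  hence "\<bar>real_of_int n\<bar> < 1" by (subst (asm) mult_less_cancel_right) auto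
  hence "n = 0" by simp
  thus False using n assms by simp
qed

text \<open>After division by \<open>i_pow (- \<alpha>)\<close> the two edges of the cut become rays
  at the angles 3\<pi>\<alpha>/2 and -\<pi>\<alpha>/2. Neither is a multiple of 2\<pi>, so both rays
  stay away from 1 at a distance proportional to 1 plus the modulus.\<close>

lemma log_symbol_denominator:
  assumes \<alpha>: "0 < \<alpha>" "\<alpha> < 1"
  obtains \<delta> where "\<delta> > 0"
    "\<And>x. norm (exp (of_real \<alpha> * (of_real x + \<i> * of_real pi)) - i_pow (- \<alpha>)) \<ge> \<delta> * (1 + exp (\<alpha> * x))"
    "\<And>x. norm (exp (of_real \<alpha> * (of_real x - \<i> * of_real pi)) - i_pow (- \<alpha>)) \<ge> \<delta> * (1 + exp (\<alpha> * x))"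
proof -
  have *: "norm (exp (of_real \<alpha> * (of_real x + \<i> * of_real s)) - i_pow (- \<alpha>)) \<ge> 
      norm (exp (\<i> * of_real (\<alpha> * (s + pi / 2))) - 1) / 2 * (1 + exp (\<alpha> * x))" for x s
  proof -
    have "exp (of_real \<alpha> * (of_real x + \<i> * of_real s)) - i_pow (- \<alpha>) = 
       i_pow (- \<alpha>) * (of_real (exp (\<alpha> * x)) * exp (\<i> * of_real (\<alpha> * (s + pi / 2))) - 1)"
      by (simp add: i_pow_def exp_of_real[symmetric] mult_exp_exp algebra_simps)
    hence "norm (exp (of_real \<alpha> * (of_real x + \<i> * of_real s)) - i_pow (- \<alpha>)) = 
       norm (of_real (exp (\<alpha> * x)) * exp (\<i> * of_real (\<alpha> * (s + pi / 2))) - 1)"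
      by (simp add: norm_mult)
    also have "\<dots> \<ge> norm (exp (\<i> * of_real (\<alpha> * (s + pi / 2))) - 1) / 2 * (1 + exp (\<alpha> * x))"
      by (rule norm_of_real_mult_unit_diff_1_ge) auto
    finally show ?thesis .
  qed
  have \<alpha>pi: "0 < \<alpha> * pi" "\<alpha> * pi < pi" using \<alpha> by auto
  define \<delta>1 where "\<delta>1 = norm (exp (\<i> * of_real (\<alpha> * (pi + pi / 2))) - 1) / 2"
  define \<delta>2 where "\<delta>2 = norm (exp (\<i> * of_real (\<alpha> * (- pi + pi / 2))) - 1) / 2"
  have "exp (\<i> * of_real (\<alpha> * (pi + pi / 2))) \<noteq> 1"
    by (rule exp_i_times_neq_1) (use \<alpha>pi in \<open>auto simp: algebra_simps\<close>)
  hence 1: "\<delta>1 > 0" by (simp add: \<delta>1_def)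
  have "exp (\<i> * of_real (\<alpha> * (- pi + pi / 2))) \<noteq> 1"
    by (rule exp_i_times_neq_1) (use \<alpha>pi \<alpha> in \<open>auto simp: algebra_simps abs_if\<close>)
  hence 2: "\<delta>2 > 0" by (simp add: \<delta>2_def)
  show ?thesis
  proof (rule that[of "min \<delta>1 \<delta>2"])
    fix x
    have e: "1 + exp (\<alpha> * x) \<ge> 0" by (simp add: add_nonneg_nonneg)
    show "norm (exp (of_real \<alpha> * (of_real x + \<i> * of_real pi)) - i_pow (- \<alpha>)) \<ge> min \<delta>1 \<delta>2 * (1 + exp (\<alpha> * x))"
      by (rule order.trans[OF mult_right_mono[OF min.cobounded1 e] *[where x = x and s = pi, folded \<delta>1_def]])
    have "norm (exp (of_real \<alpha> * (of_real x + \<i> * of_real (- pi))) - i_pow (- \<alpha>)) \<ge> min \<delta>1 \<delta>2 * (1 + exp (\<alpha> * x))"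
      by (rule order.trans[OF mult_right_mono[OF min.cobounded2 e] *[where x = x and s = "- pi", folded \<delta>2_def]])
    thus "norm (exp (of_real \<alpha> * (of_real x - \<i> * of_real pi)) - i_pow (- \<alpha>)) \<ge> min \<delta>1 \<delta>2 * (1 + exp (\<alpha> * x))"
      by simp
  qed (use 1 2 in auto)
qed

text \<open>Each side of the cut tends to 1 as x grows, but in the jump these limits cancel: the
  common numerator is \<open>l * (Q - P)\<close>, of size at most 2q, over a denominator of order
  \<open>(1 + q)^2\<close>. This yields decay at both ends.\<close>

lemma norm_spectral_density_le:
  assumes \<alpha>: "0 < \<alpha>" "\<alpha> < 1"
  obtains C where "C > 0" "\<And>x. norm (spectral_density \<alpha> x) \<le> C * (exp (\<alpha> * x) / (1 + exp (\<alpha> * x))\<^sup>2)"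
proof -
  obtain \<delta> where \<delta>: "\<delta> > 0"
    "\<And>x. norm (exp (of_real \<alpha> * (of_real x + \<i> * of_real pi)) - i_pow (- \<alpha>)) \<ge> \<delta> * (1 + exp (\<alpha> * x))"
    "\<And>x. norm (exp (of_real \<alpha> * (of_real x - \<i> * of_real pi)) - i_pow (- \<alpha>)) \<ge> \<delta> * (1 + exp (\<alpha> * x))"
    using log_symbol_denominator[OF \<alpha>] by metis
  show ?thesis
  proof (rule that[of "1 / (pi * \<delta>\<^sup>2)"])
    fix x :: real
    define P where "P = exp (of_real \<alpha> * (of_real x + \<i> * of_real pi))"
    define Q where "Q = exp (of_real \<alpha> * (of_real x - \<i> * of_real pi))"
    define l where "l = i_pow (- \<alpha>)"
    define q where "q = exp (\<alpha> * x)"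
    have q: "q > 0" by (simp add: q_def)
    have dP: "norm (P - l) \<ge> \<delta> * (1 + q)" and dQ: "norm (Q - l) \<ge> \<delta> * (1 + q)"
      using \<delta>(2,3)[of x] by (auto simp: P_def Q_def l_def q_def)
    have pos: "\<delta> * (1 + q) > 0" using \<delta>(1) q by simp
    have nz: "P \<noteq> l" "Q \<noteq> l" using dP dQ pos by auto
    have nP: "norm P = q" "norm Q = q" by (auto simp: P_def Q_def q_def)
    have "spectral_density \<alpha> x = (P / (P - l) - Q / (Q - l)) / (2 * \<i> * of_real pi)"
      by (simp add: spectral_density_def log_symbol_def P_def Q_def l_def)
    also have "P / (P - l) - Q / (Q - l) = l * (Q - P) / ((P - l) * (Q - l))"
      using nz by (simp add: field_simps)
    also have "norm (l * (Q - P) / ((P - l) * (Q - l)) / (2 * \<i> * of_real pi)) = 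
       norm (Q - P) / (norm (P - l) * norm (Q - l)) / (2 * pi)"
      by (simp add: norm_mult norm_divide l_def)
    also have "\<dots> \<le> (2 * q) / ((\<delta> * (1 + q)) * (\<delta> * (1 + q))) / (2 * pi)"
      using dP dQ pos norm_triangle_ineq4[of Q P] q
      by (intro divide_right_mono frac_le mult_mono mult_pos_pos) (use \<delta>(1) in \<open>auto simp: nP\<close>)
    also have "\<dots> = 1 / (pi * \<delta>\<^sup>2) * (q / (1 + q)\<^sup>2)"
      by (simp add: power2_eq_square)
    finally show "norm (spectral_density \<alpha> x) \<le> 1 / (pi * \<delta>\<^sup>2) * (exp (\<alpha> * x) / (1 + exp (\<alpha> * x))\<^sup>2)"
      by (simp add: q_def)
  qed (use \<delta> in auto)
qed

lemma borel_measurable_spectral_density [measurable]: "spectral_density \<alpha> \<in> borel_measurable borel"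
  unfolding spectral_density_def[abs_def] log_symbol_def[abs_def] by measurable

lemma integrable_spectral_density:
  assumes \<alpha>: "0 < \<alpha>" "\<alpha> < 1"
  shows "integrable lborel (spectral_density \<alpha>)"
proof -
  obtain C where C: "C > 0" "\<And>x. norm (spectral_density \<alpha> x) \<le> C * (exp (\<alpha> * x) / (1 + exp (\<alpha> * x))\<^sup>2)"
    using norm_spectral_density_le[OF \<alpha>] by metis
  have "integrable lborel (\<lambda>x. C * (exp (\<alpha> * x) / (1 + exp (\<alpha> * x))\<^sup>2))"
    using integrable_logistic[OF \<alpha>(1)] by (rule integrable_mult_right)
  thus ?thesis
    by (rule Bochner_Integration.integrable_bound) (use C in \<open>auto intro!: AE_I2 intro: order.trans\<close>)
qed

section \<open>Zeros in the strip and the residue computation\<close>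

lemma contour_integral_linepath_same_Im:
  assumes "a < b"
  shows "contour_integral (linepath (of_real a + c) (of_real b + c)) f = integral {a..b} (\<lambda>x. f (of_real x + c))"
proof -
  have "linepath (of_real a + c) (of_real b + c) x = linepath (of_real a) (of_real b) x + c" for x
    by (simp add: linepath_def scaleR_conv_of_real algebra_simps)
  hence "contour_integral (linepath (of_real a + c) (of_real b + c)) f = 
     contour_integral (linepath (of_real a) (of_real b)) (\<lambda>z. f (z + c))"
    by (simp add: contour_integral_integral)
  also have "\<dots> = integral {a..b} (\<lambda>x. f (of_real x + c))"
    using assms by (subst contour_integral_linepath_Reals_eq) auto
  finally show ?thesis .
qed

text \<open>The solutions are spaced vertically by 2\<pi>/\<alpha>, which exceeds 2\<pi>, and every
  point of the strip is at height less than 2\<pi> from the solution at -\<pi>/2. The half-width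
  3\<pi>/2 leaves room for the closed rectangle up to height \<pi> inside the open strip.\<close>

lemma exp_eq_i_pow_iff_in_strip:
  assumes \<alpha>: "0 < \<alpha>" "\<alpha> < 1" and w: "\<bar>Im w\<bar> < 3 * pi / 2"
  shows "exp (of_real \<alpha> * w) = i_pow (- \<alpha>) \<longleftrightarrow> w = - \<i> * of_real (pi / 2)"
proof
  assume "exp (of_real \<alpha> * w) = i_pow (- \<alpha>)"
  then obtain n :: int where n: "of_real \<alpha> * w = \<i> * of_real (pi * (- \<alpha>) / 2) + (of_int (2 * n) * of_real pi) * \<i>"
    unfolding i_pow_def by (auto simp: exp_eq)
  have im: "\<alpha> * Im w = pi * (- \<alpha>) / 2 + 2 * real_of_int n * pi" 
    using arg_cong[OF n, of Im] by simp
  have re: "\<alpha> * Re w = 0" using arg_cong[OF n, of Re] by simp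
  have "\<bar>2 * real_of_int n * pi\<bar> = \<alpha> * \<bar>Im w + pi / 2\<bar>"
  proof -
    have "2 * real_of_int n * pi = \<alpha> * (Im w + pi / 2)" using im by (simp add: algebra_simps)
    thus ?thesis using \<alpha> by (simp add: abs_mult)
  qed
  also have "\<dots> < 1 * (2 * pi)" using \<alpha> w by (intro mult_strict_mono') auto
  finally have "\<bar>real_of_int n\<bar> * (2 * pi) < 1 * (2 * pi)" by (simp add: abs_mult)
  hence "\<bar>real_of_int n\<bar> < 1" by (subst (asm) mult_less_cancel_right) auto
  hence "n = 0" by simp
  with im have "\<alpha> * Im w = \<alpha> * (- pi / 2)" by simp
  hence "Im w = - pi / 2" using \<alpha> by (subst (asm) mult_cancel_left) auto
  with re \<alpha> show "w = - \<i> * of_real (pi / 2)" by (simp add: complex_eq_iff)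
next
  assume w: "w = - \<i> * of_real (pi / 2)"
  show "exp (of_real \<alpha> * w) = i_pow (- \<alpha>)" unfolding w i_pow_def
    by (rule arg_cong[of _ _ exp]) simp
qed

lemma exp_eq_of_real_iff_in_strip:
  assumes p: "p > 0" and w: "\<bar>Im w\<bar> < 2 * pi"
  shows "exp w = of_real p \<longleftrightarrow> w = of_real (ln p)"
proof
  assume "exp w = of_real p"
  also have "\<dots> = exp (of_real (ln p))" using p by (simp add: exp_of_real)
  finally obtain n :: int where n: "w = of_real (ln p) + (of_int (2 * n) * of_real pi) * \<i>"
    by (auto simp: exp_eq)
  have "\<bar>real_of_int n\<bar> * (2 * pi) < 1 * (2 * pi)" using n w by (simp add: abs_mult)
  hence "\<bar>real_of_int n\<bar> < 1" by (subst (asm) mult_less_cancel_right) auto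
  hence "n = 0" by simp
  with n show "w = of_real (ln p)" by simp
qed (use p in \<open>simp add: exp_of_real\<close>)

lemma norm_sub_divide_le:
  fixes z w :: complex
  assumes "norm w = 1" "norm z \<noteq> 1"
  shows "norm (z / (z - w)) \<le> norm z / \<bar>norm z - 1\<bar>"
  using norm_triangle_ineq3[of z w] assms by (simp add: norm_divide frac_le)

text \<open>Cauchy's theorem for the keyhole contour around the negative half-line; the substitution
  \<open>\<zeta> = e\<^sup>w\<close> turns the keyhole into the boundary of the strip \<open>\<bar>Im w\<bar> \<le> \<pi>\<close>.\<close>

lemma log_symbol_Stieltjes:
  assumes \<alpha>: "0 < \<alpha>" "\<alpha> < 1" and p: "p > 0"
  shows "has_bochner_integral lborel (\<lambda>x. spectral_density \<alpha> x / of_real (p + exp x))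
     (log_symbol \<alpha> (of_real (ln p)) / of_real p - 1 / (of_real \<alpha> * (of_real p + \<i>)))"
proof -
  \<comment> \<open>With \<open>\<zeta> = e^w\<close> and \<Phi> the symbol, \<open>G w dw\<close>
    is \<open>\<Phi>(\<zeta>) / (\<zeta> * (\<zeta> - p)) d\<zeta>\<close>. Its residue at
    \<open>ln p\<close> is the Laplace transform of the Mittag-Leffler function at p; the residue at
    -i\<pi>/2 is minus that of the oscillation.\<close>
  define G where "G w = exp (of_real \<alpha> * w) / (exp (of_real \<alpha> * w) - i_pow (- \<alpha>)) / (exp w - of_real p)" for w
  define S where "S = {w. - (3 * pi / 2) < Im w} \<inter> {w. Im w < 3 * pi / 2}"
  define w1 where "w1 = complex_of_real (ln p)"
  define w2 where "w2 = - \<i> * complex_of_real (pi / 2)"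
  define R where "R = log_symbol \<alpha> (of_real (ln p)) / of_real p - 1 / (of_real \<alpha> * (of_real p + \<i>))"
  have S: "open S" "connected S"
    unfolding S_def by (intro open_Int open_halfspace_Im_lt open_halfspace_Im_gt
      convex_connected convex_Int convex_halfspace_Im_lt convex_halfspace_Im_gt)+
  have absS: "\<bar>Im w\<bar> < 3 * pi / 2" if "w \<in> S" for w
    using that unfolding S_def abs_less_iff by (simp; linarith)
  have "exp (of_real \<alpha> * w) \<noteq> i_pow (- \<alpha>)" if "w \<in> S" "w \<noteq> w2" for w
    using exp_eq_i_pow_iff_in_strip[OF \<alpha> absS[OF that(1)]] that(2) by (simp add: w2_def)
  note nz2 = this
  have nz1: "exp w \<noteq> of_real p" if "w \<in> S" "w \<noteq> w1" for w
    using exp_eq_of_real_iff_in_strip[OF p, of w] absS[OF that(1)] pi_gt_zero that(2) by (simp add: w1_def)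
  have holo: "G holomorphic_on S - {w1, w2}"
    unfolding G_def[abs_def] using nz1 nz2 by (intro holomorphic_intros) auto
  have ne: "w1 \<noteq> w2" by (auto simp: w1_def w2_def complex_eq_iff)
  have w1S: "w1 \<in> S" and w2S: "w2 \<in> S" by (auto simp: w1_def w2_def S_def)
  have res1: "residue G w1 = log_symbol \<alpha> (of_real (ln p)) / of_real p"
  proof -
    \<comment> \<open>A smaller strip that keeps \<open>w1\<close> but excludes \<open>w2\<close>,
      so that the numerator is holomorphic on all of it. The same device with the roles exchanged
      serves the other residue.\<close>
    define S1 where "S1 = {w. - (pi / 2) < Im w} \<inter> {w. Im w < 3 * pi / 2}"
    have "S1 \<subseteq> S - {w2}" using pi_gt_zero by (auto simp: S1_def S_def w2_def)
    have "residue (\<lambda>w. log_symbol \<alpha> w / (exp w - of_real p)) w1 = log_symbol \<alpha> w1 / exp w1"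
    proof (rule residue_simple_pole_deriv[where s = S1])
      show "log_symbol \<alpha> holomorphic_on S1"
        unfolding log_symbol_def[abs_def] using nz2 \<open>S1 \<subseteq> S - {w2}\<close> by (intro holomorphic_intros) auto
      show "open S1" "connected S1"
        unfolding S1_def by (intro open_Int open_halfspace_Im_lt open_halfspace_Im_gt
      convex_connected convex_Int convex_halfspace_Im_lt convex_halfspace_Im_gt)+
      show "w1 \<in> S1" by (auto simp: S1_def w1_def)
      show "((\<lambda>w. exp w - of_real p) has_field_derivative exp w1) (at w1)"
        by (auto intro!: derivative_eq_intros)
      show "log_symbol \<alpha> w1 \<noteq> 0" using nz2[OF w1S ne] by (simp add: log_symbol_def)
    qed (use p in \<open>auto intro!: holomorphic_intros simp: w1_def exp_of_real\<close>)
    thus ?thesis using p by (simp add: G_def[abs_def] log_symbol_def w1_def exp_of_real)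
  qed
  have ew2: "exp w2 = - \<i>" by (simp add: w2_def exp_eq_polar complex_eq_iff cis.ctr)
  have res2: "residue G w2 = - 1 / (of_real \<alpha> * (of_real p + \<i>))"
  proof -
    define S1 where "S1 = {w. - (3 * pi / 2) < Im w} \<inter> {w. Im w < 0}"
    have "S1 \<subseteq> S - {w1}" using pi_gt_zero by (auto simp: S1_def S_def w1_def)
    have "residue (\<lambda>w. (exp (of_real \<alpha> * w) / (exp w - of_real p)) / (exp (of_real \<alpha> * w) - i_pow (- \<alpha>))) w2 = 
      (exp (of_real \<alpha> * w2) / (exp w2 - of_real p)) / (of_real \<alpha> * exp (of_real \<alpha> * w2))"
    proof (rule residue_simple_pole_deriv[where s = S1])
      show "(\<lambda>w. exp (of_real \<alpha> * w) / (exp w - of_real p)) holomorphic_on S1"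
        using nz1 \<open>S1 \<subseteq> S - {w1}\<close> by (intro holomorphic_intros) auto
      show "open S1" "connected S1"
        unfolding S1_def by (intro open_Int open_halfspace_Im_lt open_halfspace_Im_gt
      convex_connected convex_Int convex_halfspace_Im_lt convex_halfspace_Im_gt)+
      show "w2 \<in> S1" by (auto simp: S1_def w2_def)
      show "((\<lambda>w. exp (of_real \<alpha> * w) - i_pow (- \<alpha>)) has_field_derivative of_real \<alpha> * exp (of_real \<alpha> * w2)) (at w2)"
        by (auto intro!: derivative_eq_intros)
      show "exp (of_real \<alpha> * w2) / (exp w2 - of_real p) \<noteq> 0" 
        using nz1[OF w2S] ne by simp
      show "exp (of_real \<alpha> * w2) - i_pow (- \<alpha>) = 0"
        using exp_eq_i_pow_iff_in_strip[OF \<alpha>, of w2] by (auto simp: w2_def)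
    qed (use \<alpha> in \<open>auto intro!: holomorphic_intros\<close>)
    also have "\<dots> = 1 / (of_real \<alpha> * (- \<i> - of_real p))" by (simp add: ew2)
    also have "- \<i> - of_real p = - (of_real p + \<i>)" by simp
    also have "1 / (of_real \<alpha> * - (of_real p + \<i>)) = - 1 / (of_real \<alpha> * (of_real p + \<i>))"
      by (simp only: mult_minus_right minus_divide_right[symmetric] minus_divide_left)
    finally show ?thesis by (simp add: G_def[abs_def] field_simps)
  qed

  define k where "k x = 2 * \<i> * of_real pi * (spectral_density \<alpha> x / of_real (p + exp x))" for x
  define side where "side c = contour_integral (linepath (Complex c (-pi)) (Complex c pi)) G" for c
  \<comment> \<open>For such N the rectangle encloses \<open>ln p\<close>; the second pole lies on
    the imaginary axis and is enclosed as soon as N is positive.\<close>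
  have eN: "eventually (\<lambda>N. real N > \<bar>ln p\<bar> \<and> N > 0) sequentially"
    using eventually_conj[OF filterlim_real_sequentially[unfolded filterlim_at_top_dense, rule_format, of "\<bar>ln p\<bar>"] eventually_gt_at_top[of 0]] .
  have cont: "continuous_on A G" if "A \<subseteq> S - {w1, w2}" for A
    using holomorphic_on_imp_continuous_on[OF holomorphic_on_subset[OF holo that]] .
  have J: "integral {- real N..real N} k = 2 * \<i> * of_real pi * R - side (real N) + side (- real N)"
    and cr: "G contour_integrable_on (linepath (Complex (real N) (-pi)) (Complex (real N) pi))" 
    and cl: "G contour_integrable_on (linepath (Complex (- real N) (-pi)) (Complex (- real N) pi))" 
    if N: "real N > \<bar>ln p\<bar> \<and> N > 0" for N
  proof -
    define a1 a2 a3 a4 where "a1 = Complex (- real N) (- pi)" and "a2 = Complex (real N) (-pi)"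
      and "a3 = Complex (real N) pi" and "a4 = Complex (- real N) pi"
    define P where "P = rectpath a1 a3"
    have imP: "path_image P = {z. Re z \<in> {- real N, real N} \<and> Im z \<in> {- pi..pi}} \<union>
           {z. Im z \<in> {- pi, pi} \<and> Re z \<in> {- real N..real N}}"
      unfolding P_def by (subst path_image_rectpath) (auto simp: a1_def a3_def)
    have bx: "w1 \<in> box a1 a3" "w2 \<in> box a1 a3"
      using N pi_gt_zero by (auto simp: in_box_complex_iff a1_def a3_def w1_def w2_def, linarith)
    have imS: "path_image P \<subseteq> S - {w1, w2}"
      using N pi_gt_zero unfolding imP by (auto simp: S_def w1_def w2_def; linarith)
    have wn: "winding_number P w1 = 1" "winding_number P w2 = 1"
      unfolding P_def using bx by (auto intro: winding_number_rectpath)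
    have "contour_integral P G = 2 * pi * \<i> * (\<Sum>w\<in>{w1, w2}. winding_number P w * residue G w)"
    proof (rule Residue_theorem[OF S _ holo _ _ imS])
      show "\<forall>z. z \<notin> S \<longrightarrow> winding_number P z = 0"
      proof safe
        fix z assume "z \<notin> S"
        hence "z \<notin> cbox a1 a3" using pi_gt_zero by (auto simp: S_def in_cbox_complex_iff a1_def a3_def; linarith)
        thus "winding_number P z = 0" unfolding P_def
          by (intro winding_number_rectpath_outside) (auto simp: a1_def a3_def)
      qed
    qed (auto simp: P_def)
    also have "\<dots> = 2 * \<i> * of_real pi * R"
      using ne by (simp add: wn res1 res2 R_def algebra_simps)
    finally have cP: "contour_integral P G = 2 * \<i> * of_real pi * R" .
    have a24: "Complex (Re a3) (Im a1) = a2" "Complex (Re a1) (Im a3) = a4"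
      by (auto simp: a1_def a2_def a3_def a4_def)
    have P: "P = linepath a1 a2 +++ linepath a2 a3 +++ linepath a3 a4 +++ linepath a4 a1"
      unfolding P_def rectpath_def Let_def a24 ..
    have "path_image P = closed_segment a1 a2 \<union> (closed_segment a2 a3 \<union> (closed_segment a3 a4 \<union> closed_segment a4 a1))"
      unfolding P by (simp add: path_image_join)
    with imS have segs: "closed_segment a1 a2 \<subseteq> S - {w1, w2}" "closed_segment a2 a3 \<subseteq> S - {w1, w2}"
      "closed_segment a3 a4 \<subseteq> S - {w1, w2}" "closed_segment a4 a1 \<subseteq> S - {w1, w2}" by auto
    have ci: "G contour_integrable_on linepath a1 a2" "G contour_integrable_on linepath a2 a3"
      "G contour_integrable_on linepath a3 a4" "G contour_integrable_on linepath a4 a1"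
      by (intro contour_integrable_continuous_linepath cont segs)+
    have "contour_integral P G = contour_integral (linepath a1 a2) G + (contour_integral (linepath a2 a3) G
       + (contour_integral (linepath a3 a4) G + contour_integral (linepath a4 a1) G))"
      unfolding P using ci by (simp add: contour_integrable_join)
    also have "contour_integral (linepath a4 a1) G = - contour_integral (linepath a1 a4) G"
      by (rule contour_integral_reverse_linepath) (use cont segs in \<open>auto simp: closed_segment_commute\<close>)
    also have "contour_integral (linepath a3 a4) G = - contour_integral (linepath a4 a3) G"
      by (rule contour_integral_reverse_linepath) (use cont segs in \<open>auto simp: closed_segment_commute\<close>)
    also have "contour_integral (linepath a2 a3) G = side (real N)" by (simp add: side_def a2_def a3_def)
    also have "contour_integral (linepath a1 a4) G = side (- real N)" by (simp add: side_def a1_def a4_def)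
    finally have *: "contour_integral (linepath a1 a2) G - contour_integral (linepath a4 a3) G = 
       2 * \<i> * of_real pi * R - side (real N) + side (- real N)" using cP by (simp add: algebra_simps)
    have a_eq: "a1 = of_real (- real N) + (- \<i> * of_real pi)" "a2 = of_real (real N) + (- \<i> * of_real pi)"
      "a4 = of_real (- real N) + \<i> * of_real pi" "a3 = of_real (real N) + \<i> * of_real pi"
      by (auto simp: a1_def a2_def a3_def a4_def complex_eq_iff)
    have b: "contour_integral (linepath a1 a2) G = integral {- real N..real N} (\<lambda>x. G (of_real x + - \<i> * of_real pi))"
      unfolding a_eq by (rule contour_integral_linepath_same_Im) (use N in auto)
    have t: "contour_integral (linepath a4 a3) G = integral {- real N..real N} (\<lambda>x. G (of_real x + \<i> * of_real pi))"
      unfolding a_eq by (rule contour_integral_linepath_same_Im) (use N in auto)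
    have inP1: "of_real x + - \<i> * of_real pi \<in> S - {w1, w2}" for x
      using pi_gt_zero by (auto simp: S_def w1_def w2_def complex_eq_iff; linarith)
    have inP2: "of_real x + \<i> * of_real pi \<in> S - {w1, w2}" for x
      using pi_gt_zero by (auto simp: S_def w1_def w2_def complex_eq_iff; linarith)
    have "integral {- real N..real N} (\<lambda>x. G (of_real x + - \<i> * of_real pi)) - integral {- real N..real N} (\<lambda>x. G (of_real x + \<i> * of_real pi))
      = integral {- real N..real N} (\<lambda>x. G (of_real x + - \<i> * of_real pi) - G (of_real x + \<i> * of_real pi))"
      using inP1 inP2 by (intro integral_diff[symmetric] integrable_continuous_interval
         continuous_on_compose2[OF cont[OF order.refl]] continuous_intros) auto
    also have "\<dots> = integral {- real N..real N} k"
    proof (rule integral_cong)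
      fix x :: real
      \<comment> \<open>Both edges lie over the point \<open>- exp x\<close>, so both denominators
        equal \<open>- (p + exp x)\<close>. This sign turns the difference bottom minus top into the
        jump top minus bottom.\<close>
      have e1: "exp (of_real x + - \<i> * of_real pi) = - of_real (exp x)" "exp (of_real x + \<i> * of_real pi) = - of_real (exp x)"
        by (simp_all add: exp_add exp_diff exp_of_real exp_pi_i')
      have d: "- complex_of_real (exp x) - of_real p = - of_real (p + exp x)" by simp
      have "G (of_real x + - \<i> * of_real pi) = - (log_symbol \<alpha> (of_real x - \<i> * of_real pi) / of_real (p + exp x))"
        unfolding G_def log_symbol_def[symmetric] e1 d by (simp del: of_real_add)
      moreover have "G (of_real x + \<i> * of_real pi) = - (log_symbol \<alpha> (of_real x + \<i> * of_real pi) / of_real (p + exp x))"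
        unfolding G_def log_symbol_def[symmetric] e1 d by (simp del: of_real_add)
      moreover have "k x = (log_symbol \<alpha> (of_real x + \<i> * of_real pi) - log_symbol \<alpha> (of_real x - \<i> * of_real pi)) / of_real (p + exp x)"
        by (simp add: k_def spectral_density_def)
      ultimately show "G (of_real x + - \<i> * of_real pi) - G (of_real x + \<i> * of_real pi) = k x"
        by (simp add: diff_divide_distrib del: of_real_add)
    qed
    finally show "integral {- real N..real N} k = 2 * \<i> * of_real pi * R - side (real N) + side (- real N)"
      using * b t by simp
    show "G contour_integrable_on (linepath (Complex (real N) (-pi)) (Complex (real N) pi))"
      using ci(2) by (simp add: a2_def a3_def)
    show "G contour_integrable_on (linepath (Complex (- real N) (-pi)) (Complex (- real N) pi))"
      using ci(4) contour_integrable_reversepath[OF _ ci(4)] by (simp add: a1_def a4_def)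
  qed

  \<comment> \<open>On a vertical side the moduli of both exponentials are constant, and the reverse
    triangle inequality bounds the denominators. As c tends to \<infinity> the last factor decays
    like \<open>exp (- c)\<close>; as c tends to -\<infinity> the first decays like
    \<open>exp (\<alpha> * c)\<close>. The sides have fixed length 2\<pi>.\<close>
  define B where "B c = exp (\<alpha> * c) / \<bar>exp (\<alpha> * c) - 1\<bar> / \<bar>exp c - p\<bar>" for c
  have side_le: "norm (side c) \<le> B c * (2 * pi)"
    if int: "G contour_integrable_on linepath (Complex c (-pi)) (Complex c pi)" and c: "c \<noteq> 0" "\<bar>c\<bar> > \<bar>ln p\<bar>" for c
  proof -
    have cp: "exp c \<noteq> p" using c by auto
    have "norm (side c) \<le> B c * norm (Complex c pi - Complex c (-pi))"
      unfolding side_def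
    proof (rule contour_integral_bound_linepath[OF int])
      fix w assume "w \<in> closed_segment (Complex c (- pi)) (Complex c pi)"
      hence "Re w = c" by (simp add: closed_segment_same_Re)
      hence n: "norm (exp (of_real \<alpha> * w)) = exp (\<alpha> * c)" "norm (exp w) = exp c" by simp_all
      have 1: "norm (exp (of_real \<alpha> * w) / (exp (of_real \<alpha> * w) - i_pow (- \<alpha>))) \<le> exp (\<alpha> * c) / \<bar>exp (\<alpha> * c) - 1\<bar>"
        using norm_sub_divide_le[of "i_pow (- \<alpha>)" "exp (of_real \<alpha> * w)"] n c \<alpha> by simp
      have 2: "\<bar>exp c - p\<bar> \<le> norm (exp w - of_real p)"
        using norm_triangle_ineq3[of "exp w" "of_real p"] n p by simp
      have "norm (G w) = norm (exp (of_real \<alpha> * w) / (exp (of_real \<alpha> * w) - i_pow (- \<alpha>))) / norm (exp w - of_real p)"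
        unfolding G_def by (rule norm_divide)
      also have "\<dots> \<le> B c" unfolding B_def by (rule frac_le[OF _ 1 _ 2]) (use cp in auto)
      finally show "norm (G w) \<le> B c" .
    qed (simp add: B_def)
    also have "norm (Complex c pi - Complex c (-pi)) = 2 * pi" by (simp add: cmod_def real_sqrt_mult)
    finally show ?thesis .
  qed
  have r0: "(\<lambda>N. side (real N)) \<longlonglongrightarrow> 0"
  proof (rule Lim_null_comparison)
    show "(\<lambda>N. B (real N) * (2 * pi)) \<longlonglongrightarrow> 0" unfolding B_def using \<alpha> p by real_asymp
    show "\<forall>\<^sub>F N in sequentially. norm (side (real N)) \<le> B (real N) * (2 * pi)"
      using eN by eventually_elim (rule side_le[OF cr], auto)
  qed
  have l0: "(\<lambda>N. side (- real N)) \<longlonglongrightarrow> 0"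
  proof (rule Lim_null_comparison)
    show "(\<lambda>N. B (- real N) * (2 * pi)) \<longlonglongrightarrow> 0" unfolding B_def using \<alpha> p by real_asymp
    show "\<forall>\<^sub>F N in sequentially. norm (side (- real N)) \<le> B (- real N) * (2 * pi)"
      using eN by eventually_elim (rule side_le[OF cl], auto)
  qed

  have ik: "integrable lborel k"
  proof -
    have "integrable lborel (\<lambda>x. spectral_density \<alpha> x / of_real (p + exp x))"
    proof (rule Bochner_Integration.integrable_bound)
      show "integrable lborel (\<lambda>x. spectral_density \<alpha> x / of_real p)"
        using integrable_spectral_density[OF \<alpha>] by simp
      have "norm (spectral_density \<alpha> x) / norm (p + exp x) \<le> norm (spectral_density \<alpha> x) / norm p" for x
        using p by (intro divide_left_mono) (auto intro!: mult_pos_pos add_pos_pos)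
      thus "AE x in lborel. norm (spectral_density \<alpha> x / of_real (p + exp x)) \<le> norm (spectral_density \<alpha> x / complex_of_real p)"
        by (simp add: norm_divide flip: of_real_add)
    qed simp
    thus ?thesis unfolding k_def[abs_def] by (rule integrable_mult_right)
  qed
  have "(\<lambda>N. \<integral>x. indicator {- real N..real N} x *\<^sub>R k x \<partial>lborel) \<longlonglongrightarrow> (\<integral>x. k x \<partial>lborel)"
  proof (rule integral_dominated_convergence)
    show "integrable lborel (\<lambda>x. norm (k x))" using ik by simp
    show "AE x in lborel. (\<lambda>N. indicator {- real N..real N} x *\<^sub>R k x) \<longlonglongrightarrow> k x"
    proof (intro AE_I2 tendsto_eventually)
      fix x :: real
      have "eventually (\<lambda>N. real N > \<bar>x\<bar>) sequentially"
        using filterlim_real_sequentially[unfolded filterlim_at_top_dense] by blast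
      thus "eventually (\<lambda>N. indicator {- real N..real N} x *\<^sub>R k x = k x) sequentially"
        by eventually_elim (auto simp: indicator_def abs_less_iff)
    qed
  qed (use ik in \<open>auto simp: indicator_def\<close>)
  also have "(\<lambda>N. \<integral>x. indicator {- real N..real N} x *\<^sub>R k x \<partial>lborel) = (\<lambda>N. integral {- real N..real N} k)"
  proof
    fix N :: nat
    have "set_integrable lborel {- real N..real N} k" unfolding set_integrable_def
      by (rule integrable_mult_indicator[OF _ ik]) auto
    from set_borel_integral_eq_integral(2)[OF this] 
    show "(\<integral>x. indicator {- real N..real N} x *\<^sub>R k x \<partial>lborel) = integral {- real N..real N} k"
      by (simp add: set_lebesgue_integral_def)
  qed
  finally have L1: "(\<lambda>N. integral {- real N..real N} k) \<longlonglongrightarrow> (\<integral>x. k x \<partial>lborel)" .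
  have "(\<lambda>N. 2 * \<i> * of_real pi * R - side (real N) + side (- real N)) \<longlonglongrightarrow> 2 * \<i> * of_real pi * R - 0 + 0"
    by (intro tendsto_intros r0 l0)
  moreover have "eventually (\<lambda>N. 2 * \<i> * of_real pi * R - side (real N) + side (- real N) = integral {- real N..real N} k) sequentially"
    using eN by eventually_elim (simp add: J)
  ultimately have L2: "(\<lambda>N. integral {- real N..real N} k) \<longlonglongrightarrow> 2 * \<i> * of_real pi * R"
    by (simp add: filterlim_cong)
  from LIMSEQ_unique[OF L1 L2] ik have "has_bochner_integral lborel k (2 * \<i> * of_real pi * R)"
    by (simp add: has_bochner_integral_iff)
  hence "has_bochner_integral lborel (\<lambda>x. (1 / (2 * \<i> * of_real pi)) * k x) ((1 / (2 * \<i> * of_real pi)) * (2 * \<i> * of_real pi * R))"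
    by (rule has_bochner_integral_mult_right)
  thus ?thesis unfolding R_def[symmetric] by (simp add: k_def)
qed

section \<open>Spectral representation on the critical ray\<close>

text \<open>Lerch's theorem. In the variable \<open>x = e\<^sup>-\<^sup>t\<close> the hypothesis says that all moments of a
  continuous function on \<open>[0,1]\<close> vanish.\<close>

lemma Laplace_unique_real:
  fixes f :: "real \<Rightarrow> real"
  assumes cont: "continuous_on {0..} f"
    and bd: "\<And>t. t \<ge> 0 \<Longrightarrow> \<bar>f t\<bar> \<le> M * exp (c * t)"
    and lap: "\<And>n::nat. real n > c \<Longrightarrow> (\<integral>t. indicator {0<..} t *\<^sub>R (exp (- real n * t) * f t) \<partial>lborel) = 0"
    and t: "t \<ge> 0"
  shows "f t = 0"
proof -
  \<comment> \<open>The weight \<open>x ^ m\<close> absorbs the exponential growth of f; the extra 1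
    makes \<open>h\<close> of order x at 0, hence continuous there.\<close>
  obtain m :: nat where m: "real m \<ge> c + 1" using real_arch_simple by blast
  have M: "M \<ge> 0" using bd[of 0] abs_ge_zero[of "f 0"] by simp
  define h where "h x = (if x \<le> 0 then 0 else x ^ m * f (- ln x))" for x
  have h_exp: "h (exp (- t)) = exp (- real m * t) * f t" for t
    by (simp add: h_def exp_of_nat_mult[symmetric])
  have h_bd: "\<bar>h x\<bar> \<le> M * x" if "x \<in> {0..1}" for x
  proof (cases "x = 0")
    case False
    with that have x: "0 < x" "x \<le> 1" by auto
    define s where "s = - ln x"
    have s: "s \<ge> 0" "x = exp (- s)" using x by (auto simp: s_def)
    have "\<bar>h x\<bar> = exp (- real m * s) * \<bar>f s\<bar>" unfolding s(2) h_exp by (simp add: abs_mult)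
    also have "\<dots> \<le> exp (- real m * s) * (M * exp (c * s))" using bd[OF s(1)] by (intro mult_left_mono) auto
    also have "\<dots> = M * exp ((c - real m) * s)" by (simp add: mult_exp_exp algebra_simps)
    also have "\<dots> \<le> M * exp (- s)"
      using M m s mult_right_mono[of "c - real m" "-1" s] by (intro mult_left_mono) auto
    finally show ?thesis using s by simp
  qed (auto simp: h_def)
  have h_cont: "continuous_on {0..1} h"
    unfolding continuous_on_sequentially o_def
  proof (intro allI ballI impI; elim conjE)
    fix X x assume X: "\<forall>n. X n \<in> {0..1}" "x \<in> {0..1::real}" "X \<longlonglongrightarrow> x"
    show "(\<lambda>n. h (X n)) \<longlonglongrightarrow> h x"
    proof (cases "x = 0")
      case True
      have "(\<lambda>n. h (X n)) \<longlonglongrightarrow> 0"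
      proof (rule Lim_null_comparison)
        show "(\<lambda>n. M * X n) \<longlonglongrightarrow> 0" using tendsto_mult_left[OF X(3), of M] True by simp
        show "\<forall>\<^sub>F n in sequentially. norm (h (X n)) \<le> M * X n"
          using X(1) h_bd by (intro always_eventually allI) auto
      qed
      thus ?thesis using True by (simp add: h_def)
    next
      case False
      with X have x: "x > 0" "x \<le> 1" by auto
      have ev: "\<forall>\<^sub>F n in sequentially. X n > 0" using order_tendstoD(1)[OF X(3) x(1)] .
      have "(\<lambda>n. f (- ln (X n))) \<longlonglongrightarrow> f (- ln x)"
      proof (rule continuous_on_tendsto_compose[OF cont])
        show "(\<lambda>n. - ln (X n)) \<longlonglongrightarrow> - ln x" using X(3) x by (intro tendsto_intros) auto
        show "\<forall>\<^sub>F n in sequentially. - ln (X n) \<in> {0..}"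
          using ev by eventually_elim (use X(1) in auto)
      qed (use x in auto)
      hence "(\<lambda>n. X n ^ m * f (- ln (X n))) \<longlonglongrightarrow> x ^ m * f (- ln x)"
        using X(3) by (intro tendsto_intros)
      also have "x ^ m * f (- ln x) = h x" using x by (simp add: h_def)
      finally show ?thesis
        by (rule Lim_transform_eventually) (use ev in eventually_elim, simp add: h_def)
    qed
  qed
  \<comment> \<open>E is the Jacobian of \<open>x = exp (- t)\<close>. Integrals over [0,1] are
    written in the variable t throughout, so no change of variables is ever performed.\<close>
  define E where "E t = indicator {0<..} t *\<^sub>R exp (- t)" for t :: real
  have E: "has_bochner_integral lborel E 1"
  proof -
    have "(\<lambda>s::real. indicator {0<..} s *\<^sub>R (s powr (1 - 1) * exp (- 1 * s))) = E"
      by (auto simp: fun_eq_iff indicator_def E_def)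
    thus ?thesis using has_bochner_integral_Gamma_kernel[of 1 1] by simp
  qed
  have E01: "exp (- t) \<in> {0..1}" if "E t \<noteq> 0" for t using that by (auto simp: E_def indicator_def)
  have int: "integrable lborel (\<lambda>t. E t * g (exp (- t)))" if g: "continuous_on {0..1} g" for g :: "real \<Rightarrow> real"
  proof -
    obtain K where K: "\<And>x. x \<in> {0..1} \<Longrightarrow> \<bar>g x\<bar> \<le> K"
      using compact_imp_bounded[OF compact_continuous_image[OF g compact_Icc]]
      unfolding bounded_iff by (metis imageI real_norm_def)
    show ?thesis
    proof (rule Bochner_Integration.integrable_bound)
    show "integrable lborel (\<lambda>t. K * E t)" using E by (simp add: has_bochner_integral_iff)
    show "AE t in lborel. norm (E t * g (exp (- t))) \<le> norm (K * E t)"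
    proof (intro AE_I2)
      fix t
      show "norm (E t * g (exp (- t))) \<le> norm (K * E t)"
      proof (cases "E t = 0")
        case False
        from K[OF E01[OF False]] have "\<bar>g (exp (- t))\<bar> \<le> \<bar>K\<bar>" by linarith
        hence "\<bar>E t\<bar> * \<bar>g (exp (- t))\<bar> \<le> \<bar>E t\<bar> * \<bar>K\<bar>" by (intro mult_left_mono) auto
        thus ?thesis by (simp add: abs_mult mult.commute)
      qed simp
    qed
    have "(\<lambda>t. indicator {0<..} t *\<^sub>R (exp (- t) * g (exp (- t)))) \<in> borel_measurable borel"
      by (intro borel_measurable_continuous_on_indicator continuous_intros continuous_on_compose2[OF g]) auto
    also have "(\<lambda>t. indicator {0<..} t *\<^sub>R (exp (- t) * g (exp (- t)))) = (\<lambda>t. E t * g (exp (- t)))"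
      by (simp add: E_def mult_ac)
    finally show "(\<lambda>t. E t * g (exp (- t))) \<in> borel_measurable lborel" by simp
    qed
  qed
  have moment: "(\<integral>t. E t * (h (exp (- t)) * exp (- t) ^ i) \<partial>lborel) = 0" for i
  proof -
    have "E t * (h (exp (- t)) * exp (- t) ^ i) = indicator {0<..} t *\<^sub>R (exp (- real (1 + m + i) * t) * f t)" for t
      by (simp add: E_def h_exp exp_of_nat_mult[symmetric] mult_exp_exp algebra_simps indicator_def)
    thus ?thesis using lap[of "1 + m + i"] m by simp
  qed
  define I where "I = (\<integral>t. E t * (h (exp (- t)) * h (exp (- t))) \<partial>lborel)"
  have ih: "integrable lborel (\<lambda>t. E t * (h (exp (- t)) * h (exp (- t))))"
    by (rule int) (intro continuous_intros h_cont)
  \<comment> \<open>As h is orthogonal to all polynomials, I is also the integral of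
    \<open>h * (h - q)\<close> for any polynomial q, and this is small when q approximates h
    uniformly. Dividing by \<open>M + 1\<close> covers the case M = 0.\<close>
  have "I \<le> 0 + e" if e: "e > 0" for e
  proof -
    define e' where "e' = e / (M + 1)"
    have e': "e' > 0" using e M by (simp add: e'_def)
    obtain q where q: "real_polynomial_function q" "\<And>x. x \<in> {0..1} \<Longrightarrow> \<bar>h x - q x\<bar> < e'"
      using Stone_Weierstrass_real_polynomial_function[OF compact_Icc h_cont e'] by metis
    obtain a n where an: "q = (\<lambda>x. \<Sum>i\<le>n. a i * x ^ i)"
      using q(1) by (auto simp: real_polynomial_function_iff_sum)
    have iq: "integrable lborel (\<lambda>t. E t * (h (exp (- t)) * q (exp (- t))))"
      unfolding an by (rule int) (intro continuous_intros h_cont)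
    have "(\<integral>t. E t * (h (exp (- t)) * q (exp (- t))) \<partial>lborel) = 
        (\<integral>t. (\<Sum>i\<le>n. a i * (E t * (h (exp (- t)) * exp (- t) ^ i))) \<partial>lborel)"
      unfolding an by (simp add: sum_distrib_left mult_ac)
    also have "\<dots> = (\<Sum>i\<le>n. a i * (\<integral>t. E t * (h (exp (- t)) * exp (- t) ^ i) \<partial>lborel))"
      by (subst Bochner_Integration.integral_sum) (intro integrable_mult_right int continuous_intros h_cont | simp)+
    finally have 0: "(\<integral>t. E t * (h (exp (- t)) * q (exp (- t))) \<partial>lborel) = 0" using moment by simp
    have "I = (\<integral>t. E t * (h (exp (- t)) * h (exp (- t))) - E t * (h (exp (- t)) * q (exp (- t))) \<partial>lborel)"
      using ih iq 0 by (simp add: I_def)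
    also have "\<dots> \<le> (\<integral>t. (M * e') * E t \<partial>lborel)"
    proof (rule integral_mono)
      fix t
      show "E t * (h (exp (- t)) * h (exp (- t))) - E t * (h (exp (- t)) * q (exp (- t))) \<le> (M * e') * E t"
      proof (cases "E t = 0")
        case False
        define x where "x = exp (- t)"
        have x: "x \<in> {0..1}" using E01[OF False] by (simp add: x_def)
        have Ep: "E t \<ge> 0" by (simp add: E_def)
        have "h x * (h x - q x) \<le> \<bar>h x\<bar> * \<bar>h x - q x\<bar>" by (metis abs_ge_self abs_mult)
        also have "\<dots> \<le> (M * x) * e'" using h_bd[OF x] q(2)[OF x] M x by (intro mult_mono) auto
        also have "\<dots> \<le> M * e'" using x M e' by (simp add: mult_left_le mult_left_mono mult_ac)
        finally have "E t * (h x * (h x - q x)) \<le> E t * (M * e')" using Ep by (intro mult_left_mono)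
        thus ?thesis by (simp add: x_def algebra_simps)
      qed simp
    qed (use ih iq E in \<open>auto simp: has_bochner_integral_iff\<close>)
    also have "\<dots> = M * e'" using E by (simp add: has_bochner_integral_iff)
    also have "\<dots> \<le> e" using M e by (simp add: e'_def field_simps)
    finally show ?thesis by simp
  qed
  hence I0: "I \<le> 0" by (rule field_le_epsilon)
  define F where "F t = exp (- t) * (exp (- real m * t) * f t)\<^sup>2" for t
  have Fcont: "continuous_on {0..} F" unfolding F_def[abs_def] by (intro continuous_intros cont)
  have EF: "E t * (h (exp (- t)) * h (exp (- t))) = indicator {0<..} t *\<^sub>R F t" for t
    by (simp add: E_def F_def h_exp power2_eq_square)
  have F0: "F t \<ge> 0" for t by (simp add: F_def)
  \<comment> \<open>A nonnegative continuous function with vanishing integral is zero. The interval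
    reaches to t + 1 so that it is nondegenerate even for t = 0.\<close>
  have "F t = 0"
  proof (rule has_integral_0_cbox_imp_0[of 0 "t + 1" F t])
    have c: "continuous_on {0..t + 1} F" by (rule continuous_on_subset[OF Fcont]) auto
    have si: "set_integrable lborel {0..t + 1} F" by (rule borel_integrable_atLeastAtMost'[OF c])
    have "(LINT t:{0..t + 1}|lborel. F t) \<le> I"
      unfolding I_def set_lebesgue_integral_def
    proof (rule integral_mono_AE)
      show "AE s in lborel. indicat_real {0..t + 1} s *\<^sub>R F s \<le> E s * (h (exp (- s)) * h (exp (- s)))"
        using AE_lborel_singleton[of 0] unfolding EF
        by eventually_elim (auto simp: indicator_def F0)
    qed (use si ih in \<open>auto simp: set_integrable_def\<close>)
    moreover have "(LINT t:{0..t + 1}|lborel. F t) \<ge> 0"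
      unfolding set_lebesgue_integral_def by (rule integral_nonneg_AE) (auto simp: F0)
    ultimately have "(LINT t:{0..t + 1}|lborel. F t) = 0" using I0 by simp
    thus "(F has_integral 0) (cbox 0 (t + 1))"
      using set_borel_integral_eq_integral[OF si] by (simp add: has_integral_iff)
  qed (use t F0 Fcont in \<open>auto intro: continuous_on_subset\<close>)
  thus ?thesis by (simp add: F_def)
qed

lemma Laplace_unique:
  fixes f :: "real \<Rightarrow> complex"
  assumes cont: "continuous_on {0..} f"
    and bd: "\<And>t. t \<ge> 0 \<Longrightarrow> norm (f t) \<le> M * exp (c * t)"
    and lap: "\<And>n::nat. real n > c \<Longrightarrow> has_bochner_integral lborel (\<lambda>t. indicator {0<..} t *\<^sub>R (of_real (exp (- real n * t)) * f t)) 0"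
    and t: "t \<ge> 0"
  shows "f t = 0"
proof (rule complex_eqI)
  show "Re (f t) = Re 0" unfolding zero_complex.sel
  proof (rule Laplace_unique_real[where f = "\<lambda>t. Re (f t)" and M = M and c = c])
    fix n :: nat assume "real n > c"
    from has_bochner_integral_Re[OF lap[OF this]]
    show "(\<integral>t. indicator {0<..} t *\<^sub>R (exp (- real n * t) * Re (f t)) \<partial>lborel) = 0"
      by (simp add: has_bochner_integral_iff)
  qed (use cont t in \<open>auto intro!: continuous_intros order.trans[OF abs_Re_le_cmod bd]\<close>)
  show "Im (f t) = Im 0" unfolding zero_complex.sel
  proof (rule Laplace_unique_real[where f = "\<lambda>t. Im (f t)" and M = M and c = c])
    fix n :: nat assume "real n > c"
    from has_bochner_integral_Im[OF lap[OF this]]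
    show "(\<integral>t. indicator {0<..} t *\<^sub>R (exp (- real n * t) * Im (f t)) \<partial>lborel) = 0"
      by (simp add: has_bochner_integral_iff)
  qed (use cont t in \<open>auto intro!: continuous_intros order.trans[OF abs_Im_le_cmod bd]\<close>)
qed

text \<open>The lower bound on Gamma is taken at 2t instead of t; the surplus factor
  \<open>(2 powr \<alpha>) ^ k\<close> makes the remaining series geometric. The estimate only
  serves to place the function within reach of Laplace uniqueness.\<close>

lemma norm_mittag_leffler_1_le_exp:
  assumes \<alpha>: "\<alpha> > 0" and t: "t \<ge> 0" and c: "norm c = 1"
  shows "norm (mittag_leffler \<alpha> 1 (c * of_real (t powr \<alpha>))) \<le> (\<Sum>k. (1 / 2 powr \<alpha>) ^ k) * exp (2 * t)"
proof -
  note sm = summable_mittag_leffler_1(1)[OF \<alpha>, of "c * of_real (t powr \<alpha>)"]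
  have q: "1 / 2 powr \<alpha> < 1" using \<alpha> by (simp add: field_simps gr_one_powr)
  have sg: "summable (\<lambda>k. (1 / 2 powr \<alpha>) ^ k)" by (rule summable_geometric) (use q in simp)
  have "norm (mittag_leffler \<alpha> 1 (c * of_real (t powr \<alpha>))) \<le> 
     (\<Sum>k. norm ((c * of_real (t powr \<alpha>)) ^ k / of_real (Gamma (\<alpha> * real k + 1))))"
    unfolding mittag_leffler_def by (rule summable_norm[OF sm])
  also have "\<dots> \<le> (\<Sum>k. (1 / 2 powr \<alpha>) ^ k * exp (2 * t))"
  proof (rule suminf_le[OF _ sm])
    fix k
    have G: "Gamma (\<alpha> * real k + 1) > 0" using \<alpha> by (intro Gamma_real_pos) (auto intro: add_nonneg_pos)
    have "(t powr \<alpha>) ^ k * (2 powr \<alpha>) ^ k \<le> exp (2 * t) * Gamma (\<alpha> * real k + 1)"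
    \<comment> \<open>The point t = 0 is separate because \<open>0 ^ 0 = 1\<close> whereas
      \<open>0 powr 0 = 0\<close>.\<close>
    proof (cases "t = 0")
      case True
      have "(0::real) ^ k * (2 powr \<alpha>) ^ k \<le> exp 0 * Gamma (\<alpha> * real k + 1)"
        using G by (cases k) auto
      thus ?thesis using True \<alpha> by simp
    next
      case False
      hence "(t powr \<alpha>) ^ k * (2 powr \<alpha>) ^ k = (2 * t) powr (\<alpha> * real k)"
        using t by (simp add: powr_powr[symmetric] powr_realpow powr_mult power_mult_distrib)
      also have "\<dots> \<le> exp (2 * t) * Gamma (\<alpha> * real k + 1)"
        by (rule powr_le_exp_mult_Gamma) (use \<alpha> t in auto)
      finally show ?thesis .
    qed
    thus "norm ((c * of_real (t powr \<alpha>)) ^ k / of_real (Gamma (\<alpha> * real k + 1))) \<le> (1 / 2 powr \<alpha>) ^ k * exp (2 * t)"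
      using G c by (simp add: norm_divide norm_power norm_mult field_simps power_divide)
  qed (intro summable_mult2 sg)
  also have "\<dots> = (\<Sum>k. (1 / 2 powr \<alpha>) ^ k) * exp (2 * t)" by (rule suminf_mult2[OF sg, symmetric])
  finally show ?thesis .
qed

text \<open>The Gamma integrals cancel all coefficients and leave a geometric series in
  \<open>c / p powr \<alpha>\<close>, of modulus below 1 because p > 1 and |c| = 1.\<close>

lemma Laplace_mittag_leffler:
  assumes \<alpha>: "\<alpha> > 0" and p: "p > 1" and c: "norm c = 1"
  shows "has_bochner_integral lborel
     (\<lambda>t. indicator {0<..} t *\<^sub>R (of_real (exp (- p * t)) * mittag_leffler \<alpha> 1 (c * of_real (t powr \<alpha>))))
     (1 / of_real p * (1 / (1 - c / of_real (p powr \<alpha>))))"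
proof -
  define A where "A k = c ^ k / of_real (Gamma (\<alpha> * real k + 1))" for k
  define h where "h k t = indicator {0<..} t *\<^sub>R (t powr (\<alpha> * real k + 1 - 1) * exp (- p * t))" for k t
  define B where "B k = Gamma (\<alpha> * real k + 1) / p powr (\<alpha> * real k + 1)" for k
  define f where "f k t = A k * of_real (h k t)" for k t
  have G: "Gamma (\<alpha> * real k + 1) > 0" for k using \<alpha> by (intro Gamma_real_pos) (auto intro: add_nonneg_pos)
  have h: "has_bochner_integral lborel (h k) (B k)" for k
    unfolding h_def[abs_def] B_def by (rule has_bochner_integral_Gamma_kernel) (use \<alpha> p in \<open>auto intro: add_nonneg_pos\<close>)
  have hn: "h k r \<ge> 0" for k r by (auto simp: h_def)
  have pw: "f k t = (indicator {0<..} t * exp (- p * t)) *\<^sub>R 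
      ((c * of_real (t powr \<alpha>)) ^ k / of_real (Gamma (\<alpha> * real k + 1)))" for k t
  proof (cases "t > 0")
    case True
    have "t powr (\<alpha> * real k) = (t powr \<alpha>) ^ k"
      using True by (simp add: powr_realpow[symmetric] powr_powr)
    thus ?thesis by (auto simp: f_def h_def A_def scaleR_conv_of_real power_mult_distrib)
  qed (auto simp: f_def h_def)
  have pa: "p powr (\<alpha> * real k + 1) = p * (p powr \<alpha>) ^ k" for k
    using p by (simp add: powr_add powr_powr[symmetric] powr_realpow)
  have AB: "A k * of_real (B k) = 1 / of_real p * (c / of_real (p powr \<alpha>)) ^ k" for k
    using G[of k] by (simp add: A_def B_def pa power_divide)
  have "p powr \<alpha> > 1" using \<alpha> p by (simp add: gr_one_powr)
  hence q: "norm (c / of_real (p powr \<alpha>)) < 1" using c by (simp add: norm_divide divide_less_eq)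
  have s: "summable (\<lambda>k. norm (A k * of_real (B k)))"
    unfolding AB norm_mult norm_power by (intro summable_mult summable_geometric) (use q in simp)
  have "summable (\<lambda>k. norm (A k * of_real (h k t)))" for t
    unfolding f_def[symmetric] pw norm_scaleR by (intro summable_mult summable_mittag_leffler_1 \<alpha>)
  from has_bochner_integral_nonneg_series[OF h hn this s]
  have I: "has_bochner_integral lborel (\<lambda>t. \<Sum>k. f k t) (\<Sum>k. A k * of_real (B k))" unfolding f_def .
  have e1: "(\<Sum>k. f k t) = indicator {0<..} t *\<^sub>R (of_real (exp (- p * t)) * mittag_leffler \<alpha> 1 (c * of_real (t powr \<alpha>)))" for t
  proof -
    have "(\<Sum>k. f k t) = (indicator {0<..} t * exp (- p * t)) *\<^sub>R mittag_leffler \<alpha> 1 (c * of_real (t powr \<alpha>))"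
      unfolding pw mittag_leffler_def
      by (rule suminf_scaleR_right[symmetric, OF summable_mittag_leffler_1(2)[OF \<alpha>]])
    thus ?thesis by (simp add: scaleR_conv_of_real)
  qed
  have "(\<Sum>k. A k * of_real (B k)) = 1 / of_real p * (1 / (1 - c / of_real (p powr \<alpha>)))"
    unfolding AB using q by (simp only: suminf_mult[OF summable_geometric] suminf_geometric)
  with I show ?thesis unfolding e1 by simp
qed

lemma Laplace_mittag_leffler_ray:
  assumes \<alpha>: "\<alpha> > 0" and p: "p > 1"
  shows "has_bochner_integral lborel
     (\<lambda>t. indicator {0<..} t *\<^sub>R (of_real (exp (- p * t)) * mittag_leffler \<alpha> 1 (i_pow (- \<alpha>) * of_real (t powr \<alpha>))))
     (log_symbol \<alpha> (of_real (ln p)) / of_real p)"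
proof -
  have ea: "exp (of_real \<alpha> * of_real (ln p)) = complex_of_real (p powr \<alpha>)"
    using p by (simp add: powr_def exp_of_real[symmetric])
  have "1 - i_pow (- \<alpha>) / of_real (p powr \<alpha>) = (of_real (p powr \<alpha>) - i_pow (- \<alpha>)) / of_real (p powr \<alpha>)"
    using p by (subst diff_divide_distrib) simp
  thus ?thesis
    using Laplace_mittag_leffler[OF \<alpha> p, of "i_pow (- \<alpha>)"] unfolding log_symbol_def ea by (simp add: mult.commute)
qed

text \<open>With \<alpha> = 1 and c = -i the transform just computed also covers the
  oscillation.\<close>

lemma mittag_leffler_1_1: "mittag_leffler 1 1 z = exp z"
proof -
  have "Gamma (1 + real k) = fact k" for k using Gamma_fact[of k, where 'a = real] by simp
  thus ?thesis
    by (simp add: mittag_leffler_def exp_def scaleR_conv_of_real divide_inverse add.commute mult.commute)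
qed

lemma Laplace_exp_minus_i:
  assumes p: "p > 1"
  shows "has_bochner_integral lborel
     (\<lambda>t. indicator {0<..} t *\<^sub>R (of_real (exp (- p * t)) * exp (- \<i> * of_real t))) (1 / (of_real p + \<i>))"
proof -
  have "has_bochner_integral lborel
     (\<lambda>t. indicator {0<..} t *\<^sub>R (of_real (exp (- p * t)) * exp (- \<i> * of_real (t powr 1)))) (1 / of_real p * (1 / (1 - - \<i> / of_real (p powr 1))))"
    using Laplace_mittag_leffler[of 1 p "- \<i>"] p by (simp add: mittag_leffler_1_1)
  also have "(\<lambda>t. indicator {0<..} t *\<^sub>R (of_real (exp (- p * t)) * exp (- \<i> * of_real (t powr 1)))) = 
     (\<lambda>t. indicator {0<..} t *\<^sub>R (of_real (exp (- p * t)) * exp (- \<i> * of_real t)))"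
    by (auto simp: fun_eq_iff indicator_def)
  also have "1 - - \<i> / of_real (p powr 1) = (of_real p + \<i>) / of_real p"
    using p by (simp add: add_divide_distrib)
  finally show ?thesis using p by simp
qed

section \<open>The cut integral and its Laplace transform\<close>

lemma continuous_on_mittag_leffler_powr:
  assumes "\<alpha> > 0"
  shows "continuous_on {0..} (\<lambda>t. mittag_leffler \<alpha> 1 (c * of_real (t powr \<alpha>)))"
  using assms by (intro continuous_intros continuous_on_powr') auto

text \<open>In the variable \<open>r = exp x\<close> this is the integral of
  \<open>exp (- r * t) * K r\<close> over r > 0; the Jacobian r is part of
  \<open>spectral_density\<close>.\<close>

definition spectral_part :: "real \<Rightarrow> real \<Rightarrow> complex" where
  "spectral_part \<alpha> t = (\<integral>x. of_real (exp (- t * exp x)) * spectral_density \<alpha> x \<partial>lborel)"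

context
  fixes \<alpha> :: real
  assumes \<alpha>: "0 < \<alpha>" "\<alpha> < 1"
begin

lemma integrable_spectral_part:
  assumes t: "t \<ge> 0"
  shows "integrable lborel (\<lambda>x. of_real (exp (- t * exp x)) * spectral_density \<alpha> x)"
  by (rule Bochner_Integration.integrable_bound[OF integrable_spectral_density[OF \<alpha>]])
     (use t in \<open>auto simp: norm_mult intro!: mult_left_le_one_le\<close>)

lemma norm_spectral_part_le:
  assumes t: "t \<ge> 0"
  shows "norm (spectral_part \<alpha> t) \<le> (\<integral>x. norm (spectral_density \<alpha> x) \<partial>lborel)"
  unfolding spectral_part_def
  by (rule Bochner_Integration.integral_norm_bound_integral[OF integrable_spectral_part[OF t] integrable_norm[OF integrable_spectral_density[OF \<alpha>]]])
     (use t in \<open>auto simp: norm_mult intro!: mult_left_le_one_le\<close>)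

lemma continuous_on_spectral_part: "continuous_on {0..} (spectral_part \<alpha>)"
  unfolding continuous_on_sequentially o_def
proof (intro allI ballI impI; elim conjE)
  fix X t assume X: "\<forall>n. X n \<in> {0..}" "t \<in> {0..}" "X \<longlonglongrightarrow> (t::real)"
  show "(\<lambda>n. spectral_part \<alpha> (X n)) \<longlonglongrightarrow> spectral_part \<alpha> t"
    unfolding spectral_part_def
  proof (rule integral_dominated_convergence)
    show "integrable lborel (\<lambda>x. norm (spectral_density \<alpha> x))" using integrable_spectral_density[OF \<alpha>] by simp
    show "AE x in lborel. (\<lambda>n. of_real (exp (- X n * exp x)) * spectral_density \<alpha> x) \<longlonglongrightarrow> of_real (exp (- t * exp x)) * spectral_density \<alpha> x"
      by (intro AE_I2 tendsto_intros X)
    show "AE x in lborel. norm (of_real (exp (- X n * exp x)) * spectral_density \<alpha> x) \<le> norm (spectral_density \<alpha> x)" for n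
      using X(1) by (auto simp: norm_mult intro!: mult_left_le_one_le)
  qed auto
qed

text \<open>By Fubini the transform in t acts on \<open>exp (- t * exp x)\<close> alone and gives
  \<open>1 / (p + exp x)\<close>, which is the kernel evaluated by the contour. The Stieltjes
  integral also supplies the absolute integrability.\<close>

lemma Laplace_spectral_part:
  assumes p: "p > 0"
  shows "has_bochner_integral lborel (\<lambda>t. indicator {0<..} t *\<^sub>R (of_real (exp (- p * t)) * spectral_part \<alpha> t))
     (log_symbol \<alpha> (of_real (ln p)) / of_real p - 1 / (of_real \<alpha> * (of_real p + \<i>)))"
proof -
  define F where "F x t = of_real (indicator {0<..} t * exp (- p * t) * exp (- t * exp x)) * spectral_density \<alpha> x" for x t :: real
  have Fm: "(\<lambda>z. F (fst z) (snd z)) \<in> borel_measurable (lborel \<Otimes>\<^sub>M lborel)"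
    unfolding F_def by measurable
  have ex: "p + exp x > 0" for x using p by (simp add: add_pos_pos)
  have inner: "has_bochner_integral lborel (\<lambda>t. indicator {0<..} t * exp (- p * t) * exp (- t * exp x)) (1 / (p + exp x))" for x
  proof -
    have "has_bochner_integral lborel (\<lambda>t. indicator {0<..} t *\<^sub>R (t powr (1 - 1) * exp (- (p + exp x) * t))) (Gamma 1 / (p + exp x) powr 1)"
      by (rule has_bochner_integral_Gamma_kernel) (use ex in auto)
    also have "(\<lambda>t. indicator {0<..} t *\<^sub>R (t powr (1 - 1) * exp (- (p + exp x) * t))) = (\<lambda>t. indicator {0<..} t * exp (- p * t) * exp (- t * exp x))"
      by (auto simp: fun_eq_iff indicator_def mult_exp_exp algebra_simps)
    finally show ?thesis using ex[of x] by simp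
  qed
  have Fi: "has_bochner_integral lborel (F x) (spectral_density \<alpha> x / of_real (p + exp x))" for x
    using has_bochner_integral_mult_left[OF has_bochner_integral_of_real[OF inner[of x]], of "spectral_density \<alpha> x"]
    by (simp add: F_def[abs_def])
  have nFi: "has_bochner_integral lborel (\<lambda>t. norm (F x t)) (norm (spectral_density \<alpha> x / of_real (p + exp x)))" for x
  proof -
    have "(\<lambda>t. norm (F x t)) = (\<lambda>t. (indicator {0<..} t * exp (- p * t) * exp (- t * exp x)) * norm (spectral_density \<alpha> x))"
      by (auto simp: F_def norm_mult)
    moreover have "norm (spectral_density \<alpha> x / of_real (p + exp x)) = 1 / (p + exp x) * norm (spectral_density \<alpha> x)"
      unfolding norm_divide norm_of_real using ex[of x] by simp
    ultimately show ?thesis using has_bochner_integral_mult_left[OF inner[of x], of "norm (spectral_density \<alpha> x)"] by simp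
  qed
  note St = log_symbol_Stieltjes[OF \<alpha> p]
  have FF: "integrable (lborel \<Otimes>\<^sub>M lborel) (\<lambda>z. F (fst z) (snd z))"
  proof (rule lborel_pair.Fubini_integrable[OF Fm])
    show "integrable lborel (\<lambda>x. \<integral>t. norm (F (fst (x, t)) (snd (x, t))) \<partial>lborel)"
      unfolding fst_conv snd_conv has_bochner_integral_integral_eq[OF nFi]
      using St by (intro integrable_norm) (simp add: has_bochner_integral_iff)
    show "AE x in lborel. integrable lborel (\<lambda>t. F (fst (x, t)) (snd (x, t)))"
      using Fi by (simp add: has_bochner_integral_iff)
  qed
  hence FF': "integrable (lborel \<Otimes>\<^sub>M lborel) (case_prod F)" by (simp add: case_prod_beta')
  have Ft: "(\<integral>x. F x t \<partial>lborel) = indicator {0<..} t *\<^sub>R (of_real (exp (- p * t)) * spectral_part \<alpha> t)" for t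
    by (simp add: F_def spectral_part_def scaleR_conv_of_real mult.assoc)
  have "(\<integral>t. (\<integral>x. F x t \<partial>lborel) \<partial>lborel) = (\<integral>x. (\<integral>t. F x t \<partial>lborel) \<partial>lborel)"
    by (rule lborel_pair.Fubini_integral[OF FF'])
  also have "\<dots> = log_symbol \<alpha> (of_real (ln p)) / of_real p - 1 / (of_real \<alpha> * (of_real p + \<i>))"
    unfolding has_bochner_integral_integral_eq[OF Fi] by (rule has_bochner_integral_integral_eq[OF St])
  finally have 1: "(\<integral>t. (\<integral>x. F x t \<partial>lborel) \<partial>lborel) = log_symbol \<alpha> (of_real (ln p)) / of_real p - 1 / (of_real \<alpha> * (of_real p + \<i>))" .
  have "integrable lborel (\<lambda>t. \<integral>x. F x t \<partial>lborel)"
    by (rule lborel_pair.integrable_snd[OF FF'])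
  with 1 show ?thesis by (simp add: has_bochner_integral_iff Ft)
qed

text \<open>Both sides are continuous, bounded by a multiple of \<open>exp (2 * t)\<close>, and have
  the same Laplace transform at every integer above 2; the rate 2 comes from the a priori bound on
  the series.\<close>

lemma mittag_leffler_spectral:
  assumes t: "t \<ge> 0"
  shows "mittag_leffler \<alpha> 1 (i_pow (- \<alpha>) * of_real (t powr \<alpha>)) = exp (- \<i> * of_real t) / of_real \<alpha> + spectral_part \<alpha> t"
proof -
  define y where "y t = mittag_leffler \<alpha> 1 (i_pow (- \<alpha>) * of_real (t powr \<alpha>))" for t
  define f where "f t = y t - exp (- \<i> * of_real t) / of_real \<alpha> - spectral_part \<alpha> t" for t
  define K where "K = (\<integral>x. norm (spectral_density \<alpha> x) \<partial>lborel)"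
  define M where "M = (\<Sum>k. (1 / 2 powr \<alpha>) ^ k) + 1 / \<alpha> + K"
  have K: "K \<ge> 0" unfolding K_def by (rule integral_nonneg_AE) auto
  have "f t = 0"
  proof (rule Laplace_unique[where f = f and M = M and c = 2])
    show "continuous_on {0..} f"
      unfolding f_def[abs_def] y_def using \<alpha>
      by (intro continuous_on_diff continuous_on_mittag_leffler_powr continuous_on_spectral_part continuous_intros) auto
    fix t :: real assume t: "t \<ge> 0"
    have "norm (f t) \<le> norm (y t) + norm (exp (- \<i> * of_real t) / of_real \<alpha>) + norm (spectral_part \<alpha> t)"
      unfolding f_def by (intro norm_triangle_ineq4 order.trans[OF norm_triangle_ineq4] add_right_mono)
    also have "\<dots> \<le> (\<Sum>k. (1 / 2 powr \<alpha>) ^ k) * exp (2 * t) + 1 / \<alpha> * exp (2 * t) + K * exp (2 * t)"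
    proof (intro add_mono)
      show "norm (y t) \<le> (\<Sum>k. (1 / 2 powr \<alpha>) ^ k) * exp (2 * t)"
        unfolding y_def by (rule norm_mittag_leffler_1_le_exp) (use \<alpha> t in auto)
      show "norm (exp (- \<i> * of_real t) / of_real \<alpha>) \<le> 1 / \<alpha> * exp (2 * t)"
        using \<alpha> t by (simp add: norm_divide field_simps)
      have "norm (spectral_part \<alpha> t) \<le> K * 1" using norm_spectral_part_le[OF t] by (simp add: K_def)
      also have "\<dots> \<le> K * exp (2 * t)" using K t by (intro mult_left_mono) auto
      finally show "norm (spectral_part \<alpha> t) \<le> K * exp (2 * t)" .
    qed
    finally show "norm (f t) \<le> M * exp (2 * t)" by (simp add: M_def algebra_simps)
  next
    fix n :: nat assume n: "real n > 2"
    have "has_bochner_integral lborel (\<lambda>t. 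
          indicator {0<..} t *\<^sub>R (of_real (exp (- real n * t)) * y t) 
        - (indicator {0<..} t *\<^sub>R (of_real (exp (- real n * t)) * exp (- \<i> * of_real t))) / of_real \<alpha>
        - indicator {0<..} t *\<^sub>R (of_real (exp (- real n * t)) * spectral_part \<alpha> t))
        (log_symbol \<alpha> (of_real (ln (real n))) / of_real (real n) - (1 / (of_real (real n) + \<i>)) / of_real \<alpha>
         - (log_symbol \<alpha> (of_real (ln (real n))) / of_real (real n) - 1 / (of_real \<alpha> * (of_real (real n) + \<i>))))"
      unfolding y_def using n
      by (intro has_bochner_integral_diff has_bochner_integral_divide_zero Laplace_mittag_leffler_ray \<alpha> Laplace_exp_minus_i Laplace_spectral_part) auto
    also have "(\<lambda>t. 
          indicator {0<..} t *\<^sub>R (of_real (exp (- real n * t)) * y t) 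
        - (indicator {0<..} t *\<^sub>R (of_real (exp (- real n * t)) * exp (- \<i> * of_real t))) / of_real \<alpha>
        - indicator {0<..} t *\<^sub>R (of_real (exp (- real n * t)) * spectral_part \<alpha> t)) = 
       (\<lambda>t. indicator {0<..} t *\<^sub>R (of_real (exp (- real n * t)) * f t))"
      by (auto simp: f_def fun_eq_iff indicator_def algebra_simps diff_divide_distrib)
    finally show "has_bochner_integral lborel (\<lambda>t. indicator {0<..} t *\<^sub>R (of_real (exp (- real n * t)) * f t)) 0"
      by (simp add: mult.commute)
  qed (use t in auto)
  thus ?thesis by (simp add: f_def y_def algebra_simps)
qed

end

text \<open>The left-hand side is the majorant of the t-derivative of the cut integrand. The
  logistic factor is at most \<open>exp (- \<alpha> * x)\<close>, which leaves
  \<open>t powr (\<alpha> - 1) * v\<close>, and the exponential \<open>exp (- t * exp x)\<close>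
  restores decay for large v. The result depends on x only through \<open>ln t + x\<close>.\<close>

lemma exp_mult_logistic_le:
  fixes \<alpha> t x :: real
  assumes \<alpha>: "0 < \<alpha>" "\<alpha> < 1" and t: "t > 0"
  defines "v \<equiv> exp ((1 - \<alpha>) * (ln t + x))"
  shows "exp x * exp (- t * exp x) * (exp (\<alpha> * x) / (1 + exp (\<alpha> * x))\<^sup>2) \<le> 4 * t powr (\<alpha> - 1) * (v / (1 + v)\<^sup>2)"
proof -
  define u where "u = t * exp x"
  define q where "q = exp (\<alpha> * x)"
  have u: "u > 0" "ln u = ln t + x" using t by (auto simp: u_def ln_mult)
  have q: "q > 0" by (simp add: q_def)
  have v: "v > 0" by (simp add: v_def)
  have "q\<^sup>2 \<le> (1 + q)\<^sup>2" using q by (intro power_mono) auto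
  hence "q / (1 + q)\<^sup>2 \<le> q / q\<^sup>2" using q by (intro divide_left_mono) (auto intro!: mult_pos_pos zero_less_power)
  also have "\<dots> = exp (- (\<alpha> * x))" by (simp add: q_def power2_eq_square exp_minus inverse_eq_divide)
  finally have 1: "q / (1 + q)\<^sup>2 \<le> exp (- (\<alpha> * x))" .
  have "v \<le> 1 + u"
  proof (cases "ln u \<le> 0")
    case True
    hence "(1 - \<alpha>) * ln u \<le> 0" using \<alpha> by (simp add: mult_le_0_iff)
    hence "v \<le> 1" unfolding v_def u(2)[symmetric] by simp
    thus ?thesis using u by simp
  next
    case False
    hence "(1 - \<alpha>) * ln u \<le> 1 * ln u" using \<alpha> by (intro mult_right_mono) auto
    hence "v \<le> exp (ln u)" unfolding v_def u(2)[symmetric] by simp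
    thus ?thesis using u(1) by simp
  qed
  \<comment> \<open>Since v is u to a power between 0 and 1, it is at most 1 + u. So
    \<open>1 + v \<le> 2 * (1 + u / 2) \<le> 2 * exp (u / 2)\<close>, whose square is the origin of
    the constant 4.\<close>
  hence "(1 + v)\<^sup>2 \<le> (2 * (1 + u / 2))\<^sup>2" using v by (intro power_mono) auto
  also have "\<dots> = 4 * (1 + u / 2)\<^sup>2" by (simp only: power_mult_distrib) simp
  also have "\<dots> \<le> 4 * (exp (u / 2))\<^sup>2" using u by (intro mult_left_mono power_mono) auto
  also have "\<dots> = 4 * exp u" by (simp add: power2_eq_square mult_exp_exp)
  finally have "(1 + v)\<^sup>2 * exp (- u) \<le> 4 * exp u * exp (- u)" by (intro mult_right_mono) auto
  hence "(1 + v)\<^sup>2 * exp (- u) \<le> 4" unfolding mult.assoc mult_exp_exp by simp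
  hence "exp (- u) \<le> 4 / (1 + v)\<^sup>2" using v by (simp add: field_simps)
  hence 2: "v * exp (- u) \<le> v * (4 / (1 + v)\<^sup>2)" using v by (intro mult_left_mono) auto
  have "exp x * exp (- u) * (q / (1 + q)\<^sup>2) \<le> exp x * exp (- u) * exp (- (\<alpha> * x))"
    using 1 by (intro mult_left_mono) auto
  also have "\<dots> = t powr (\<alpha> - 1) * (v * exp (- u))"
    using t by (simp add: v_def powr_def mult_exp_exp algebra_simps)
  also have "\<dots> \<le> t powr (\<alpha> - 1) * (v * (4 / (1 + v)\<^sup>2))" by (rule mult_left_mono[OF 2]) simp
  finally show ?thesis by (simp add: u_def q_def mult_ac)
qed

text \<open>Increments are estimated through \<open>1 - exp (- h * r) \<le> h * r\<close>, which
  avoids differentiating under the integral sign; existence of the derivative is obtained elsewhere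
  from the power series.\<close>

lemma spectral_part_diff_le:
  assumes \<alpha>: "0 < \<alpha>" "\<alpha> < 1"
  obtains C where "C \<ge> 0"
    "\<And>t h. t > 0 \<Longrightarrow> h > 0 \<Longrightarrow> norm (spectral_part \<alpha> (t + h) - spectral_part \<alpha> t) \<le> h * (C * t powr (\<alpha> - 1))"
proof -
  obtain C0 where C0: "C0 > 0" "\<And>x. norm (spectral_density \<alpha> x) \<le> C0 * (exp (\<alpha> * x) / (1 + exp (\<alpha> * x))\<^sup>2)"
    using norm_spectral_density_le[OF \<alpha>] by metis
  define g where "g x = exp ((1 - \<alpha>) * x) / (1 + exp ((1 - \<alpha>) * x))\<^sup>2" for x
  have g: "integrable lborel g" unfolding g_def[abs_def] by (rule integrable_logistic) (use \<alpha> in auto)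
  have gn: "g x \<ge> 0" for x by (simp add: g_def)
  define C where "C = 4 * C0 * (\<integral>x. g x \<partial>lborel)"
  show ?thesis
  proof (rule that[of C])
    show "C \<ge> 0" unfolding C_def using C0 gn by (intro mult_nonneg_nonneg integral_nonneg_AE) auto
    fix t h :: real assume t: "t > 0" and h: "h > 0"
    \<comment> \<open>Time enters the majorant as a shift of x by \<open>ln t\<close>, which leaves
      the integral unchanged; only the factor \<open>t powr (\<alpha> - 1)\<close> remains.\<close>
    have gt: "integrable lborel (\<lambda>x. g (ln t + 1 * x))" by (rule lborel_integrable_real_affine[OF g]) simp
    have gt': "(\<integral>x. g (ln t + 1 * x) \<partial>lborel) = (\<integral>x. g x \<partial>lborel)"
      using lborel_integral_real_affine[of 1 g "ln t"] by simp
    have I1: "integrable lborel (\<lambda>x. of_real (exp (- (t + h) * exp x)) * spectral_density \<alpha> x)"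
      by (rule integrable_spectral_part[OF \<alpha>]) (use t h in simp)
    have I2: "integrable lborel (\<lambda>x. of_real (exp (- t * exp x)) * spectral_density \<alpha> x)"
      by (rule integrable_spectral_part[OF \<alpha>]) (use t in simp)
    have E: "spectral_part \<alpha> (t + h) - spectral_part \<alpha> t = 
      (\<integral>x. of_real (exp (- (t + h) * exp x)) * spectral_density \<alpha> x - of_real (exp (- t * exp x)) * spectral_density \<alpha> x \<partial>lborel)"
      unfolding spectral_part_def by (rule Bochner_Integration.integral_diff[OF I1 I2, symmetric])
    have "norm (spectral_part \<alpha> (t + h) - spectral_part \<alpha> t) \<le> (\<integral>x. (h * (4 * C0 * t powr (\<alpha> - 1))) * g (ln t + 1 * x) \<partial>lborel)"
      unfolding E
    proof (rule Bochner_Integration.integral_norm_bound_integral)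
      show "integrable lborel (\<lambda>x. of_real (exp (- (t + h) * exp x)) * spectral_density \<alpha> x - of_real (exp (- t * exp x)) * spectral_density \<alpha> x)"
        by (rule Bochner_Integration.integrable_diff[OF I1 I2])
      show "integrable lborel (\<lambda>x. (h * (4 * C0 * t powr (\<alpha> - 1))) * g (ln t + 1 * x))"
        using gt by (rule integrable_mult_right)
      fix x :: real
      have "of_real (exp (- (t + h) * exp x)) * spectral_density \<alpha> x - of_real (exp (- t * exp x)) * spectral_density \<alpha> x
        = of_real (exp (- t * exp x) * (exp (- (h * exp x)) - 1)) * spectral_density \<alpha> x"
        by (simp add: algebra_simps mult_exp_exp exp_add[symmetric] flip: of_real_mult)
      also have "norm \<dots> = exp (- t * exp x) * (1 - exp (- (h * exp x))) * norm (spectral_density \<alpha> x)"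
        unfolding norm_mult norm_of_real using h by (simp add: abs_mult)
      also have "\<dots> \<le> exp (- t * exp x) * (h * exp x) * (C0 * (exp (\<alpha> * x) / (1 + exp (\<alpha> * x))\<^sup>2))"
        using h C0 exp_ge_add_one_self[of "- (h * exp x)"] by (intro mult_mono) auto
      also have "\<dots> = h * C0 * (exp x * exp (- t * exp x) * (exp (\<alpha> * x) / (1 + exp (\<alpha> * x))\<^sup>2))" by simp
      also have "\<dots> \<le> h * C0 * (4 * t powr (\<alpha> - 1) * g (ln t + x))"
        unfolding g_def using h C0 exp_mult_logistic_le[OF \<alpha> t, of x] by (intro mult_left_mono) auto
      finally show "norm (of_real (exp (- (t + h) * exp x)) * spectral_density \<alpha> x - of_real (exp (- t * exp x)) * spectral_density \<alpha> x)
         \<le> (h * (4 * C0 * t powr (\<alpha> - 1))) * g (ln t + 1 * x)" by (simp add: mult_ac)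
    qed
    also have "\<dots> = (h * (4 * C0 * t powr (\<alpha> - 1))) * (\<integral>x. g (ln t + 1 * x) \<partial>lborel)" by (rule integral_mult_right_zero)
    also have "\<dots> = h * (C * t powr (\<alpha> - 1))" unfolding gt' C_def by simp
    finally show "norm (spectral_part \<alpha> (t + h) - spectral_part \<alpha> t) \<le> h * (C * t powr (\<alpha> - 1))" .
  qed
qed

text \<open>Increments to the right suffice, because the derivative is known to exist.\<close>

lemma norm_vector_derivative_le:
  fixes f :: "real \<Rightarrow> 'a::real_normed_vector"
  assumes f: "(f has_vector_derivative f') (at t)"
    and bd: "\<And>h. h > 0 \<Longrightarrow> norm (f (t + h) - f t) \<le> h * B"
  shows "norm f' \<le> B"
proof (rule field_le_epsilon)
  fix e :: real assume "e > 0"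
  then obtain d where d: "d > 0"
    "\<And>s. norm (s - t) < d \<Longrightarrow> norm (f s - f t - (s - t) *\<^sub>R f') \<le> e * norm (s - t)"
    using f unfolding has_vector_derivative_def has_derivative_at_alt by blast
  define h where "h = d / 2"
  have h: "h > 0" "h < d" using d by (auto simp: h_def)
  have "norm (h *\<^sub>R f') \<le> norm (f (t + h) - f t) + norm (f (t + h) - f t - h *\<^sub>R f')"
    using norm_triangle_ineq4[of "f (t + h) - f t" "f (t + h) - f t - h *\<^sub>R f'"] by simp
  also have "\<dots> \<le> h * B + e * h" using bd[OF h(1)] d(2)[of "t + h"] h by simp
  finally have "h * norm f' \<le> h * (B + e)" using h by (simp add: algebra_simps)
  thus "norm f' \<le> B + e" using h by simp
qed

text \<open>The cut integral is the difference of two functions differentiable for t > 0, so its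
  increment bound applies to its derivative. The oscillation contributes the constant
  \<open>1 / \<alpha>\<close>.\<close>

lemma norm_ml_density_unit_le:
  assumes \<alpha>: "0 < \<alpha>" "\<alpha> < 1"
  obtains C where "C \<ge> 0" "\<And>t. t \<ge> 0 \<Longrightarrow> norm (ml_density \<alpha> (i_pow (- \<alpha>)) t) \<le> 1 / \<alpha> + C * t powr (\<alpha> - 1)"
proof -
  obtain C where C: "C \<ge> 0"
    "\<And>t h. t > 0 \<Longrightarrow> h > 0 \<Longrightarrow> norm (spectral_part \<alpha> (t + h) - spectral_part \<alpha> t) \<le> h * (C * t powr (\<alpha> - 1))"
    using spectral_part_diff_le[OF \<alpha>] by metis
  show ?thesis
  proof (rule that[OF C(1)])
    fix t :: real assume "t \<ge> 0"
    show "norm (ml_density \<alpha> (i_pow (- \<alpha>)) t) \<le> 1 / \<alpha> + C * t powr (\<alpha> - 1)"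
    proof (cases "t = 0")
      case False
      with \<open>t \<ge> 0\<close> have t: "t > 0" by simp
      define e where "e = \<i> * exp (- \<i> * of_real t) / of_real \<alpha>"
      have "((\<lambda>z. exp (- \<i> * z) / of_real \<alpha>) has_field_derivative - e) (at (of_real t))"
        unfolding e_def using \<alpha> by (auto intro!: derivative_eq_intros)
      hence 1: "((\<lambda>t. exp (- \<i> * of_real t) / of_real \<alpha>) has_vector_derivative - e) (at t)"
        by (rule has_vector_derivative_real_field)
      have "((\<lambda>t. mittag_leffler \<alpha> 1 (i_pow (- \<alpha>) * of_real (t powr \<alpha>)) - exp (- \<i> * of_real t) / of_real \<alpha>) has_vector_derivative 
         ml_density \<alpha> (i_pow (- \<alpha>)) t - (- e)) (at t)"
        by (intro has_vector_derivative_diff 1 has_vector_derivative_mittag_leffler_powr \<alpha> t)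
      hence "(spectral_part \<alpha> has_vector_derivative ml_density \<alpha> (i_pow (- \<alpha>)) t - (- e)) (at t)"
      proof (rule has_vector_derivative_transform_within_open)
        show "open {0::real<..}" "t \<in> {0<..}" using t by auto
        fix s :: real assume "s \<in> {0<..}"
        thus "mittag_leffler \<alpha> 1 (i_pow (- \<alpha>) * of_real (s powr \<alpha>)) - exp (- \<i> * of_real s) / of_real \<alpha> = spectral_part \<alpha> s"
          using mittag_leffler_spectral[OF \<alpha>, of s] by simp
      qed
      hence "norm (ml_density \<alpha> (i_pow (- \<alpha>)) t - (- e)) \<le> C * t powr (\<alpha> - 1)"
        by (rule norm_vector_derivative_le) (rule C(2)[OF t])
      moreover have "norm e = 1 / \<alpha>" using \<alpha> by (simp add: e_def norm_divide norm_mult)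
      ultimately show ?thesis
        using norm_triangle_ineq4[of "ml_density \<alpha> (i_pow (- \<alpha>)) t - (- e)" e] by simp
    qed (use \<alpha> in \<open>simp add: ml_density_def\<close>)
  qed
qed

text \<open>Every x on the ray is \<open>t powr \<alpha>\<close> for some t, and the spectral
  formula is bounded in t: by \<open>1 / \<alpha>\<close> for the oscillation plus the L1 norm of
  the density. An eigenvalue merely moves the point along the ray, so the bound is uniform in
  it.\<close>

lemma norm_mittag_leffler_ray_le:
  assumes \<alpha>: "0 < \<alpha>" "\<alpha> < 1"
  obtains M where "M > 0" "\<And>x. x \<ge> 0 \<Longrightarrow> norm (mittag_leffler \<alpha> 1 (i_pow (- \<alpha>) * of_real x)) \<le> M"
proof -
  define K where "K = (\<integral>x. norm (spectral_density \<alpha> x) \<partial>lborel)"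
  have K: "K \<ge> 0" unfolding K_def by (rule integral_nonneg_AE) auto
  show ?thesis
  proof (rule that[of "1 / \<alpha> + K"])
    show "1 / \<alpha> + K > 0" using K \<alpha> by (simp add: add_pos_nonneg)
    fix x :: real assume x: "x \<ge> 0"
    define t where "t = x powr (1 / \<alpha>)"
    have t: "t \<ge> 0" "t powr \<alpha> = x" using x \<alpha> by (auto simp: t_def powr_powr)
    have "norm (mittag_leffler \<alpha> 1 (i_pow (- \<alpha>) * of_real x)) = norm (exp (- \<i> * of_real t) / of_real \<alpha> + spectral_part \<alpha> t)"
      using mittag_leffler_spectral[OF \<alpha> t(1)] t(2) by simp
    also have "\<dots> \<le> norm (exp (- \<i> * of_real t) / of_real \<alpha>) + norm (spectral_part \<alpha> t)" by (rule norm_triangle_ineq)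
    also have "\<dots> \<le> 1 / \<alpha> + K"
      using norm_spectral_part_le[OF \<alpha> t(1)] \<alpha> by (simp add: K_def norm_divide)
    finally show "norm (mittag_leffler \<alpha> 1 (i_pow (- \<alpha>) * of_real x)) \<le> 1 / \<alpha> + K" .
  qed
qed

text \<open>The chain rule for the rescaled time \<open>l powr (1 / \<alpha>) * t\<close>, in which
  the eigenvalue l is absorbed.\<close>

lemma ml_density_scale:
  assumes \<alpha>: "0 < \<alpha>" and l: "l > 0" and t: "t \<ge> 0"
  shows "ml_density \<alpha> (c * of_real l) t = of_real (l powr (1 / \<alpha>)) * ml_density \<alpha> c (l powr (1 / \<alpha>) * t)"
proof -
  define m where "m = l powr (1 / \<alpha>)"
  have m: "m > 0" using l by (simp add: m_def)
  have ma: "m powr \<alpha> = l" using l \<alpha> by (simp add: m_def powr_powr)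
  have "m * (m * t) powr (\<alpha> - 1) = l * t powr (\<alpha> - 1)"
    using m t by (simp add: powr_mult powr_diff ma)
  hence 1: "complex_of_real m * of_real ((m * t) powr (\<alpha> - 1)) = of_real l * of_real (t powr (\<alpha> - 1))"
    by (metis of_real_mult)
  have 2: "(m * t) powr \<alpha> = l * t powr \<alpha>" using m t by (simp add: powr_mult ma)
  have "of_real m * ml_density \<alpha> c (m * t) = c * (of_real m * of_real ((m * t) powr (\<alpha> - 1))) * mittag_leffler \<alpha> \<alpha> (c * of_real ((m * t) powr \<alpha>))"
    by (simp add: ml_density_def)
  also have "\<dots> = ml_density \<alpha> (c * of_real l) t"
    unfolding 1 2 by (simp add: ml_density_def mult_ac)
  finally show ?thesis by (simp add: m_def)
qed

text \<open>The growth of the density is the reason for the space \<open>H\<^bsub>-1/\<alpha>\<^esub>\<close>.\<close>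

lemma norm_ml_density_le:
  assumes \<alpha>: "0 < \<alpha>" "\<alpha> < 1" and l0: "l0 > 0"
  obtains C where "C > 0"
    "\<And>l t. l \<ge> l0 \<Longrightarrow> t \<ge> 0 \<Longrightarrow> norm (ml_density \<alpha> (i_pow (- \<alpha>) * of_real l) t) \<le> l powr (1 / \<alpha>) * (C * (1 + t powr (\<alpha> - 1)))"
proof -
  obtain C where C: "C \<ge> 0" "\<And>t. t \<ge> 0 \<Longrightarrow> norm (ml_density \<alpha> (i_pow (- \<alpha>)) t) \<le> 1 / \<alpha> + C * t powr (\<alpha> - 1)"
    using norm_ml_density_unit_le[OF \<alpha>] by metis
  \<comment> \<open>Factoring out \<open>l powr (1 / \<alpha>)\<close> leaves
    \<open>l powr (1 - 1 / \<alpha>)\<close> in the singular term. This exponent is negative, so the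
    factor is largest at the lower bound \<open>l0\<close>.\<close>
  define K where "K = 1 / \<alpha> + C * l0 powr (1 - 1 / \<alpha>)"
  have K: "K > 0" unfolding K_def using \<alpha> C by (intro add_pos_nonneg) auto
  show ?thesis
  proof (rule that[OF K])
    fix l t :: real assume l: "l \<ge> l0" and t: "t \<ge> 0"
    define m where "m = l powr (1 / \<alpha>)"
    have lp: "l > 0" using l l0 by simp
    have m: "m > 0" using lp by (simp add: m_def)
    have "(m * t) powr (\<alpha> - 1) = l powr (1 - 1 / \<alpha>) * t powr (\<alpha> - 1)"
      using m t lp \<alpha> by (simp add: powr_mult m_def powr_powr field_simps)
    also have "\<dots> \<le> l0 powr (1 - 1 / \<alpha>) * t powr (\<alpha> - 1)"
      using l l0 \<alpha> by (intro mult_right_mono powr_mono2') auto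
    finally have 1: "C * (m * t) powr (\<alpha> - 1) \<le> C * l0 powr (1 - 1 / \<alpha>) * t powr (\<alpha> - 1)"
      using C(1) by (simp add: mult_left_mono mult.assoc)
    have "norm (ml_density \<alpha> (i_pow (- \<alpha>) * of_real l) t) = m * norm (ml_density \<alpha> (i_pow (- \<alpha>)) (m * t))"
      using m ml_density_scale[OF \<alpha>(1) lp t, of "i_pow (- \<alpha>)"] by (simp add: m_def norm_mult)
    also have "\<dots> \<le> m * (1 / \<alpha> + C * (m * t) powr (\<alpha> - 1))" using C(2)[of "m * t"] m t by (intro mult_left_mono) auto
    also have "\<dots> \<le> m * (K * (1 + t powr (\<alpha> - 1)))"
    proof (rule mult_left_mono)
      have "1 / \<alpha> * t powr (\<alpha> - 1) \<ge> 0" "C * l0 powr (1 - 1 / \<alpha>) \<ge> 0" using \<alpha> C by auto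
      with 1 show "1 / \<alpha> + C * (m * t) powr (\<alpha> - 1) \<le> K * (1 + t powr (\<alpha> - 1))"
        unfolding K_def by (simp only: distrib_left distrib_right mult_1_right)
    qed (use m in auto)
    finally show "norm (ml_density \<alpha> (i_pow (- \<alpha>) * of_real l) t) \<le> l powr (1 / \<alpha>) * (K * (1 + t powr (\<alpha> - 1)))"
      by (simp add: m_def)
  qed
qed

section \<open>Abel's integral equation\<close>

text \<open>The Riemann-Liouville integral of order a + 1 without its factor
  \<open>1 / Gamma (a + 1)\<close>. The exponent -\<alpha> occurs in the Caputo derivative, \<alpha>
  - 1 in its inversion.\<close>

abbreviation abel :: "real \<Rightarrow> (real \<Rightarrow> complex) \<Rightarrow> real \<Rightarrow> complex" where
  "abel a f t \<equiv> (LINT r:{0..t}|lborel. of_real ((t - r) powr a) * f r)"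

text \<open>The sets over which f integrates to 0 form a Dynkin system, complements being covered by
  the vanishing total integral, and half-lines are an intersection-stable generator of the Borel
  sets.\<close>

lemma AE_eq_0_if_integral_atMost_eq_0:
  fixes f :: "real \<Rightarrow> 'a::{second_countable_topology, banach}"
  assumes f: "integrable lborel f"
    and tot: "(\<integral>x. f x \<partial>lborel) = 0"
    and at: "\<And>a. (LINT x:{..a}|lborel. f x) = 0"
  shows "AE x in lborel. f x = 0"
proof -
  have si: "set_integrable lborel A f" if "A \<in> sets borel" for A
    unfolding set_integrable_def using that f by (intro integrable_mult_indicator) auto
  have "(LINT x:A|lborel. f x) = 0" if A: "A \<in> sets lborel" for A
  proof -
    have "Int_stable (range (\<lambda>a::real. {..a}))"
      by (auto simp: Int_stable_def)
    moreover have "range (\<lambda>a::real. {..a}) \<subseteq> Pow UNIV" by simp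
    moreover have "A \<in> sigma_sets UNIV (range (\<lambda>a::real. {..a}))"
      using A by (simp add: borel_eq_atMost)
    ultimately have "A \<in> sets borel \<and> (LINT x:A|lborel. f x) = 0"
    proof (induction rule: sigma_sets_induct_disjoint)
      case (compl B)
      have "(LINT x:UNIV - B|lborel. f x) = (\<integral>x. f x - indicator B x *\<^sub>R f x \<partial>lborel)"
        unfolding set_lebesgue_integral_def by (intro Bochner_Integration.integral_cong) (auto simp: indicator_def)
      also have "\<dots> = 0"
        using compl si[of B] f tot by (simp add: set_integrable_def set_lebesgue_integral_def)
      finally show ?case using compl by auto
    next
      case (union B)
      have "(LINT x:(\<Union>i. B i)|lborel. f x) = (\<Sum>i. LINT x:B i|lborel. f x)"
        using union by (intro lebesgue_integral_countable_add si) (auto simp: disjoint_family_on_def)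
      thus ?case using union by auto
    qed (use at in \<open>auto simp: set_lebesgue_integral_def\<close>)
    thus ?thesis ..
  qed
  thus ?thesis by (rule sigma_finite_measure.density_zero[OF sigma_finite_lborel f])
qed

text \<open>Used to identify the densities that witness Caputo derivatives of one function at
  different times.\<close>

lemma AE_eq_if_primitives_eq:
  fixes f g :: "real \<Rightarrow> complex"
  assumes f: "set_integrable lborel {0..T} f" and g: "set_integrable lborel {0..T} g"
    and eq: "\<And>r. r \<in> {0..T} \<Longrightarrow> (LINT x:{0..r}|lborel. f x) = (LINT x:{0..r}|lborel. g x)"
    and T: "T \<ge> 0"
  shows "AE x in lborel. x \<in> {0..T} \<longrightarrow> f x = g x"
proof -
  define d where "d x = indicator {0..T} x *\<^sub>R (f x - g x)" for x
  have di: "integrable lborel d"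
    using set_integral_diff(1)[OF f g] by (simp add: set_integrable_def d_def[abs_def])
  have dr: "(LINT x:{0..r}|lborel. f x - g x) = 0" if "r \<in> {0..T}" for r
  proof -
    have "set_integrable lborel {0..r} f" "set_integrable lborel {0..r} g"
      using that by (auto intro: set_integrable_subset[OF f] set_integrable_subset[OF g])
    thus ?thesis using eq[OF that] by simp
  qed
  have at: "(LINT x:{..a}|lborel. d x) = 0" for a
  proof (cases "a < 0")
    case True
    hence "(LINT x:{..a}|lborel. d x) = (LINT x:{..a}|lborel. 0)"
      by (intro set_lebesgue_integral_cong) (auto simp: d_def)
    thus ?thesis by (simp add: set_lebesgue_integral_def)
  next
    case False
    have "(LINT x:{..a}|lborel. d x) = (LINT x:{0..min a T}|lborel. f x - g x)"
      unfolding set_lebesgue_integral_def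
      by (intro Bochner_Integration.integral_cong) (auto simp: d_def indicator_def)
    also have "\<dots> = 0" using False T by (intro dr) auto
    finally show ?thesis .
  qed
  have "(\<integral>x. d x \<partial>lborel) = (LINT x:{..T}|lborel. d x)"
    unfolding set_lebesgue_integral_def
    by (intro Bochner_Integration.integral_cong) (auto simp: d_def indicator_def)
  hence "AE x in lborel. d x = 0"
    using at by (intro AE_eq_0_if_integral_atMost_eq_0[OF di]) auto
  thus ?thesis by eventually_elim (auto simp: d_def)
qed

text \<open>Exchanging the integrals leaves, for each r, a Beta integral over [r, \<tau>] with
  parameters \<alpha> and 1 - \<alpha>, hence a constant independent of r. Fubini also delivers
  integrability of the Abel transform of a merely integrable g.\<close>

lemma Abel_inversion:
  fixes g :: "real \<Rightarrow> complex"
  assumes \<alpha>: "0 < \<alpha>" "\<alpha> < 1" and \<tau>: "\<tau> > 0" and g: "set_integrable lborel {0..\<tau>} g"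
  shows "has_bochner_integral lborel
     (\<lambda>t. indicator {0..\<tau>} t *\<^sub>R (of_real ((\<tau> - t) powr (\<alpha> - 1)) * abel (- \<alpha>) g t))
     (of_real (Gamma \<alpha> * Gamma (1 - \<alpha>)) * (LINT r:{0..\<tau>}|lborel. g r))"
proof -
  define G where "G r = indicator {0..\<tau>} r *\<^sub>R g r" for r
  have Gi: "integrable lborel G" using g by (simp add: set_integrable_def G_def[abs_def])
  hence [measurable]: "G \<in> borel_measurable borel" by simp
  define k where "k r t = (if r \<le> t \<and> t \<le> \<tau> then (\<tau> - t) powr (\<alpha> - 1) * (t - r) powr (- \<alpha>) else 0)" for r t
  define c where "c = Gamma \<alpha> * Gamma (1 - \<alpha>)"
  define F where "F r t = of_real (k r t) * G r" for r t
  have Fm: "(\<lambda>z. F (fst z) (snd z)) \<in> borel_measurable (lborel \<Otimes>\<^sub>M lborel)"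
    unfolding F_def k_def by measurable
  have kn: "k r t \<ge> 0" for r t by (simp add: k_def)
  have ki: "has_bochner_integral lborel (k r) c" if r: "r < \<tau>" for r
  proof -
    have "has_bochner_integral lborel (\<lambda>s. indicator {0..\<tau> - r} s *\<^sub>R (((\<tau> - r) - s) powr (\<alpha> - 1) * s powr ((1 - \<alpha>) - 1)))
      (Gamma (1 - \<alpha>) * Gamma \<alpha> / Gamma ((1 - \<alpha>) + \<alpha>) * (\<tau> - r) powr ((1 - \<alpha>) + \<alpha> - 1))"
      by (rule has_bochner_integral_Beta_kernel) (use \<alpha> r in auto)
    hence "has_bochner_integral lborel (\<lambda>t. indicator {0..\<tau> - r} (- r + 1 * t) *\<^sub>R (((\<tau> - r) - (- r + 1 * t)) powr (\<alpha> - 1) * (- r + 1 * t) powr ((1 - \<alpha>) - 1)))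
      ((Gamma (1 - \<alpha>) * Gamma \<alpha> / Gamma ((1 - \<alpha>) + \<alpha>) * (\<tau> - r) powr ((1 - \<alpha>) + \<alpha> - 1)) /\<^sub>R \<bar>1\<bar>)"
      by (subst (asm) lborel_has_bochner_integral_real_affine_iff[of 1 _ _ "- r"]) auto
    also have "(\<lambda>t. indicator {0..\<tau> - r} (- r + 1 * t) *\<^sub>R (((\<tau> - r) - (- r + 1 * t)) powr (\<alpha> - 1) * (- r + 1 * t) powr ((1 - \<alpha>) - 1))) = k r"
      by (auto simp: fun_eq_iff k_def indicator_def)
    finally show ?thesis using r by (simp add: c_def mult.commute)
  qed
  \<comment> \<open>At r = \<tau> the kernel vanishes identically and its integral is 0 rather than
    c; the exception is a null set in r.\<close>
  have Gk: "has_bochner_integral lborel (F r) (of_real c * G r)" 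
    and nGk: "has_bochner_integral lborel (\<lambda>t. norm (F r t)) (c * norm (G r))" if "r \<noteq> \<tau>" for r
  proof -
    have "has_bochner_integral lborel (F r) (of_real c * G r) \<and> has_bochner_integral lborel (\<lambda>t. norm (F r t)) (c * norm (G r))"
    proof (cases "r < \<tau>")
      case True
      have "has_bochner_integral lborel (\<lambda>t. k r t * norm (G r)) (c * norm (G r))"
        by (rule has_bochner_integral_mult_left[OF ki[OF True]])
      moreover have "has_bochner_integral lborel (\<lambda>t. of_real (k r t) * G r) (of_real c * G r)"
        by (rule has_bochner_integral_mult_left[OF has_bochner_integral_of_real[OF ki[OF True]]])
      ultimately show ?thesis using kn by (simp add: F_def[abs_def] norm_mult)
    next
      case False
      hence "G r = 0" using that by (simp add: G_def)
      thus ?thesis by (simp add: F_def[abs_def] has_bochner_integral_zero)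
    qed
    thus "has_bochner_integral lborel (F r) (of_real c * G r)" "has_bochner_integral lborel (\<lambda>t. norm (F r t)) (c * norm (G r))"
      by auto
  qed
  have FF: "integrable (lborel \<Otimes>\<^sub>M lborel) (\<lambda>z. F (fst z) (snd z))"
  proof (rule lborel_pair.Fubini_integrable[OF Fm])
    have "AE r in lborel. (\<integral>t. norm (F (fst (r, t)) (snd (r, t))) \<partial>lborel) = c * norm (G r)"
      using AE_lborel_singleton[of \<tau>] by eventually_elim (use nGk in \<open>simp add: has_bochner_integral_iff\<close>)
    moreover have "integrable lborel (\<lambda>r. c * norm (G r))" using Gi by simp
    moreover have "(\<lambda>r. \<integral>t. norm (F (fst (r, t)) (snd (r, t))) \<partial>lborel) \<in> borel_measurable lborel"
      using Fm by (intro lborel.borel_measurable_lebesgue_integral) (simp add: case_prod_beta')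
    ultimately show "integrable lborel (\<lambda>r. \<integral>t. norm (F (fst (r, t)) (snd (r, t))) \<partial>lborel)"
      by (subst integrable_cong_AE) auto
    show "AE r in lborel. integrable lborel (\<lambda>t. F (fst (r, t)) (snd (r, t)))"
      using AE_lborel_singleton[of \<tau>] by eventually_elim (use Gk in \<open>simp add: has_bochner_integral_iff\<close>)
  qed
  hence FF': "integrable (lborel \<Otimes>\<^sub>M lborel) (case_prod F)" by (simp add: case_prod_beta')
  have Ft: "(\<integral>r. F r t \<partial>lborel) = indicator {0..\<tau>} t *\<^sub>R (of_real ((\<tau> - t) powr (\<alpha> - 1)) * abel (- \<alpha>) g t)" for t
  proof -
    have "(\<integral>r. F r t \<partial>lborel) = (\<integral>r. (indicator {0..\<tau>} t * of_real ((\<tau> - t) powr (\<alpha> - 1))) * (indicator {0..t} r *\<^sub>R (of_real ((t - r) powr (- \<alpha>)) * g r)) \<partial>lborel)"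
      by (intro Bochner_Integration.integral_cong) (auto simp: F_def k_def G_def indicator_def)
    also have "\<dots> = (indicator {0..\<tau>} t * of_real ((\<tau> - t) powr (\<alpha> - 1))) * abel (- \<alpha>) g t"
      unfolding set_lebesgue_integral_def by (rule integral_mult_right_zero)
    finally show ?thesis by (simp add: indicator_def)
  qed
  have "(\<integral>t. (\<integral>r. F r t \<partial>lborel) \<partial>lborel) = (\<integral>r. (\<integral>t. F r t \<partial>lborel) \<partial>lborel)"
    by (rule lborel_pair.Fubini_integral[OF FF'])
  also have "\<dots> = (\<integral>r. of_real c * G r \<partial>lborel)"
  proof (rule integral_cong_AE)
    show "(\<lambda>r. \<integral>t. F r t \<partial>lborel) \<in> borel_measurable lborel"
      using FF' by (intro lborel.borel_measurable_lebesgue_integral) auto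
    show "AE r in lborel. (\<integral>t. F r t \<partial>lborel) = of_real c * G r"
      using AE_lborel_singleton[of \<tau>] by eventually_elim (use Gk in \<open>simp add: has_bochner_integral_iff\<close>)
  qed simp
  also have "\<dots> = of_real c * (LINT r:{0..\<tau>}|lborel. g r)"
    unfolding G_def set_lebesgue_integral_def by (rule integral_mult_right_zero)
  finally have "(\<integral>t. (\<integral>r. F r t \<partial>lborel) \<partial>lborel) = of_real c * (LINT r:{0..\<tau>}|lborel. g r)" .
  moreover have "integrable lborel (\<lambda>t. \<integral>r. F r t \<partial>lborel)"
    by (rule lborel_pair.integrable_snd[OF FF'])
  ultimately show ?thesis by (simp add: has_bochner_integral_iff Ft c_def)
qed

text \<open>Under the weighted norm \<open>sup e\<^sup>-\<^sup>\<omega>\<^sup>t \<bar>f t\<bar>\<close> the Abel operator has norm at most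
  \<open>\<Gamma>(\<alpha>) / \<omega>\<^sup>\<alpha>\<close>, hence is a contraction for large \<open>\<omega>\<close>.\<close>

lemma Abel_equation_unique:
  fixes f :: "real \<Rightarrow> complex"
  assumes \<alpha>: "0 < \<alpha>" and \<tau>: "\<tau> \<ge> 0" and cont: "continuous_on {0..\<tau>} f"
    and eq: "\<And>t. t \<in> {0..\<tau>} \<Longrightarrow> f t = c * abel (\<alpha> - 1) f t"
    and t: "t \<in> {0..\<tau>}"
  shows "f t = 0"
proof -
  have Gp: "Gamma \<alpha> > 0" using \<alpha> by (rule Gamma_real_pos)
  \<comment> \<open>This makes \<open>norm c * Gamma \<alpha> / \<omega> powr \<alpha>\<close>
    smaller than 1/2; the summand 1 keeps \<omega> positive when c = 0.\<close>
  define \<omega> where "\<omega> = (2 * norm c * Gamma \<alpha> + 1) powr (1 / \<alpha>)"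
  have pos: "2 * norm c * Gamma \<alpha> + 1 > 0" using Gp by (intro add_nonneg_pos) auto
  have \<omega>: "\<omega> > 0" "\<omega> powr \<alpha> = 2 * norm c * Gamma \<alpha> + 1"
    using \<alpha> pos by (auto simp: \<omega>_def powr_powr)
  have "\<exists>s\<in>{0..\<tau>}. \<forall>r\<in>{0..\<tau>}. exp (- \<omega> * r) * norm (f r) \<le> exp (- \<omega> * s) * norm (f s)"
    by (rule continuous_attains_sup) (use \<tau> in \<open>auto intro!: continuous_intros cont\<close>)
  then obtain s where s: "s \<in> {0..\<tau>}" "\<And>r. r \<in> {0..\<tau>} \<Longrightarrow> exp (- \<omega> * r) * norm (f r) \<le> exp (- \<omega> * s) * norm (f s)"
    by blast
  define M where "M = exp (- \<omega> * s) * norm (f s)"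
  have fr: "norm (f r) \<le> M * exp (\<omega> * r)" if "r \<in> {0..\<tau>}" for r
  proof -
    have "exp (\<omega> * r) * (exp (- \<omega> * r) * norm (f r)) \<le> exp (\<omega> * r) * M"
      unfolding M_def by (intro mult_left_mono s(2)[OF that]) auto
    hence "(exp (\<omega> * r) * exp (- \<omega> * r)) * norm (f r) \<le> exp (\<omega> * r) * M" by (simp only: mult.assoc)
    thus ?thesis by (simp add: mult_exp_exp mult.commute)
  qed
  have M0: "M \<ge> 0" by (simp add: M_def)
  \<comment> \<open>Reflection at s turns the Gamma kernel into the weighted Abel kernel on all of
    (-\<infinity>, s), which dominates the one on [0, s].\<close>
  have "has_bochner_integral lborel (\<lambda>x. indicator {0<..} x *\<^sub>R (x powr (\<alpha> - 1) * exp (- \<omega> * x))) (Gamma \<alpha> / \<omega> powr \<alpha>)"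
    by (rule has_bochner_integral_Gamma_kernel[OF \<alpha> \<omega>(1)])
  hence "has_bochner_integral lborel (\<lambda>r. indicator {0<..} (s + (-1) * r) *\<^sub>R ((s + (-1) * r) powr (\<alpha> - 1) * exp (- \<omega> * (s + (-1) * r)))) ((Gamma \<alpha> / \<omega> powr \<alpha>) /\<^sub>R \<bar>-1\<bar>)"
    by (subst (asm) lborel_has_bochner_integral_real_affine_iff[of "-1" _ _ s]) auto
  from has_bochner_integral_mult_right[OF this, of "M * exp (\<omega> * s)"]
  have K: "has_bochner_integral lborel (\<lambda>r. M * exp (\<omega> * s) * (indicator {0<..} (s - r) *\<^sub>R ((s - r) powr (\<alpha> - 1) * exp (- \<omega> * (s - r)))))
     (M * exp (\<omega> * s) * (Gamma \<alpha> / \<omega> powr \<alpha>))" by simp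
  have "norm (abel (\<alpha> - 1) f s) \<le> 
      (\<integral>r. norm (indicator {0..s} r *\<^sub>R (of_real ((s - r) powr (\<alpha> - 1)) * f r)) \<partial>lborel)"
    unfolding set_lebesgue_integral_def by (rule integral_norm_bound)
  also have "\<dots> \<le> (\<integral>r. M * exp (\<omega> * s) * (indicator {0<..} (s - r) *\<^sub>R ((s - r) powr (\<alpha> - 1) * exp (- \<omega> * (s - r)))) \<partial>lborel)"
  proof (rule integral_mono_AE')
    show "AE r in lborel. norm (indicator {0..s} r *\<^sub>R (of_real ((s - r) powr (\<alpha> - 1)) * f r)) \<le> 
       M * exp (\<omega> * s) * (indicator {0<..} (s - r) *\<^sub>R ((s - r) powr (\<alpha> - 1) * exp (- \<omega> * (s - r))))"
    proof (rule AE_I2)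
      fix r
      show "norm (indicator {0..s} r *\<^sub>R (of_real ((s - r) powr (\<alpha> - 1)) * f r)) \<le> 
       M * exp (\<omega> * s) * (indicator {0<..} (s - r) *\<^sub>R ((s - r) powr (\<alpha> - 1) * exp (- \<omega> * (s - r))))"
      proof (cases "r \<in> {0..s} \<and> r \<noteq> s")
        case True
        hence "norm (f r) \<le> M * exp (\<omega> * r)" using s(1) by (intro fr) auto
        hence "(s - r) powr (\<alpha> - 1) * norm (f r) \<le> (s - r) powr (\<alpha> - 1) * (M * exp (\<omega> * r))" by (intro mult_left_mono) auto
        also have "\<dots> = M * exp (\<omega> * s) * ((s - r) powr (\<alpha> - 1) * exp (- \<omega> * (s - r)))"
          by (simp add: mult_exp_exp algebra_simps)
        finally show ?thesis using True by (simp add: norm_mult)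
      qed (use M0 in \<open>auto simp: indicator_def\<close>)
    qed
  qed (use K M0 in \<open>auto simp: has_bochner_integral_iff intro!: AE_I2\<close>)
  also have "\<dots> = M * exp (\<omega> * s) * (Gamma \<alpha> / \<omega> powr \<alpha>)" by (rule has_bochner_integral_integral_eq[OF K])
  finally have X: "norm (abel (\<alpha> - 1) f s) \<le> M * exp (\<omega> * s) * (Gamma \<alpha> / \<omega> powr \<alpha>)" .
  have "norm (f s) \<le> norm c * (M * exp (\<omega> * s) * (Gamma \<alpha> / \<omega> powr \<alpha>))"
    by (subst eq[OF s(1)], subst norm_mult, rule mult_left_mono[OF X]) simp
  also have "norm (f s) = M * exp (\<omega> * s)" by (simp add: M_def mult_exp_exp)
  finally have "M * exp (\<omega> * s) * 1 \<le> M * exp (\<omega> * s) * (norm c * Gamma \<alpha> / \<omega> powr \<alpha>)" by (simp add: mult_ac)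
  moreover have "norm c * Gamma \<alpha> / \<omega> powr \<alpha> < 1"
    unfolding \<omega>(2) using pos Gp by (simp add: divide_less_eq) (simp add: add_nonneg_pos)
  ultimately have "\<not> M * exp (\<omega> * s) > 0"
    by (metis mult_less_cancel_left_pos not_less)
  hence "M = 0" using M0 by (simp add: zero_less_mult_iff)
  thus ?thesis using fr[OF t] by simp
qed

text \<open>The hypothesis provides a separate density for almost every time. Given \<tau>, the
  density of one later time s is used on [0, \<tau>]; it agrees almost everywhere with those of
  earlier times, as all of them have the primitive f. Abel inversion then turns the equation into a
  homogeneous Abel equation for f.\<close>

lemma caputo_equation_unique:
  fixes f :: "real \<Rightarrow> complex"
  assumes \<alpha>: "0 < \<alpha>" "\<alpha> < 1" and cont: "continuous_on {0..T} f" and f0: "f 0 = 0"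
    and ae: "AE t in lborel. t \<in> {0<..<T} \<longrightarrow> (\<exists>g. set_integrable lborel {0..t} g \<and>
       (\<forall>r\<in>{0..t}. f r = (LINT x:{0..r}|lborel. g x)) \<and>
       abel (- \<alpha>) g t = c * f t)"
    and t: "t \<in> {0..T}"
  shows "f t = 0"
proof -
  define P where "P t g \<longleftrightarrow> set_integrable lborel {0..t} g \<and>
       (\<forall>r\<in>{0..t}. f r = (LINT x:{0..r}|lborel. g x)) \<and>
       abel (- \<alpha>) g t = c * f t" for t g
  define C where "C = Gamma \<alpha> * Gamma (1 - \<alpha>)"
  have C: "C > 0" unfolding C_def using \<alpha> by (intro mult_pos_pos Gamma_real_pos) auto
  have Ab: "f \<tau> = c / of_real C * abel (\<alpha> - 1) f \<tau>" if \<tau>: "0 < \<tau>" "\<tau> < T" for \<tau>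
  proof -
    \<comment> \<open>The equation holds at almost every time, and the interval above \<tau> has
      positive measure.\<close>
    have "\<exists>s\<in>{\<tau><..<T}. \<exists>g. P s g"
    proof (rule ccontr)
      assume nex: "\<not> ?thesis"
      have "AE s in lborel. s \<notin> {\<tau><..<T}"
        using ae unfolding P_def[symmetric] by eventually_elim (use nex \<tau> in auto)
      hence "emeasure lborel {\<tau><..<T} = 0" by (subst (asm) AE_iff_measurable[where N = "{\<tau><..<T}"]) auto
      thus False using \<tau> by simp
    qed
    then obtain s g where s: "s \<in> {\<tau><..<T}" and g: "P s g" by auto
    have g\<tau>: "set_integrable lborel {0..\<tau>} g"
      by (rule set_integrable_subset[of _ "{0..s}"]) (use g s \<tau> in \<open>auto simp: P_def\<close>)
    have Af: "(LINT t:{0..\<tau>}|lborel. of_real ((\<tau> - t) powr (\<alpha> - 1)) * abel (- \<alpha>) g t)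
      = (LINT t:{0..\<tau>}|lborel. of_real ((\<tau> - t) powr (\<alpha> - 1)) * (c * f t))"
      unfolding set_lebesgue_integral_def[of _ "{0..\<tau>}"]
    proof (rule integral_cong_AE)
      show "(\<lambda>t. indicator {0..\<tau>} t *\<^sub>R (of_real ((\<tau> - t) powr (\<alpha> - 1)) * abel (- \<alpha>) g t)) \<in> borel_measurable lborel"
        by (rule borel_measurable_has_bochner_integral[OF Abel_inversion[OF \<alpha> \<tau>(1) g\<tau>]])
      have [measurable]: "(\<lambda>t. indicator {0..\<tau>} t *\<^sub>R f t) \<in> borel_measurable borel"
        by (intro borel_measurable_continuous_on_indicator continuous_on_subset[OF cont]) (use \<tau> in auto)
      have "(\<lambda>t. of_real ((\<tau> - t) powr (\<alpha> - 1)) * c * (indicator {0..\<tau>} t *\<^sub>R f t)) \<in> borel_measurable lborel" by measurable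
      thus "(\<lambda>t. indicator {0..\<tau>} t *\<^sub>R (of_real ((\<tau> - t) powr (\<alpha> - 1)) * (c * f t))) \<in> borel_measurable lborel"
        by (simp add: mult_ac)
      show "AE t in lborel. indicator {0..\<tau>} t *\<^sub>R (of_real ((\<tau> - t) powr (\<alpha> - 1)) * abel (- \<alpha>) g t)
         = indicator {0..\<tau>} t *\<^sub>R (of_real ((\<tau> - t) powr (\<alpha> - 1)) * (c * f t))"
        using ae AE_lborel_singleton[of 0]
      proof eventually_elim
        case (elim t)
        show ?case
        proof (cases "t \<in> {0..\<tau>}")
          case True
          with elim \<tau> obtain h where h: "P t h" by (auto simp: P_def)
          have t0: "t \<ge> 0" using True by simp
          have gt: "set_integrable lborel {0..t} g" by (rule set_integrable_subset[OF g\<tau>]) (use True in auto)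
          have ht: "set_integrable lborel {0..t} h" using h by (simp add: P_def)
          \<comment> \<open>Replaces the density h attached to the time t by the fixed g, so that a
            single function enters the Abel inversion.\<close>
          have "AE x in lborel. x \<in> {0..t} \<longrightarrow> g x = h x"
          proof (rule AE_eq_if_primitives_eq[OF gt ht _ t0])
            fix r assume "r \<in> {0..t}"
            thus "(LINT x:{0..r}|lborel. g x) = (LINT x:{0..r}|lborel. h x)"
              using g h True s unfolding P_def by (metis atLeastAtMost_iff greaterThanLessThan_iff less_eq_real_def order.trans)
          qed
          hence ae': "AE r in lborel. indicator {0..t} r *\<^sub>R (of_real ((t - r) powr (- \<alpha>)) * g r) = indicator {0..t} r *\<^sub>R (of_real ((t - r) powr (- \<alpha>)) * h r)"
            by eventually_elim (auto simp: indicator_def)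
          have meas: "(\<lambda>r. indicator {0..t} r *\<^sub>R (of_real ((t - r) powr (- \<alpha>)) * g r)) \<in> borel_measurable lborel"
            if "set_integrable lborel {0..t} g" for g :: "real \<Rightarrow> complex"
          proof -
            have [measurable]: "(\<lambda>r. indicator {0..t} r *\<^sub>R g r) \<in> borel_measurable borel"
              using borel_measurable_integrable[OF that[unfolded set_integrable_def]] by simp
            have "(\<lambda>r. of_real ((t - r) powr (- \<alpha>)) * (indicator {0..t} r *\<^sub>R g r)) \<in> borel_measurable lborel" by measurable
            thus ?thesis by simp
          qed
          have "abel (- \<alpha>) g t = abel (- \<alpha>) h t"
            unfolding set_lebesgue_integral_def by (rule integral_cong_AE[OF meas[OF gt] meas[OF ht] ae'])
          also have "\<dots> = c * f t" using h by (simp add: P_def)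
          finally show ?thesis by simp
        qed simp
      qed
    qed
    have "of_real C * (LINT r:{0..\<tau>}|lborel. g r) = (LINT t:{0..\<tau>}|lborel. of_real ((\<tau> - t) powr (\<alpha> - 1)) * abel (- \<alpha>) g t)"
      using has_bochner_integral_integral_eq[OF Abel_inversion[OF \<alpha> \<tau>(1) g\<tau>], symmetric]
      by (simp only: C_def set_lebesgue_integral_def)
    also note Af
    also have "(LINT t:{0..\<tau>}|lborel. of_real ((\<tau> - t) powr (\<alpha> - 1)) * (c * f t)) = c * abel (\<alpha> - 1) f \<tau>"
    proof -
      have "indicator {0..\<tau>} t *\<^sub>R (of_real ((\<tau> - t) powr (\<alpha> - 1)) * (c * f t)) =
        c * (indicator {0..\<tau>} t *\<^sub>R (of_real ((\<tau> - t) powr (\<alpha> - 1)) * f t))" for t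
        by (simp add: scaleR_conv_of_real)
      thus ?thesis unfolding set_lebesgue_integral_def by (simp only: integral_mult_right_zero)
    qed
    also have "(LINT r:{0..\<tau>}|lborel. g r) = f \<tau>" using g s \<tau> by (auto simp: P_def)
    finally show ?thesis using C by (simp add: field_simps)
  qed
  have z: "f t = 0" if "t \<in> {0..<T}" for t
  proof (rule Abel_equation_unique[OF \<alpha>(1), where \<tau> = t and c = "c / of_real C"])
    show "continuous_on {0..t} f" by (rule continuous_on_subset[OF cont]) (use that in auto)
    fix r assume r: "r \<in> {0..t}"
    show "f r = c / of_real C * abel (\<alpha> - 1) f r"
    proof (cases "r = 0")
      case True
      have "(LINT x:{0..0}|lborel. of_real ((0 - x) powr (\<alpha> - 1)) * f x) = (LINT x:{0..0::real}|lborel. 0)"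
        by (intro set_lebesgue_integral_cong) (auto simp: f0)
      thus ?thesis using True f0 by (simp add: set_lebesgue_integral_def)
    qed (use r that in \<open>intro Ab, auto\<close>)
  qed (use that in auto)
  \<comment> \<open>The Abel equation is available only below T; the endpoint follows because the
    zero set of f is closed.\<close>
  show ?thesis
  proof (cases "t = T \<and> T > 0")
    case True
    have "continuous_on {0..T} f \<Longrightarrow> closed {x \<in> {0..T}. f x = 0}"
      by (intro continuous_closed_preimage_constant) auto
    hence cl: "closed {x \<in> {0..T}. f x = 0}" using cont .
    have "{0..<T} \<subseteq> {x \<in> {0..T}. f x = 0}" using z by auto
    hence "closure {0..<T} \<subseteq> {x \<in> {0..T}. f x = 0}" using cl by (rule closure_minimal)
    moreover have "T \<in> closure {0..<T}" using True by simp
    ultimately show ?thesis using True by blast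
  qed (use t z f0 in \<open>cases "t = 0"; auto\<close>)
qed

section \<open>Expansions in a Hilbert basis\<close>

lemma module_scaleC: "module (scaleC :: complex \<Rightarrow> 'a::complex_inner \<Rightarrow> 'a)"
proof
  show "1 *\<^sub>C x = x" for x :: 'a using scaleC_of_real[of 1 x] by simp
qed (simp_all add: scaleC_add_right scaleC_add_left scaleC_scaleC)

lemmas scaleC_one [simp] = module.scale_one[OF module_scaleC]
lemmas scaleC_zero_left [simp] = module.scale_zero_left[OF module_scaleC]

lemma cinner_zero_left [simp]: "cinner 0 y = 0"
  using cinner_add_left[of 0 0 y] by simp

lemma cinner_minus_left: "cinner (- x) y = - cinner x y"
  using cinner_add_left[of x "- x" y] by (simp add: eq_neg_iff_add_eq_0 add.commute)

lemma cinner_diff_left: "cinner (x - y) z = cinner x z - cinner y z"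
  using cinner_add_left[of x "- y" z] by (simp add: cinner_minus_left)

lemma cinner_sum_left: "cinner (sum f A) y = (\<Sum>i\<in>A. cinner (f i) y)"
  by (induction A rule: infinite_finite_induct) (simp_all add: cinner_add_left)

lemma cinner_scaleR_left: "cinner (r *\<^sub>R x) y = of_real r * cinner x y"
  by (metis cinner_scaleC_left scaleC_of_real)

lemma cinner_add_right: "cinner x (y + z) = cinner x y + cinner x z"
  by (subst (1 2 3) cinner_commute) (simp add: cinner_add_left)

lemma cinner_diff_right: "cinner x (y - z) = cinner x y - cinner x z"
  by (subst (1 2 3) cinner_commute) (simp add: cinner_diff_left)

lemma cinner_zero_right [simp]: "cinner x 0 = 0"
  by (subst cinner_commute) simp

lemma cinner_sum_right: "cinner x (sum f A) = (\<Sum>i\<in>A. cinner x (f i))"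
  by (induction A rule: infinite_finite_induct) (simp_all add: cinner_add_right)

lemma cinner_scaleC_right: "cinner x (c *\<^sub>C y) = cnj c * cinner x y"
  by (subst (1 2) cinner_commute) (simp add: cinner_scaleC_left)

lemma cinner_self: "cinner x x = of_real ((norm x)\<^sup>2)"
proof (rule complex_eqI)
  have "Re (cinner x x) \<ge> 0"
    using norm_ge_zero[of x] unfolding norm_eq_sqrt_cinner by simp
  thus "Re (cinner x x) = Re (of_real ((norm x)\<^sup>2))" by (simp add: norm_eq_sqrt_cinner)
  have "Im (cinner x x) = - Im (cinner x x)" by (subst cinner_commute) simp
  thus "Im (cinner x x) = Im (of_real ((norm x)\<^sup>2))" by simp
qed

text \<open>The component of x orthogonal to y has square norm
  \<open>(norm x)^2 - (norm (cinner x y))^2 / (norm y)^2\<close>, which is nonnegative.\<close>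

lemma norm_cinner_le: "norm (cinner x y) \<le> norm x * norm y"
proof (cases "y = 0")
  case False
  define c where "c = cinner x y / of_real ((norm y)\<^sup>2)"
  have n: "complex_of_real ((norm y)\<^sup>2) \<noteq> 0" using False by simp
  have cy: "c * of_real ((norm y)\<^sup>2) = cinner x y" using n by (simp add: c_def)
  have "of_real ((norm (x - c *\<^sub>C y))\<^sup>2) = cinner (x - c *\<^sub>C y) (x - c *\<^sub>C y)" by (rule cinner_self[symmetric])
  also have "\<dots> = cinner x x - cnj c * cinner x y - c * cinner y x + c * cnj c * cinner y y"
    by (simp add: cinner_diff_left cinner_diff_right cinner_scaleC_left cinner_scaleC_right algebra_simps)
  also have "cinner y x = cnj (cinner x y)" by (rule cinner_commute)
  also have "c * cnj c * cinner y y = cnj c * cinner x y" unfolding cinner_self cy[symmetric] by simp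
  also have "cinner x x - cnj c * cinner x y - c * cnj (cinner x y) + cnj c * cinner x y = cinner x x - c * cnj (cinner x y)" by simp
  also have "c * cnj (cinner x y) = of_real ((norm (cinner x y))\<^sup>2 / (norm y)\<^sup>2)"
    by (simp add: c_def complex_norm_square flip: of_real_power)
  finally have "(norm (x - c *\<^sub>C y))\<^sup>2 = (norm x)\<^sup>2 - (norm (cinner x y))\<^sup>2 / (norm y)\<^sup>2"
    unfolding cinner_self of_real_diff[symmetric] of_real_eq_iff .
  hence "(norm (cinner x y))\<^sup>2 / (norm y)\<^sup>2 \<le> (norm x)\<^sup>2" using zero_le_power2[of "norm (x - c *\<^sub>C y)"] by linarith
  hence "(norm (cinner x y))\<^sup>2 \<le> (norm x * norm y)\<^sup>2"
    using False by (simp add: divide_le_eq power_mult_distrib)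
  thus ?thesis by (rule power2_le_imp_le) simp
qed simp

lemma bounded_linear_cinner_left: "bounded_linear (\<lambda>x. cinner x y)"
  by (rule bounded_linear_intro[where K = "norm y"])
     (auto simp: cinner_add_left cinner_scaleR_left scaleR_conv_of_real norm_cinner_le)

lemma continuous_on_cinner_left [continuous_intros]:
  "continuous_on A f \<Longrightarrow> continuous_on A (\<lambda>x. cinner (f x) y)"
  by (rule bounded_linear.continuous_on[OF bounded_linear_cinner_left])

lemma summable_square_imp_summable_mult:
  fixes x y :: "nat \<Rightarrow> real"
  assumes x: "summable (\<lambda>n. (x n)\<^sup>2)" and y: "summable (\<lambda>n. (y n)\<^sup>2)"
  shows "summable (\<lambda>n. \<bar>x n * y n\<bar>)" 
    and "(\<Sum>n. \<bar>x n * y n\<bar>) \<le> sqrt (\<Sum>n. (x n)\<^sup>2) * sqrt (\<Sum>n. (y n)\<^sup>2)"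
proof -
  have b: "(\<Sum>n<N. \<bar>x n * y n\<bar>) \<le> sqrt (\<Sum>n. (x n)\<^sup>2) * sqrt (\<Sum>n. (y n)\<^sup>2)" for N
  proof -
    have "(\<Sum>n<N. \<bar>x n * y n\<bar>) \<le> L2_set x {..<N} * L2_set y {..<N}"
      using L2_set_mult_ineq[of x y "{..<N}"] by (simp add: abs_mult)
    also have "\<dots> \<le> sqrt (\<Sum>n. (x n)\<^sup>2) * sqrt (\<Sum>n. (y n)\<^sup>2)"
      unfolding L2_set_def
      by (intro mult_mono real_sqrt_le_mono sum_le_suminf x y) (auto intro!: sum_nonneg suminf_nonneg x y)
    finally show ?thesis .
  qed
  show s: "summable (\<lambda>n. \<bar>x n * y n\<bar>)"
    by (rule summableI_nonneg_bounded[of _ "sqrt (\<Sum>n. (x n)\<^sup>2) * sqrt (\<Sum>n. (y n)\<^sup>2)"]) (use b in auto)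
  show "(\<Sum>n. \<bar>x n * y n\<bar>) \<le> sqrt (\<Sum>n. (x n)\<^sup>2) * sqrt (\<Sum>n. (y n)\<^sup>2)"
    by (rule suminf_le_const[OF s b])
qed

locale eigenbasis =
  fixes lam :: "nat \<Rightarrow> real" and phi :: "nat \<Rightarrow> 'a::chilbert_space"
  assumes basis: "hilbert_basis phi" and lam_0: "0 < lam 0" and mono_lam: "mono lam"
begin

lemma lam_ge: "lam n \<ge> lam 0"
  using mono_lam by (auto simp: mono_def)

lemma lam_pos: "lam n > 0"
  using lam_ge[of n] lam_0 by linarith

lemma cinner_phi: "cinner (phi m) (phi n) = (if m = n then 1 else 0)"
  using basis by (auto simp: hilbert_basis_def)

lemma cinner_sum_phi: "finite A \<Longrightarrow> cinner (\<Sum>i\<in>A. c i *\<^sub>C phi i) (phi n) = (if n \<in> A then c n else 0)"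
  by (simp add: cinner_sum_left cinner_scaleC_left cinner_phi if_distrib cong: if_cong)

lemma norm_sum_phi:
  assumes A: "finite A"
  shows "(norm (\<Sum>i\<in>A. c i *\<^sub>C phi i))\<^sup>2 = (\<Sum>i\<in>A. (norm (c i))\<^sup>2)"
proof -
  have "complex_of_real ((norm (\<Sum>i\<in>A. c i *\<^sub>C phi i))\<^sup>2) = (\<Sum>j\<in>A. cnj (c j) * cinner (\<Sum>i\<in>A. c i *\<^sub>C phi i) (phi j))"
    unfolding cinner_self[symmetric] by (subst cinner_sum_right) (simp add: cinner_scaleC_right)
  also have "\<dots> = (\<Sum>j\<in>A. cnj (c j) * c j)" using A by (intro sum.cong) (auto simp: cinner_sum_phi)
  also have "\<dots> = of_real (\<Sum>j\<in>A. (norm (c j))\<^sup>2)" by (simp add: complex_norm_square mult.commute flip: of_real_power)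
  finally show ?thesis by (simp only: of_real_eq_iff)
qed

text \<open>The orthogonal complement of w is closed and contains the span of the basis. By density
  it contains w itself.\<close>

lemma eq_0_if_orthogonal:
  assumes "\<And>n. cinner w (phi n) = 0"
  shows "w = 0"
proof -
  define V where "V = {v. cinner v w = 0}"
  have "closed V"
    unfolding V_def by (intro closed_Collect_eq continuous_intros)
  moreover have "module.span scaleC (range phi) \<subseteq> V"
  proof
    fix v assume "v \<in> module.span scaleC (range phi)"
    thus "v \<in> V"
    proof (induction rule: module.span_induct_alt[OF module_scaleC, consumes 1])
      case (2 c x y)
      then obtain n where "x = phi n" by auto
      hence "cinner x w = 0" using assms[of n] cinner_commute[of x w] by simp
      thus ?case using 2 by (simp add: V_def cinner_add_left cinner_scaleC_left)
    qed (simp add: V_def)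
  qed
  ultimately have "closure (module.span scaleC (range phi)) \<subseteq> V" by (intro closure_minimal)
  hence "w \<in> V" using basis by (auto simp: hilbert_basis_def)
  thus ?thesis by (simp add: V_def cinner_self)
qed

lemma Riesz_Fischer:
  assumes c: "summable (\<lambda>n. (norm (c n))\<^sup>2)"
  shows "summable (\<lambda>n. c n *\<^sub>C phi n)"
    and "cinner (\<Sum>n. c n *\<^sub>C phi n) (phi m) = c m"
proof -
  show s: "summable (\<lambda>n. c n *\<^sub>C phi n)"
    unfolding summable_Cauchy
  proof (intro allI impI)
    fix e :: real assume e: "e > 0"
    then obtain N where N: "\<And>m n. m \<ge> N \<Longrightarrow> norm (\<Sum>i\<in>{m..<n}. (norm (c i))\<^sup>2) < e\<^sup>2"
      using c unfolding summable_Cauchy by (metis zero_less_power)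
    have "norm (\<Sum>i\<in>{m..<n}. c i *\<^sub>C phi i) < e" if "m \<ge> N" for m n
    proof (rule power2_less_imp_less)
      show "(norm (\<Sum>i\<in>{m..<n}. c i *\<^sub>C phi i))\<^sup>2 < e\<^sup>2"
        using N[OF that, of n] by (simp add: norm_sum_phi)
    qed (use e in auto)
    thus "\<exists>N. \<forall>m\<ge>N. \<forall>n. norm (\<Sum>i\<in>{m..<n}. c i *\<^sub>C phi i) < e" by blast
  qed
  have "(\<lambda>n. cinner (c n *\<^sub>C phi n) (phi m)) sums cinner (\<Sum>n. c n *\<^sub>C phi n) (phi m)"
    by (rule bounded_linear.sums[OF bounded_linear_cinner_left summable_sums[OF s]])
  also have "(\<lambda>n. cinner (c n *\<^sub>C phi n) (phi m)) = (\<lambda>n. if n = m then c n else 0)"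
    by (auto simp: cinner_scaleC_left cinner_phi)
  finally show "cinner (\<Sum>n. c n *\<^sub>C phi n) (phi m) = c m"
    using sums_single[of m c] sums_unique2 by blast
qed

lemma Bessel: "summable (\<lambda>n. (norm (cinner u (phi n)))\<^sup>2)"
proof (rule summableI_nonneg_bounded[where x = "(norm u)\<^sup>2"])
  fix N
  define P where "P = (\<Sum>i<N. cinner u (phi i) *\<^sub>C phi i)"
  have uP: "cinner (u - P) (phi i) = 0" if "i < N" for i
    using that by (simp add: P_def cinner_diff_left cinner_sum_phi)
  have "cinner (u - P) P = (\<Sum>i<N. cnj (cinner u (phi i)) * cinner (u - P) (phi i))"
    by (subst (2) P_def) (simp add: cinner_sum_right cinner_scaleC_right)
  hence 0: "cinner (u - P) P = 0" using uP by simp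
  hence orth: "cinner P (u - P) = 0" using cinner_commute[of P "u - P"] by simp
  have "cinner u u = cinner ((u - P) + P) ((u - P) + P)" by simp
  also have "\<dots> = cinner (u - P) (u - P) + cinner P P"
    unfolding cinner_add_left cinner_add_right using 0 orth by simp
  finally have "(norm u)\<^sup>2 = (norm (u - P))\<^sup>2 + (norm P)\<^sup>2"
    unfolding cinner_self of_real_add[symmetric] of_real_eq_iff .
  moreover have "(norm P)\<^sup>2 = (\<Sum>n<N. (norm (cinner u (phi n)))\<^sup>2)"
    unfolding P_def by (rule norm_sum_phi) simp
  ultimately show "(\<Sum>n<N. (norm (cinner u (phi n)))\<^sup>2) \<le> (norm u)\<^sup>2" by simp
qed simp

lemma expansion: "(\<lambda>n. cinner u (phi n) *\<^sub>C phi n) sums u"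
proof -
  define S where "S = (\<Sum>n. cinner u (phi n) *\<^sub>C phi n)"
  have "u - S = 0"
    by (rule eq_0_if_orthogonal) (simp add: S_def cinner_diff_left Riesz_Fischer(2)[OF Bessel])
  thus ?thesis using summable_sums[OF Riesz_Fischer(1)[OF Bessel, of u]] by (simp add: S_def)
qed

lemma Parseval: "(\<lambda>n. cinner u (phi n) * cnj (cinner v (phi n))) sums cinner u v"
proof -
  have "(\<lambda>n. cinner (cinner u (phi n) *\<^sub>C phi n) v) sums cinner u v"
    by (rule bounded_linear.sums[OF bounded_linear_cinner_left expansion])
  thus ?thesis using cinner_commute[of "phi _" v] by (simp add: cinner_scaleC_left)
qed

section \<open>The scale of spaces in coordinates\<close>

lemma norm_pos_0: "norm_pos lam phi 0 u = norm u"
proof -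
  have "(\<lambda>n. of_real ((norm (cinner u (phi n)))\<^sup>2)) sums complex_of_real ((norm u)\<^sup>2)"
    using Parseval[of u u] by (simp only: complex_norm_square cinner_self)
  hence "(\<lambda>n. (norm (cinner u (phi n)))\<^sup>2) sums (norm u)\<^sup>2" by (simp only: sums_of_real_iff)
  moreover have "lam n powr (2 * 0) = 1" for n using lam_pos[of n] by simp
  ultimately show ?thesis by (simp add: norm_pos_def sums_iff)
qed

lemma H_pos_0: "u \<in> H_pos lam phi 0"
  using Bessel[of u] lam_pos by (simp add: H_pos_def less_imp_neq[THEN not_sym])

lemma powr_lam_square: "(lam n powr s)\<^sup>2 = lam n powr (2 * s)"
  by (simp add: power2_eq_square powr_add[symmetric])

text \<open>With the weight inside the square, the condition has the shape to which the
  Cauchy-Schwarz inequality for sequences applies.\<close>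

lemma H_pos_iff: "u \<in> H_pos lam phi s \<longleftrightarrow> summable (\<lambda>n. (lam n powr s * norm (cinner u (phi n)))\<^sup>2)"
  by (simp add: H_pos_def power_mult_distrib powr_lam_square)

lemma norm_pos_eq: "norm_pos lam phi s u = sqrt (\<Sum>n. (lam n powr s * norm (cinner u (phi n)))\<^sup>2)"
  by (simp add: norm_pos_def power_mult_distrib powr_lam_square)

lemma norm_neg_eq: "norm_neg lam phi s F = sqrt (\<Sum>n. (lam n powr (- s) * norm (F (phi n)))\<^sup>2)"
  by (simp add: norm_neg_def power_mult_distrib powr_lam_square)

lemma H_pos_scaleC: "u \<in> H_pos lam phi s \<Longrightarrow> c *\<^sub>C u \<in> H_pos lam phi s"
proof -
  assume "u \<in> H_pos lam phi s"
  hence "summable (\<lambda>n. (norm c)\<^sup>2 * (lam n powr s * norm (cinner u (phi n)))\<^sup>2)"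
    unfolding H_pos_iff by (rule summable_mult)
  thus ?thesis unfolding H_pos_iff by (simp add: cinner_scaleC_left norm_mult power_mult_distrib mult_ac)
qed

lemma H_pos_add:
  assumes "u \<in> H_pos lam phi s" "v \<in> H_pos lam phi s"
  shows "u + v \<in> H_pos lam phi s"
  unfolding H_pos_iff
proof (rule summable_comparison_test')
  show "summable (\<lambda>n. 2 * (lam n powr s * norm (cinner u (phi n)))\<^sup>2 + 2 * (lam n powr s * norm (cinner v (phi n)))\<^sup>2)"
    using assms unfolding H_pos_iff by (intro summable_add summable_mult)
  fix n :: nat assume "n \<ge> 0"
  define a b where "a = lam n powr s * norm (cinner u (phi n))" and "b = lam n powr s * norm (cinner v (phi n))"
  have "lam n powr s * norm (cinner (u + v) (phi n)) \<le> a + b"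
    unfolding a_def b_def cinner_add_left distrib_left[symmetric] by (intro mult_left_mono norm_triangle_ineq) auto
  hence "(lam n powr s * norm (cinner (u + v) (phi n)))\<^sup>2 \<le> (a + b)\<^sup>2" by (intro power_mono) auto
  also have "\<dots> \<le> 2 * a\<^sup>2 + 2 * b\<^sup>2" using sum_squares_ge_zero[of "a - b" 0] by (simp add: power2_eq_square algebra_simps)
  finally show "norm ((lam n powr s * norm (cinner (u + v) (phi n)))\<^sup>2) \<le> 
      2 * (lam n powr s * norm (cinner u (phi n)))\<^sup>2 + 2 * (lam n powr s * norm (cinner v (phi n)))\<^sup>2"
    by (simp add: a_def b_def)
qed

lemma sum_phi_in_H_pos: "finite A \<Longrightarrow> (\<Sum>i\<in>A. c i *\<^sub>C phi i) \<in> H_pos lam phi s"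
  unfolding H_pos_iff by (rule summable_finite[of A]) (auto simp: cinner_sum_phi)

lemma phi_in_H_pos: "phi n \<in> H_pos lam phi s"
  using sum_phi_in_H_pos[of "{n}" "\<lambda>_. 1" s] by simp

lemma H_neg_scaleC: "F \<in> H_neg lam phi s \<Longrightarrow> v \<in> H_pos lam phi s \<Longrightarrow> F (c *\<^sub>C v) = cnj c * F v"
  by (simp add: H_neg_def)

lemma H_neg_add: "F \<in> H_neg lam phi s \<Longrightarrow> v \<in> H_pos lam phi s \<Longrightarrow> w \<in> H_pos lam phi s \<Longrightarrow> F (v + w) = F v + F w"
  by (simp add: H_neg_def)

lemma H_neg_sum:
  assumes F: "F \<in> H_neg lam phi s" and A: "finite A"
  shows "F (\<Sum>i\<in>A. c i *\<^sub>C phi i) = (\<Sum>i\<in>A. cnj (c i) * F (phi i))"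
  using A
proof (induction A)
  case empty
  show ?case using H_neg_scaleC[OF F phi_in_H_pos, of 0 0] by simp
next
  case (insert i A)
  have "F (c i *\<^sub>C phi i + (\<Sum>i\<in>A. c i *\<^sub>C phi i)) = F (c i *\<^sub>C phi i) + F (\<Sum>i\<in>A. c i *\<^sub>C phi i)"
    by (intro H_neg_add[OF F] H_pos_scaleC phi_in_H_pos sum_phi_in_H_pos insert(1))
  moreover have "F (c i *\<^sub>C phi i) = cnj (c i) * F (phi i)"
    by (rule H_neg_scaleC[OF F phi_in_H_pos])
  ultimately show ?case using insert by simp
qed

text \<open>The functional is tested on the truncations of its own Riesz representative.\<close>

lemma H_neg_summable:
  assumes F: "F \<in> H_neg lam phi s"
  shows "summable (\<lambda>n. (lam n powr (- s) * norm (F (phi n)))\<^sup>2)"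
proof -
  obtain K where K: "\<And>v. v \<in> H_pos lam phi s \<Longrightarrow> norm (F v) \<le> K * norm_pos lam phi s v"
    using F unfolding H_neg_def by blast
  define q where "q n = (lam n powr (- s) * norm (F (phi n)))\<^sup>2" for n
  have "(\<Sum>n<N. q n) \<le> K\<^sup>2" for N
  proof -
    define c where "c n = of_real (lam n powr (- 2 * s)) * F (phi n)" for n
    define v where "v = (\<Sum>i<N. c i *\<^sub>C phi i)"
    define S where "S = (\<Sum>n<N. q n)"
    have S0: "S \<ge> 0" by (auto simp: S_def q_def intro: sum_nonneg)
    have "F v = (\<Sum>i<N. cnj (c i) * F (phi i))" unfolding v_def by (rule H_neg_sum[OF F]) simp
    also have "\<dots> = (\<Sum>i<N. of_real (q i))"
    proof (rule sum.cong)
      fix i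
      have "cnj (c i) * F (phi i) = of_real (lam i powr (2 * - s)) * (F (phi i) * cnj (F (phi i)))" by (simp add: c_def)
      also have "\<dots> = of_real (q i)"
        unfolding complex_norm_square[symmetric] powr_lam_square[symmetric] q_def by (simp add: power_mult_distrib)
      finally show "cnj (c i) * F (phi i) = of_real (q i)" .
    qed simp
    finally have Fv: "F v = of_real S" by (simp add: S_def)
    have "(\<Sum>n. (lam n powr s * norm (cinner v (phi n)))\<^sup>2) = (\<Sum>n<N. (lam n powr s * norm (cinner v (phi n)))\<^sup>2)"
      by (rule suminf_finite) (auto simp: v_def cinner_sum_phi)
    also have "\<dots> = S"
      unfolding S_def
    proof (rule sum.cong)
      fix n assume "n \<in> {..<N}"
      hence "lam n powr s * norm (cinner v (phi n)) = (lam n powr s * lam n powr (- 2 * s)) * norm (F (phi n))"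
        by (simp add: v_def cinner_sum_phi c_def norm_mult)
      also have "lam n powr s * lam n powr (- 2 * s) = lam n powr (- s)" by (simp add: powr_add[symmetric])
      finally show "(lam n powr s * norm (cinner v (phi n)))\<^sup>2 = q n" by (simp add: q_def)
    qed simp
    finally have "norm_pos lam phi s v = sqrt S" by (simp add: norm_pos_eq)
    \<comment> \<open>For this v both \<open>F v\<close> and the square of its norm equal S, so
      boundedness of F reads \<open>S \<le> K * sqrt S\<close>, a bound on S independent of
      N.\<close>
    with K[of v] Fv S0 have *: "S \<le> K * sqrt S" by (simp add: v_def sum_phi_in_H_pos)
    show ?thesis unfolding S_def[symmetric]
    proof (cases "S = 0")
      case False
      hence "sqrt S > 0" using S0 by simp
      moreover have "sqrt S * sqrt S \<le> K * sqrt S" using * S0 by simp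
      ultimately have "sqrt S \<le> K" by (simp only: mult_le_cancel_right_pos)
      hence "(sqrt S)\<^sup>2 \<le> K\<^sup>2" using S0 by (intro power_mono) auto
      thus "S \<le> K\<^sup>2" using S0 by simp
    qed simp
  qed
  thus ?thesis
    unfolding q_def[symmetric] by (intro summableI_nonneg_bounded[of q "K\<^sup>2"]) (auto simp: q_def)
qed

lemma norm_le_norm_neg:
  assumes "summable (\<lambda>n. (lam n powr (- s) * norm (F (phi n)))\<^sup>2)"
  shows "norm (F (phi n)) \<le> lam n powr s * norm_neg lam phi s F"
proof -
  have "(lam n powr (- s) * norm (F (phi n)))\<^sup>2 \<le> (\<Sum>n. (lam n powr (- s) * norm (F (phi n)))\<^sup>2)"
    using sum_le_suminf[OF assms, of "{n}"] by simp
  hence "lam n powr (- s) * norm (F (phi n)) \<le> norm_neg lam phi s F"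
    unfolding norm_neg_eq by (rule real_le_rsqrt)
  hence "lam n powr s * (lam n powr (- s) * norm (F (phi n))) \<le> lam n powr s * norm_neg lam phi s F" by (intro mult_left_mono) auto
  moreover have "lam n powr s * lam n powr (- s) = 1" using lam_pos[of n] by (simp add: powr_add[symmetric])
  ultimately show ?thesis by (simp add: mult.assoc[symmetric])
qed

text \<open>The functional whose bracket with \<open>phi n\<close> is \<open>a n\<close>. The
  derivative of the solution, its Caputo derivative and its image under the operator are all
  constructed in this form.\<close>

definition dual_of :: "real \<Rightarrow> (nat \<Rightarrow> complex) \<Rightarrow> 'a \<Rightarrow> complex" where
  "dual_of s a v = (if v \<in> H_pos lam phi s then \<Sum>n. a n * cnj (cinner v (phi n)) else 0)"

lemma summable_dual_of:
  assumes a: "summable (\<lambda>n. (lam n powr (- s) * norm (a n))\<^sup>2)" and v: "v \<in> H_pos lam phi s"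
  shows "summable (\<lambda>n. norm (a n * cnj (cinner v (phi n))))"
    and "(\<Sum>n. norm (a n * cnj (cinner v (phi n)))) \<le> sqrt (\<Sum>n. (lam n powr (- s) * norm (a n))\<^sup>2) * norm_pos lam phi s v"
proof -
  have e: "norm (a n * cnj (cinner v (phi n))) = \<bar>(lam n powr (- s) * norm (a n)) * (lam n powr s * norm (cinner v (phi n)))\<bar>" for n
  proof -
    have "lam n powr (- s) * lam n powr s = 1" using lam_pos[of n] by (simp add: powr_add[symmetric])
    moreover have "(lam n powr (- s) * norm (a n)) * (lam n powr s * norm (cinner v (phi n))) = (lam n powr (- s) * lam n powr s) * (norm (a n) * norm (cinner v (phi n)))"
      by (simp only: mult_ac)
    ultimately show ?thesis by (simp add: norm_mult)
  qed
  note * = summable_square_imp_summable_mult[OF a v[unfolded H_pos_iff]]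
  show "summable (\<lambda>n. norm (a n * cnj (cinner v (phi n))))" unfolding e by (rule *)
  show "(\<Sum>n. norm (a n * cnj (cinner v (phi n)))) \<le> sqrt (\<Sum>n. (lam n powr (- s) * norm (a n))\<^sup>2) * norm_pos lam phi s v"
    unfolding e norm_pos_eq by (rule *)
qed

lemma dual_of_phi: "dual_of s a (phi m) = a m"
proof -
  have "(\<lambda>n. a n * cnj (cinner (phi m) (phi n))) = (\<lambda>n. if n = m then a n else 0)"
    by (auto simp: cinner_phi)
  thus ?thesis using sums_single[of m a] phi_in_H_pos by (simp add: dual_of_def sums_iff)
qed

lemma dual_of_in_H_neg:
  assumes a: "summable (\<lambda>n. (lam n powr (- s) * norm (a n))\<^sup>2)"
  shows "dual_of s a \<in> H_neg lam phi s"
  unfolding H_neg_def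
proof (intro CollectI conjI ballI allI impI exI)
  fix v w assume v: "v \<in> H_pos lam phi s" and w: "w \<in> H_pos lam phi s"
  note sv = summable_norm_cancel[OF summable_dual_of(1)[OF a v]]
  note sw = summable_norm_cancel[OF summable_dual_of(1)[OF a w]]
  show "dual_of s a (v + w) = dual_of s a v + dual_of s a w"
    using suminf_add[OF sv sw] v w H_pos_add[OF v w] by (simp add: dual_of_def cinner_add_left distrib_left)
next
  fix c v assume v: "v \<in> H_pos lam phi s"
  note sv = summable_norm_cancel[OF summable_dual_of(1)[OF a v]]
  show "dual_of s a (c *\<^sub>C v) = cnj c * dual_of s a v"
    using suminf_mult[OF sv, of "cnj c"] v H_pos_scaleC[OF v, of c] by (simp add: dual_of_def cinner_scaleC_left mult_ac)
next
  fix v assume v: "v \<in> H_pos lam phi s"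
  have "norm (dual_of s a v) \<le> (\<Sum>n. norm (a n * cnj (cinner v (phi n))))"
    using v summable_norm[OF summable_dual_of(1)[OF a v]] by (simp add: dual_of_def)
  also note summable_dual_of(2)[OF a v]
  finally show "norm (dual_of s a v) \<le> sqrt (\<Sum>n. (lam n powr (- s) * norm (a n))\<^sup>2) * norm_pos lam phi s v" .
qed (simp add: dual_of_def)

lemma norm_neg_dual_of: "norm_neg lam phi s (dual_of s a) = sqrt (\<Sum>n. (lam n powr (- s) * norm (a n))\<^sup>2)"
  by (simp add: norm_neg_eq dual_of_phi)

end

section \<open>The fractional Schroedinger equation\<close>

locale fractional_problem = eigenbasis lam phi
  for lam :: "nat \<Rightarrow> real" and phi :: "nat \<Rightarrow> 'a::chilbert_space" +
  fixes \<alpha> T :: real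
  assumes \<alpha>: "0 < \<alpha>" "\<alpha> < 1" and T: "0 < T"
begin

section \<open>The candidate solution and its regularity\<close>

definition sol_coeff :: "nat \<Rightarrow> real \<Rightarrow> complex" where
  "sol_coeff n t = mittag_leffler \<alpha> 1 (i_pow (- \<alpha>) * of_real (lam n * t powr \<alpha>))"

definition sol_density :: "nat \<Rightarrow> real \<Rightarrow> complex" where
  "sol_density n = ml_density \<alpha> (i_pow (- \<alpha>) * of_real (lam n))"

definition sol :: "'a \<Rightarrow> real \<Rightarrow> 'a" where
  "sol u0 t = (\<Sum>n. (cinner u0 (phi n) * sol_coeff n t) *\<^sub>C phi n)"

lemma sol_coeff_eq: "sol_coeff n t = mittag_leffler \<alpha> 1 (i_pow (- \<alpha>) * of_real (lam n) * of_real (t powr \<alpha>))"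
  by (simp add: sol_coeff_def mult.assoc)

lemma sol_coeff_bound:
  obtains M where "M > 0" "\<And>n t. norm (sol_coeff n t) \<le> M"
proof -
  obtain M where M: "M > 0" "\<And>x. x \<ge> 0 \<Longrightarrow> norm (mittag_leffler \<alpha> 1 (i_pow (- \<alpha>) * of_real x)) \<le> M"
    using norm_mittag_leffler_ray_le[OF \<alpha>] by metis
  show ?thesis
    by (rule that[OF M(1)]) (unfold sol_coeff_def, rule M(2), simp add: less_imp_le[OF lam_pos])
qed

lemma continuous_on_sol_coeff: "continuous_on {0..} (sol_coeff n)"
  unfolding sol_coeff_eq[abs_def] using \<alpha> by (intro continuous_on_mittag_leffler_powr)

lemma sol_coeff_0: "sol_coeff n 0 = 1"
  using \<alpha> by (simp add: sol_coeff_def)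

text \<open>Coefficients bounded uniformly in n act boundedly on every weighted square-summable
  space. The weight 1 is used for H and \<open>lam n powr s\<close> for the scale, with the same
  constant.\<close>

lemma summable_sol:
  assumes b: "summable (\<lambda>n. (w n * norm (cinner u0 (phi n)))\<^sup>2)"
  shows "summable (\<lambda>n. (w n * norm (cinner u0 (phi n) * sol_coeff n t))\<^sup>2)"
    and "\<And>M. (\<And>n. norm (sol_coeff n t) \<le> M) \<Longrightarrow> 
      sqrt (\<Sum>n. (w n * norm (cinner u0 (phi n) * sol_coeff n t))\<^sup>2) \<le> M * sqrt (\<Sum>n. (w n * norm (cinner u0 (phi n)))\<^sup>2)"
proof -
  have le: "(w n * norm (cinner u0 (phi n) * sol_coeff n t))\<^sup>2 \<le> M\<^sup>2 * (w n * norm (cinner u0 (phi n)))\<^sup>2"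
    if "\<And>n. norm (sol_coeff n t) \<le> M" for M n
  proof -
    have "(w n * norm (cinner u0 (phi n) * sol_coeff n t))\<^sup>2 = (norm (sol_coeff n t))\<^sup>2 * (w n * norm (cinner u0 (phi n)))\<^sup>2"
      by (simp add: norm_mult power_mult_distrib)
    also have "\<dots> \<le> M\<^sup>2 * (w n * norm (cinner u0 (phi n)))\<^sup>2"
      using that by (intro mult_right_mono power_mono) auto
    finally show ?thesis .
  qed
  obtain M0 where M0: "M0 > 0" "\<And>n t. norm (sol_coeff n t) \<le> M0" using sol_coeff_bound by metis
  show s: "summable (\<lambda>n. (w n * norm (cinner u0 (phi n) * sol_coeff n t))\<^sup>2)"
    by (rule summable_comparison_test'[OF summable_mult[OF b, of "M0\<^sup>2"]]) (use le[OF M0(2)] in auto)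
  fix M assume M: "\<And>n. norm (sol_coeff n t) \<le> M"
  have M': "M \<ge> 0" using M[of 0] norm_ge_zero order.trans by blast
  have "(\<Sum>n. (w n * norm (cinner u0 (phi n) * sol_coeff n t))\<^sup>2) \<le> (\<Sum>n. M\<^sup>2 * (w n * norm (cinner u0 (phi n)))\<^sup>2)"
    by (intro suminf_le s summable_mult b le[OF M])
  also have "\<dots> = M\<^sup>2 * (\<Sum>n. (w n * norm (cinner u0 (phi n)))\<^sup>2)" by (rule suminf_mult[OF b])
  finally have "sqrt (\<Sum>n. (w n * norm (cinner u0 (phi n) * sol_coeff n t))\<^sup>2) \<le> sqrt (M\<^sup>2 * (\<Sum>n. (w n * norm (cinner u0 (phi n)))\<^sup>2))"
    by (rule real_sqrt_le_mono)
  thus "sqrt (\<Sum>n. (w n * norm (cinner u0 (phi n) * sol_coeff n t))\<^sup>2) \<le> M * sqrt (\<Sum>n. (w n * norm (cinner u0 (phi n)))\<^sup>2)"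
    using M' by (simp add: real_sqrt_mult)
qed

lemma summable_sol_coeffs: "summable (\<lambda>n. (norm (cinner u0 (phi n) * sol_coeff n t))\<^sup>2)"
  using summable_sol(1)[where w = "\<lambda>_. 1", of u0 t] Bessel[of u0] by simp

lemma sol_sums: "(\<lambda>n. (cinner u0 (phi n) * sol_coeff n t) *\<^sub>C phi n) sums sol u0 t"
  unfolding sol_def by (rule summable_sums[OF Riesz_Fischer(1)[OF summable_sol_coeffs]])

lemma cinner_sol: "cinner (sol u0 t) (phi n) = cinner u0 (phi n) * sol_coeff n t"
  unfolding sol_def by (rule Riesz_Fischer(2)[OF summable_sol_coeffs])

lemma sol_0: "sol u0 0 = u0"
  using expansion[of u0] by (simp add: sol_def sol_coeff_0 sums_iff)

lemma sol_in_H_pos: "u0 \<in> H_pos lam phi s \<Longrightarrow> sol u0 t \<in> H_pos lam phi s"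
  unfolding H_pos_iff cinner_sol by (rule summable_sol(1))

lemma norm_pos_sol_le:
  assumes "u0 \<in> H_pos lam phi s" "\<And>n. norm (sol_coeff n t) \<le> M"
  shows "norm_pos lam phi s (sol u0 t) \<le> M * norm_pos lam phi s u0"
  using assms unfolding H_pos_iff norm_pos_eq cinner_sol by (rule summable_sol(2))

text \<open>The squared distance between two times is a series of continuous functions, dominated by
  \<open>(2 * M)^2\<close> times the series of the squared norm of \<open>u0\<close>. The
  Weierstrass test makes its sum continuous, and it is 0 at r = t.\<close>

lemma sol_in_C_pos:
  assumes u0: "u0 \<in> H_pos lam phi s"
  shows "sol u0 \<in> C_pos lam phi s T"
  unfolding C_pos_def
proof (intro CollectI ballI conjI)
  fix t assume t: "t \<in> {0..T}"
  show "sol u0 t \<in> H_pos lam phi s" by (rule sol_in_H_pos[OF u0])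
  obtain M where M: "M > 0" "\<And>n t. norm (sol_coeff n t) \<le> M" using sol_coeff_bound by metis
  define g where "g n r = (lam n powr s * norm (cinner u0 (phi n)))\<^sup>2 * (norm (sol_coeff n r - sol_coeff n t))\<^sup>2" for n r
  have ng: "norm_pos lam phi s (sol u0 r - sol u0 t) = sqrt (\<Sum>n. g n r)" for r
    by (simp add: norm_pos_eq cinner_diff_left cinner_sol g_def right_diff_distrib[symmetric] norm_mult power_mult_distrib mult_ac)
  have "uniform_limit {0..T} (\<lambda>N r. \<Sum>n<N. g n r) (\<lambda>r. \<Sum>n. g n r) sequentially"
  proof (rule Weierstrass_m_test)
    show "summable (\<lambda>n. (lam n powr s * norm (cinner u0 (phi n)))\<^sup>2 * (2 * M)\<^sup>2)"
      using u0 unfolding H_pos_iff by (rule summable_mult2)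
    fix n r
    have "norm (sol_coeff n r - sol_coeff n t) \<le> 2 * M"
      using norm_triangle_ineq4[of "sol_coeff n r" "sol_coeff n t"] M(2)[of n r] M(2)[of n t] by linarith
    hence "(norm (sol_coeff n r - sol_coeff n t))\<^sup>2 \<le> (2 * M)\<^sup>2" by (intro power_mono) auto
    thus "norm (g n r) \<le> (lam n powr s * norm (cinner u0 (phi n)))\<^sup>2 * (2 * M)\<^sup>2"
      unfolding g_def by (simp add: mult_left_mono)
  qed
  moreover have "continuous_on {0..T} (\<lambda>r. \<Sum>n<N. g n r)" for N
    unfolding g_def by (intro continuous_intros continuous_on_subset[OF continuous_on_sol_coeff]) auto
  ultimately have "continuous_on {0..T} (\<lambda>r. \<Sum>n. g n r)"
    by (intro uniform_limit_theorem[where F = sequentially]) auto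
  hence "continuous_on {0..T} (\<lambda>r. sqrt (\<Sum>n. g n r))" by (intro continuous_intros)
  hence "((\<lambda>r. sqrt (\<Sum>n. g n r)) \<longlongrightarrow> sqrt (\<Sum>n. g n t)) (at t within {0..T})"
    using t by (auto simp: continuous_on_def)
  thus "((\<lambda>r. norm_pos lam phi s (sol u0 r - sol u0 t)) \<longlongrightarrow> 0) (at t within {0..T})"
    by (simp add: ng g_def)
qed

lemma continuous_on_sol: "continuous_on {0..T} (sol u0)"
  unfolding continuous_on_def
proof
  fix t assume "t \<in> {0..T}"
  hence "((\<lambda>r. norm (sol u0 r - sol u0 t)) \<longlongrightarrow> 0) (at t within {0..T})"
    using sol_in_C_pos[OF H_pos_0, of u0] by (simp add: C_pos_def norm_pos_0)
  thus "(sol u0 \<longlongrightarrow> sol u0 t) (at t within {0..T})"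
    using Lim_null tendsto_norm_zero_iff by blast
qed

section \<open>The time derivative as a functional\<close>

lemma sol_density_bound:
  obtains C where "C > 0" 
    "\<And>n t. t \<ge> 0 \<Longrightarrow> norm (sol_density n t) \<le> lam n powr (1 / \<alpha>) * (C * (1 + t powr (\<alpha> - 1)))"
proof -
  obtain C where C: "C > 0"
    "\<And>l t. l \<ge> lam 0 \<Longrightarrow> t \<ge> 0 \<Longrightarrow> norm (ml_density \<alpha> (i_pow (- \<alpha>) * of_real l) t) \<le> l powr (1 / \<alpha>) * (C * (1 + t powr (\<alpha> - 1)))"
    using norm_ml_density_le[OF \<alpha> lam_0] by metis
  show ?thesis by (rule that[OF C(1)]) (simp add: sol_density_def C(2) lam_ge)
qed

lemma borel_measurable_sol_density [measurable]: "sol_density n \<in> borel_measurable borel"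
  by (simp add: sol_density_def)

lemma integral_sol_density:
  "t \<ge> 0 \<Longrightarrow> has_bochner_integral lborel (\<lambda>r. indicator {0..t} r *\<^sub>R sol_density n r) (sol_coeff n t - 1)"
  unfolding sol_coeff_eq sol_density_def by (rule integral_ml_density[OF \<alpha>(1)])

lemma integral_caputo_sol_density:
  "t > 0 \<Longrightarrow> has_bochner_integral lborel (\<lambda>r. indicator {0..t} r *\<^sub>R (of_real ((t - r) powr (- \<alpha>)) * sol_density n r))
     (of_real (Gamma (1 - \<alpha>)) * (i_pow (- \<alpha>) * of_real (lam n)) * sol_coeff n t)"
  unfolding sol_coeff_eq sol_density_def by (rule integral_caputo_ml_density[OF \<alpha>])

definition sol_deriv :: "'a \<Rightarrow> real \<Rightarrow> 'a \<Rightarrow> complex" where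
  "sol_deriv u0 r = dual_of (1 / \<alpha>) (\<lambda>n. cinner u0 (phi n) * sol_density n r)"

lemma lam_powr_cancel: "lam n powr (- s) * (lam n powr s * x) = x"
proof -
  have "lam n powr (- s) * lam n powr s = 1" using lam_pos[of n] by (simp add: powr_add[symmetric])
  thus ?thesis by (simp add: mult.assoc[symmetric])
qed

lemma sol_deriv_coeff_le:
  assumes "norm (sol_density n r) \<le> lam n powr (1 / \<alpha>) * D"
  shows "lam n powr (- (1 / \<alpha>)) * norm (c * sol_density n r) \<le> D * norm c"
proof -
  have "lam n powr (- (1 / \<alpha>)) * norm (c * sol_density n r) \<le> lam n powr (- (1 / \<alpha>)) * (norm c * (lam n powr (1 / \<alpha>) * D))"
    unfolding norm_mult using assms by (intro mult_left_mono) auto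
  also have "\<dots> = lam n powr (- (1 / \<alpha>)) * (lam n powr (1 / \<alpha>) * (D * norm c))" by (simp only: mult_ac)
  also have "\<dots> = D * norm c" by (rule lam_powr_cancel)
  finally show ?thesis .
qed

text \<open>The weight \<open>lam n powr (- (1 / \<alpha>))\<close> of the dual norm cancels the
  growth of the density exactly, so what remains is controlled by the coefficients of
  \<open>u0\<close> in H.\<close>

lemma summable_sol_deriv:
  assumes D: "\<And>n. norm (sol_density n r) \<le> lam n powr (1 / \<alpha>) * D"
  shows "summable (\<lambda>n. (lam n powr (- (1 / \<alpha>)) * norm (cinner u0 (phi n) * sol_density n r))\<^sup>2)"
    and "norm_neg lam phi (1 / \<alpha>) (sol_deriv u0 r) \<le> D * norm u0"
proof -
  have D0: "D \<ge> 0"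
  proof -
    have "0 \<le> lam 0 powr (1 / \<alpha>) * D" using D[of 0] norm_ge_zero order.trans by blast
    thus ?thesis using lam_0 by (simp add: zero_le_mult_iff)
  qed
  have le: "(lam n powr (- (1 / \<alpha>)) * norm (cinner u0 (phi n) * sol_density n r))\<^sup>2 \<le> D\<^sup>2 * (norm (cinner u0 (phi n)))\<^sup>2" for n
    unfolding power_mult_distrib[of D, symmetric] by (intro power_mono sol_deriv_coeff_le D) auto
  show s: "summable (\<lambda>n. (lam n powr (- (1 / \<alpha>)) * norm (cinner u0 (phi n) * sol_density n r))\<^sup>2)"
    by (rule summable_comparison_test'[OF summable_mult[OF Bessel[of u0], of "D\<^sup>2"]]) (use le in auto)
  have "norm_neg lam phi (1 / \<alpha>) (sol_deriv u0 r) = sqrt (\<Sum>n. (lam n powr (- (1 / \<alpha>)) * norm (cinner u0 (phi n) * sol_density n r))\<^sup>2)"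
    unfolding sol_deriv_def by (rule norm_neg_dual_of)
  also have "\<dots> \<le> sqrt (\<Sum>n. D\<^sup>2 * (norm (cinner u0 (phi n)))\<^sup>2)"
    by (intro real_sqrt_le_mono suminf_le le s summable_mult Bessel)
  also have "\<dots> = sqrt (D\<^sup>2 * (\<Sum>n. (norm (cinner u0 (phi n)))\<^sup>2))" by (subst suminf_mult[OF Bessel]) simp
  also have "\<dots> = D * norm u0"
    using D0 norm_pos_0[of u0] lam_pos by (simp add: real_sqrt_mult norm_pos_def less_imp_neq[THEN not_sym])
  finally show "norm_neg lam phi (1 / \<alpha>) (sol_deriv u0 r) \<le> D * norm u0" .
qed

lemma sol_deriv_in_H_neg:
  assumes "r \<ge> 0"
  shows "sol_deriv u0 r \<in> H_neg lam phi (1 / \<alpha>)"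
proof -
  obtain C where "\<And>n t. t \<ge> 0 \<Longrightarrow> norm (sol_density n t) \<le> lam n powr (1 / \<alpha>) * (C * (1 + t powr (\<alpha> - 1)))"
    using sol_density_bound by metis
  thus ?thesis
    unfolding sol_deriv_def by (intro dual_of_in_H_neg summable_sol_deriv(1)) (use assms in auto)
qed

lemma borel_measurable_sol_deriv [measurable]: "(\<lambda>r. sol_deriv u0 r v) \<in> borel_measurable borel"
  unfolding sol_deriv_def dual_of_def by (cases "v \<in> H_pos lam phi (1 / \<alpha>)") simp_all

lemma borel_measurable_norm_neg_sol_deriv [measurable]: "(\<lambda>r. norm_neg lam phi (1 / \<alpha>) (sol_deriv u0 r)) \<in> borel_measurable borel"
  unfolding sol_deriv_def norm_neg_dual_of by measurable

lemma norm_neg_scale: "norm_neg lam phi s (\<lambda>v. of_real k * F v) = \<bar>k\<bar> * norm_neg lam phi s F"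
  if "summable (\<lambda>n. (lam n powr (- s) * norm (F (phi n)))\<^sup>2)"
proof -
  have "(\<Sum>n. (lam n powr (- s) * norm (of_real k * F (phi n)))\<^sup>2) = (\<Sum>n. k\<^sup>2 * (lam n powr (- s) * norm (F (phi n)))\<^sup>2)"
    by (simp add: norm_mult power_mult_distrib mult_ac)
  also have "\<dots> = k\<^sup>2 * (\<Sum>n. (lam n powr (- s) * norm (F (phi n)))\<^sup>2)" by (rule suminf_mult[OF that])
  finally show ?thesis by (simp add: norm_neg_eq real_sqrt_mult)
qed

lemma H_neg_scale:
  assumes "F \<in> H_neg lam phi s"
  shows "(\<lambda>v. c * F v) \<in> H_neg lam phi s"
proof -
  obtain K where K: "\<And>v. v \<in> H_pos lam phi s \<Longrightarrow> norm (F v) \<le> K * norm_pos lam phi s v"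
    using assms unfolding H_neg_def by blast
  have "norm (c * F v) \<le> (norm c * K) * norm_pos lam phi s v" if "v \<in> H_pos lam phi s" for v
    unfolding norm_mult mult.assoc by (intro mult_left_mono K that) auto
  hence "\<exists>K. \<forall>v\<in>H_pos lam phi s. norm (c * F v) \<le> K * norm_pos lam phi s v" by blast
  thus ?thesis using assms by (simp add: H_neg_def distrib_left mult_ac)
qed

text \<open>The weight \<open>k\<close> is 1 for the reconstruction of the solution from its derivative and
  \<open>(t - r) powr (- \<alpha>)\<close> for the Caputo derivative.\<close>

lemma H_neg_integrable_sol_deriv:
  assumes [measurable]: "k \<in> borel_measurable borel"
    and k: "set_integrable lborel {0..t} (\<lambda>r. k r * (1 + r powr (\<alpha> - 1)))"
  shows "H_neg_integrable lam phi (1 / \<alpha>) {0..t} (\<lambda>r v. of_real (k r) * sol_deriv u0 r v)"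
  unfolding H_neg_integrable_def
proof (intro conjI ballI)
  obtain C where C: "C > 0" "\<And>n t. t \<ge> 0 \<Longrightarrow> norm (sol_density n t) \<le> lam n powr (1 / \<alpha>) * (C * (1 + t powr (\<alpha> - 1)))"
    using sol_density_bound by metis
  show "(\<lambda>v. of_real (k r) * sol_deriv u0 r v) \<in> H_neg lam phi (1 / \<alpha>)" if "r \<in> {0..t}" for r
    using that by (intro H_neg_scale sol_deriv_in_H_neg) auto
  show "set_borel_measurable lborel {0..t} (\<lambda>r. of_real (k r) * sol_deriv u0 r v)" for v
    unfolding set_borel_measurable_def by measurable
  have nn: "norm_neg lam phi (1 / \<alpha>) (\<lambda>v. of_real (k r) * sol_deriv u0 r v) = \<bar>k r\<bar> * norm_neg lam phi (1 / \<alpha>) (sol_deriv u0 r)" if "r \<in> {0..t}" for r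
    by (rule norm_neg_scale, rule H_neg_summable, rule sol_deriv_in_H_neg) (use that in auto)
  have "set_integrable lborel {0..t} (\<lambda>r. \<bar>k r\<bar> * norm_neg lam phi (1 / \<alpha>) (sol_deriv u0 r))"
    unfolding set_integrable_def
  proof (rule Bochner_Integration.integrable_bound)
    show "integrable lborel (\<lambda>r. (C * norm u0) * (indicator {0..t} r *\<^sub>R (k r * (1 + r powr (\<alpha> - 1)))))"
      using k unfolding set_integrable_def by (rule integrable_mult_right)
    show "AE r in lborel. norm (indicator {0..t} r *\<^sub>R (\<bar>k r\<bar> * norm_neg lam phi (1 / \<alpha>) (sol_deriv u0 r)))
       \<le> norm ((C * norm u0) * (indicator {0..t} r *\<^sub>R (k r * (1 + r powr (\<alpha> - 1)))))"
    proof (rule AE_I2)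
      fix r
      show "norm (indicator {0..t} r *\<^sub>R (\<bar>k r\<bar> * norm_neg lam phi (1 / \<alpha>) (sol_deriv u0 r)))
       \<le> norm ((C * norm u0) * (indicator {0..t} r *\<^sub>R (k r * (1 + r powr (\<alpha> - 1)))))"
      proof (cases "r \<in> {0..t}")
        case True
        hence "norm_neg lam phi (1 / \<alpha>) (sol_deriv u0 r) \<le> (C * (1 + r powr (\<alpha> - 1))) * norm u0"
          by (intro summable_sol_deriv(2) C(2)) auto
        moreover have "norm_neg lam phi (1 / \<alpha>) (sol_deriv u0 r) \<ge> 0"
          unfolding norm_neg_eq by (intro real_sqrt_ge_zero suminf_nonneg H_neg_summable sol_deriv_in_H_neg) (use True in auto)
        moreover have "\<bar>1 + r powr (\<alpha> - 1)\<bar> = 1 + r powr (\<alpha> - 1)" by (simp add: add_nonneg_nonneg)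
        ultimately show ?thesis using True C(1) mult_left_mono[of "norm_neg lam phi (1 / \<alpha>) (sol_deriv u0 r)" "(C * (1 + r powr (\<alpha> - 1))) * norm u0" "\<bar>k r\<bar>"]
          by (simp add: abs_mult mult_ac)
      qed simp
    qed
  qed measurable
  thus "set_integrable lborel {0..t} (\<lambda>r. norm_neg lam phi (1 / \<alpha>) (\<lambda>v. of_real (k r) * sol_deriv u0 r v))"
    by (subst set_integrable_cong[OF refl refl nn]) auto
qed

text \<open>Sum and integral are exchanged. The values \<open>J n\<close> are left open so that both
  the primitive and the Caputo integral are instances.\<close>

lemma integral_sol_deriv:
  assumes v: "v \<in> H_pos lam phi (1 / \<alpha>)"
    and k: "set_integrable lborel {0..t} (\<lambda>r. k r * (1 + r powr (\<alpha> - 1)))"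
    and J: "\<And>n. has_bochner_integral lborel (\<lambda>r. indicator {0..t} r *\<^sub>R (of_real (k r) * sol_density n r)) (J n)"
  shows "(\<lambda>n. cinner u0 (phi n) * J n * cnj (cinner v (phi n))) sums
     H_neg_integral {0..t} (\<lambda>r v. of_real (k r) * sol_deriv u0 r v) v"
proof -
  obtain C where C: "C > 0" "\<And>n t. t \<ge> 0 \<Longrightarrow> norm (sol_density n t) \<le> lam n powr (1 / \<alpha>) * (C * (1 + t powr (\<alpha> - 1)))"
    using sol_density_bound by metis
  define b where "b n = cinner u0 (phi n) * cnj (cinner v (phi n))" for n
  define D where "D r = \<bar>indicator {0..t} r *\<^sub>R (k r * (1 + r powr (\<alpha> - 1)))\<bar>" for r
  define f where "f n r = b n * (indicator {0..t} r *\<^sub>R (of_real (k r) * sol_density n r))" for n r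
  have Di: "integrable lborel D" using k unfolding D_def set_integrable_def by (rule integrable_abs)
  have fi: "has_bochner_integral lborel (f n) (b n * J n)" for n
    unfolding f_def by (rule has_bochner_integral_mult_right[OF J])
  \<comment> \<open>The majorant separates into e, depending on n, and D, depending on r.
    Summability of e is Cauchy-Schwarz between \<open>u0\<close> in H and v in the space of order
    \<open>1 / \<alpha>\<close>.\<close>
  define e where "e n = norm (b n) * lam n powr (1 / \<alpha>) * C" for n
  have se: "summable e"
  proof -
    have "summable (\<lambda>n. \<bar>norm (cinner u0 (phi n)) * (lam n powr (1 / \<alpha>) * norm (cinner v (phi n)))\<bar>)"
      by (rule summable_square_imp_summable_mult(1)[OF Bessel v[unfolded H_pos_iff]])
    from summable_mult[OF this, of C] show ?thesis
      by (simp add: e_def[abs_def] b_def norm_mult mult_ac)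
  qed
  have fe: "norm (f n r) \<le> e n * D r" for n r
  proof (cases "r \<in> {0..t}")
    case True
    hence "norm (f n r) = norm (b n) * (\<bar>k r\<bar> * norm (sol_density n r))" by (simp add: f_def norm_mult)
    also have "\<dots> \<le> norm (b n) * (\<bar>k r\<bar> * (lam n powr (1 / \<alpha>) * (C * (1 + r powr (\<alpha> - 1)))))"
      using True by (intro mult_left_mono C(2)) auto
    also have "\<dots> = e n * D r" using True by (simp add: e_def D_def abs_mult abs_of_nonneg[of "1 + r powr (\<alpha> - 1)"] mult_ac)
    finally show ?thesis .
  qed (simp add: f_def D_def)
  have i: "integrable lborel (f n)" for n using fi by (auto simp: has_bochner_integral_iff)
  have s1: "AE r in lborel. summable (\<lambda>n. norm (f n r))"
  proof (rule AE_I2)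
    fix r show "summable (\<lambda>n. norm (f n r))"
      by (rule summable_comparison_test'[OF summable_mult2[OF se, of "D r"]]) (use fe in auto)
  qed
  have s2: "summable (\<lambda>n. \<integral>r. norm (f n r) \<partial>lborel)"
  proof (rule summable_comparison_test'[OF summable_mult2[OF se, of "integral\<^sup>L lborel D"]])
    fix n :: nat
    have "(\<integral>r. norm (f n r) \<partial>lborel) \<le> (\<integral>r. e n * D r \<partial>lborel)"
      using i Di fe by (intro integral_mono) auto
    thus "norm (\<integral>r. norm (f n r) \<partial>lborel) \<le> e n * integral\<^sup>L lborel D" by simp
  qed
  have sm: "(\<lambda>n. b n * J n) sums (\<integral>r. (\<Sum>n. f n r) \<partial>lborel)"
    using sums_integral[OF i s1 s2] fi by (simp add: has_bochner_integral_iff)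
  have "(\<Sum>n. f n r) = indicator {0..t} r *\<^sub>R (of_real (k r) * sol_deriv u0 r v)" for r
  proof (cases "r \<in> {0..t}")
    case True
    hence r: "r \<ge> 0" by simp
    have sv: "summable (\<lambda>n. cinner u0 (phi n) * sol_density n r * cnj (cinner v (phi n)))"
      by (rule summable_norm_cancel[OF summable_dual_of(1)[OF summable_sol_deriv(1)[OF C(2)[OF r]] v]])
    have "(\<Sum>n. f n r) = (\<Sum>n. of_real (k r) * (cinner u0 (phi n) * sol_density n r * cnj (cinner v (phi n))))"
      using True by (simp add: f_def b_def mult_ac)
    also have "\<dots> = of_real (k r) * (\<Sum>n. cinner u0 (phi n) * sol_density n r * cnj (cinner v (phi n)))"
      by (rule suminf_mult[OF sv])
    finally show ?thesis using True v by (simp add: sol_deriv_def dual_of_def)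
  qed (simp add: f_def)
  with sm show ?thesis by (simp add: H_neg_integral_def set_lebesgue_integral_def b_def mult_ac)
qed

text \<open>Reading the constant 1 as a power with exponent 0 makes both integrands sums of Beta
  kernels. Since \<open>0 powr 0 = 0\<close>, this holds only away from r = 0 and r = t, hence the
  correction on a null set.\<close>

lemma set_integrable_density_bound: "set_integrable lborel {0..t} (\<lambda>r. 1 * (1 + r powr (\<alpha> - 1)))"
  and set_integrable_caputo_bound: "set_integrable lborel {0..t} (\<lambda>r. (t - r) powr (- \<alpha>) * (1 + r powr (\<alpha> - 1)))"
proof -
  have B: "set_integrable lborel {0..t} (\<lambda>r. (t - r) powr (b - 1) * r powr (a - 1))" if "a > 0" "b > 0" for a b
  proof (cases "t > 0")
    case True
    from has_bochner_integral_Beta_kernel[OF that True] show ?thesis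
      by (simp add: set_integrable_def has_bochner_integral_iff)
  next
    case False
    have "(\<lambda>r. indicator {0..t} r *\<^sub>R ((t - r) powr (b - 1) * r powr (a - 1))) = (\<lambda>_. 0)"
      using False by (auto simp: indicator_def fun_eq_iff)
    thus ?thesis by (simp add: set_integrable_def)
  qed
  have one: "set_integrable lborel {0..t} f" if "AE r in lborel. r \<noteq> 0 \<longrightarrow> r \<noteq> t \<longrightarrow> f r = g r" "set_integrable lborel {0..t} g" 
     "f \<in> borel_measurable borel" for f g :: "real \<Rightarrow> real"
  proof -
    have "integrable lborel (\<lambda>r. indicator {0..t} r *\<^sub>R f r) \<longleftrightarrow> integrable lborel (\<lambda>r. indicator {0..t} r *\<^sub>R g r)"
    proof (rule integrable_cong_AE)
      show "(\<lambda>r. indicator {0..t} r *\<^sub>R f r) \<in> borel_measurable lborel" using that(3) by simp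
      show "(\<lambda>r. indicator {0..t} r *\<^sub>R g r) \<in> borel_measurable lborel" 
        using that(2) by (auto simp: set_integrable_def)
      show "AE r in lborel. indicator {0..t} r *\<^sub>R f r = indicator {0..t} r *\<^sub>R g r"
        using that(1) AE_lborel_singleton[of 0] AE_lborel_singleton[of t] by eventually_elim auto
    qed
    thus ?thesis using that(2) by (simp add: set_integrable_def)
  qed
  show "set_integrable lborel {0..t} (\<lambda>r. 1 * (1 + r powr (\<alpha> - 1)))"
    by (rule one[OF _ set_integral_add(1)[OF B[of 1 1] B[of \<alpha> 1]]]) (use \<alpha> in auto)
  show "set_integrable lborel {0..t} (\<lambda>r. (t - r) powr (- \<alpha>) * (1 + r powr (\<alpha> - 1)))"
    by (rule one[OF _ set_integral_add(1)[OF B[of 1 "1 - \<alpha>"] B[of \<alpha> "1 - \<alpha>"]]]) (use \<alpha> in \<open>auto simp: distrib_left\<close>)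
qed

end

context fractional_problem
begin

section \<open>The candidate solves the equation\<close>

abbreviation solves_at :: "(real \<Rightarrow> 'a) \<Rightarrow> real \<Rightarrow> bool" where
  "solves_at w t \<equiv> (\<exists>F\<in>H_neg lam phi (1 / \<alpha>). \<exists>G\<in>H_neg lam phi (1 / \<alpha>).
           has_caputo_derivative lam phi (1 / \<alpha>) \<alpha> (\<lambda>r. embed lam phi (1 / \<alpha>) (w r)) t F \<and>
           has_A_value lam phi (1 / \<alpha>) (w t) G \<and> (\<forall>v. i_pow \<alpha> * F v + G v = 0))"

lemma embed_sol_sums:
  assumes v: "v \<in> H_pos lam phi s"
  shows "(\<lambda>n. cinner u0 (phi n) * sol_coeff n t * cnj (cinner v (phi n))) sums embed lam phi s (sol u0 t) v"
  using Parseval[of "sol u0 t" v] v by (simp add: embed_def cinner_sol)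

text \<open>The single density \<open>sol_deriv u0\<close> serves every t. Both identities are
  checked on brackets, by termwise integration for v in the space and trivially outside, where all
  functionals are 0.\<close>

lemma has_caputo_derivative_sol:
  assumes t: "t > 0"
  shows "has_caputo_derivative lam phi (1 / \<alpha>) \<alpha> (\<lambda>r. embed lam phi (1 / \<alpha>) (sol u0 r)) t
     (dual_of (1 / \<alpha>) (\<lambda>n. i_pow (- \<alpha>) * of_real (lam n) * (cinner u0 (phi n) * sol_coeff n t)))"
  unfolding has_caputo_derivative_def
proof (intro exI[of _ "sol_deriv u0"] conjI ballI allI)
  show "H_neg_integrable lam phi (1 / \<alpha>) {0..t} (sol_deriv u0)"
    using H_neg_integrable_sol_deriv[OF _ set_integrable_density_bound[of t], of u0] by simp
  show "H_neg_integrable lam phi (1 / \<alpha>) {0..t} (\<lambda>r v. of_real ((t - r) powr (- \<alpha>)) * sol_deriv u0 r v)"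
    by (rule H_neg_integrable_sol_deriv[OF _ set_integrable_caputo_bound]) measurable
next
  fix r v assume r: "r \<in> {0..t}"
  show "embed lam phi (1 / \<alpha>) (sol u0 r) v = embed lam phi (1 / \<alpha>) (sol u0 0) v + H_neg_integral {0..r} (sol_deriv u0) v"
  proof (cases "v \<in> H_pos lam phi (1 / \<alpha>)")
    case True
    have "(\<lambda>n. cinner u0 (phi n) * (sol_coeff n r - 1) * cnj (cinner v (phi n))) sums
       H_neg_integral {0..r} (\<lambda>r v. of_real 1 * sol_deriv u0 r v) v"
      by (rule integral_sol_deriv[OF True set_integrable_density_bound]) (use integral_sol_density[of r] r in simp)
    hence "(\<lambda>n. cinner u0 (phi n) * (sol_coeff n r - 1) * cnj (cinner v (phi n))) sums H_neg_integral {0..r} (sol_deriv u0) v"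
      by simp
    from sums_add[OF embed_sol_sums[OF True, of u0 0] this]
    have "(\<lambda>n. cinner u0 (phi n) * sol_coeff n r * cnj (cinner v (phi n))) sums 
       (embed lam phi (1 / \<alpha>) (sol u0 0) v + H_neg_integral {0..r} (sol_deriv u0) v)"
      by (simp add: sol_coeff_0 algebra_simps)
    with embed_sol_sums[OF True, of u0 r] show ?thesis by (rule sums_unique2)
  qed (simp add: embed_def H_neg_integral_def sol_deriv_def dual_of_def set_lebesgue_integral_def)
next
  fix v
  show "dual_of (1 / \<alpha>) (\<lambda>n. i_pow (- \<alpha>) * of_real (lam n) * (cinner u0 (phi n) * sol_coeff n t)) v =
     of_real (1 / Gamma (1 - \<alpha>)) * H_neg_integral {0..t} (\<lambda>r v. of_real ((t - r) powr (- \<alpha>)) * sol_deriv u0 r v) v"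
  proof (cases "v \<in> H_pos lam phi (1 / \<alpha>)")
    case True
    have G: "Gamma (1 - \<alpha>) \<noteq> 0" by (rule less_imp_neq[THEN not_sym, OF Gamma_real_pos]) (use \<alpha> in simp)
    have "(\<lambda>n. cinner u0 (phi n) * (of_real (Gamma (1 - \<alpha>)) * (i_pow (- \<alpha>) * of_real (lam n)) * sol_coeff n t) * cnj (cinner v (phi n))) sums
       H_neg_integral {0..t} (\<lambda>r v. of_real ((t - r) powr (- \<alpha>)) * sol_deriv u0 r v) v"
      by (rule integral_sol_deriv[OF True set_integrable_caputo_bound integral_caputo_sol_density[OF t]])
    from sums_mult[OF this, of "of_real (1 / Gamma (1 - \<alpha>))"] G
    have "(\<lambda>n. i_pow (- \<alpha>) * of_real (lam n) * (cinner u0 (phi n) * sol_coeff n t) * cnj (cinner v (phi n))) sums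
       (of_real (1 / Gamma (1 - \<alpha>)) * H_neg_integral {0..t} (\<lambda>r v. of_real ((t - r) powr (- \<alpha>)) * sol_deriv u0 r v) v)"
      by (simp add: mult_ac)
    thus ?thesis using True by (simp add: dual_of_def sums_iff)
  qed (simp add: H_neg_integral_def sol_deriv_def dual_of_def set_lebesgue_integral_def)
qed

text \<open>The exponent \<open>1 - 1 / \<alpha>\<close> is negative, so
  \<open>lam n powr (1 - 1 / \<alpha>)\<close> is at most its value at n = 0: the operator maps H
  into the dual space of order \<open>1 / \<alpha>\<close>. The unit factor c allows for
  \<open>i_pow (- \<alpha>)\<close> and for the sign of the operator.\<close>

lemma summable_lam_sol:
  assumes c: "norm c = 1"
  shows "summable (\<lambda>n. (lam n powr (- (1 / \<alpha>)) * norm (c * of_real (lam n) * (cinner u0 (phi n) * sol_coeff n t)))\<^sup>2)"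
proof (rule summable_comparison_test')
  show "summable (\<lambda>n. (lam 0 powr (1 - 1 / \<alpha>))\<^sup>2 * (norm (cinner u0 (phi n) * sol_coeff n t))\<^sup>2)"
    by (intro summable_mult summable_sol_coeffs)
  fix n :: nat
  have "lam n powr (- (1 / \<alpha>)) * lam n = lam n powr (1 - 1 / \<alpha>)"
    using lam_pos[of n] by (simp add: powr_diff powr_minus field_simps)
  also have "\<dots> \<le> lam 0 powr (1 - 1 / \<alpha>)"
    using lam_0 lam_ge[of n] \<alpha> by (intro powr_mono2') auto
  finally have "lam n powr (- (1 / \<alpha>)) * lam n * norm (cinner u0 (phi n) * sol_coeff n t) \<le> lam 0 powr (1 - 1 / \<alpha>) * norm (cinner u0 (phi n) * sol_coeff n t)"
    by (intro mult_right_mono) auto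
  hence "lam n powr (- (1 / \<alpha>)) * norm (c * of_real (lam n) * (cinner u0 (phi n) * sol_coeff n t)) \<le> lam 0 powr (1 - 1 / \<alpha>) * norm (cinner u0 (phi n) * sol_coeff n t)"
    using c lam_pos[of n] by (simp add: norm_mult mult.assoc)
  hence "(lam n powr (- (1 / \<alpha>)) * norm (c * of_real (lam n) * (cinner u0 (phi n) * sol_coeff n t)))\<^sup>2 \<le> (lam 0 powr (1 - 1 / \<alpha>) * norm (cinner u0 (phi n) * sol_coeff n t))\<^sup>2"
    by (intro power_mono) auto
  thus "norm ((lam n powr (- (1 / \<alpha>)) * norm (c * of_real (lam n) * (cinner u0 (phi n) * sol_coeff n t)))\<^sup>2) \<le> (lam 0 powr (1 - 1 / \<alpha>))\<^sup>2 * (norm (cinner u0 (phi n) * sol_coeff n t))\<^sup>2"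
    by (simp add: power_mult_distrib)
qed

lemma sum_embed_phi: "(\<Sum>n<N. c n * embed lam phi s (phi n) (phi m)) = (if m < N then c m else 0)"
proof -
  have "(\<Sum>n<N. c n * embed lam phi s (phi n) (phi m)) = (\<Sum>n<N. if n = m then c n else 0)"
    by (intro sum.cong) (auto simp: embed_def phi_in_H_pos cinner_phi)
  thus ?thesis by simp
qed

text \<open>The error of the N-th partial sum has coefficients 0 below N and \<open>a m\<close> from
  N on. Its squared norm is the tail of a convergent series.\<close>

lemma has_A_value_dual_of:
  assumes a: "\<And>n. a n = - (of_real (lam n) * cinner u (phi n))"
    and s: "summable (\<lambda>n. (lam n powr (- s) * norm (a n))\<^sup>2)"
  shows "has_A_value lam phi s u (dual_of s a)"
  unfolding has_A_value_def
proof
  show "dual_of s a \<in> H_neg lam phi s" by (rule dual_of_in_H_neg[OF s])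
  define h where "h n = (lam n powr (- s) * norm (a n))\<^sup>2" for n
  have "norm_neg lam phi s (\<lambda>v. dual_of s a v - (- (\<Sum>n<N. of_real (lam n) * cinner u (phi n) * embed lam phi s (phi n) v)))
     = sqrt (suminf h - (\<Sum>n<N. h n))" for N
  proof -
    have "dual_of s a (phi m) - (- (\<Sum>n<N. of_real (lam n) * cinner u (phi n) * embed lam phi s (phi n) (phi m))) = (if m < N then 0 else a m)" for m
      by (simp add: dual_of_phi sum_embed_phi a)
    hence "norm_neg lam phi s (\<lambda>v. dual_of s a v - (- (\<Sum>n<N. of_real (lam n) * cinner u (phi n) * embed lam phi s (phi n) v)))
      = sqrt (\<Sum>m. (lam m powr (- s) * norm (if m < N then 0 else a m))\<^sup>2)" by (simp add: norm_neg_eq)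
    also have "(\<lambda>m. (lam m powr (- s) * norm (if m < N then 0 else a m))\<^sup>2) = (\<lambda>m. h m - (if m < N then h m else 0))"
      by (auto simp: h_def)
    also have "(\<Sum>m. h m - (if m < N then h m else 0)) = suminf h - (\<Sum>m. if m < N then h m else 0)"
      by (rule suminf_diff[symmetric]) (use s in \<open>auto simp: h_def[abs_def] intro!: summable_finite[of "{..<N}"]\<close>)
    also have "(\<Sum>m. if m < N then h m else 0) = (\<Sum>m<N. h m)"
      by (subst suminf_finite[of "{..<N}"]) auto
    finally show ?thesis .
  qed
  moreover have "(\<lambda>N. sqrt (suminf h - (\<Sum>n<N. h n))) \<longlonglongrightarrow> sqrt (suminf h - suminf h)"
    by (intro tendsto_intros summable_LIMSEQ) (use s in \<open>simp add: h_def[abs_def]\<close>)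
  ultimately show "(\<lambda>N. norm_neg lam phi s (\<lambda>v. dual_of s a v - (- (\<Sum>n<N. of_real (lam n) * cinner u (phi n) * embed lam phi s (phi n) v)))) \<longlonglongrightarrow> 0"
    by simp
qed

lemma weak_solution_sol: "weak_solution lam phi \<alpha> T u0 (sol u0)"
  unfolding weak_solution_def
proof (intro conjI)
  show "continuous_on {0..T} (sol u0)" by (rule continuous_on_sol)
  hence "(sol u0 \<longlongrightarrow> sol u0 0) (at 0 within {0..T})"
    using T by (auto simp: continuous_on_def)
  hence "(sol u0 \<longlongrightarrow> u0) (at 0 within {0..T})" by (simp only: sol_0)
  hence "(sol u0 \<longlongrightarrow> u0) (at_right 0)" using T by (simp add: at_within_Icc_at_right)
  thus "((\<lambda>t. norm (sol u0 t - u0)) \<longlongrightarrow> 0) (at_right 0)"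
    by (intro tendsto_norm_zero LIM_zero)
  show "AE t in lborel. t \<in> {0<..<T} \<longrightarrow>
        solves_at (sol u0) t"
  proof (intro AE_I2 impI)
    fix t assume t: "t \<in> {0<..<T}"
    define F where "F = dual_of (1 / \<alpha>) (\<lambda>n. i_pow (- \<alpha>) * of_real (lam n) * (cinner u0 (phi n) * sol_coeff n t))"
    define G where "G = dual_of (1 / \<alpha>) (\<lambda>n. - 1 * of_real (lam n) * (cinner u0 (phi n) * sol_coeff n t))"
    have F: "F \<in> H_neg lam phi (1 / \<alpha>)" unfolding F_def
      by (intro dual_of_in_H_neg summable_lam_sol) simp
    have G: "has_A_value lam phi (1 / \<alpha>) (sol u0 t) G" unfolding G_def
      by (intro has_A_value_dual_of summable_lam_sol) (simp_all add: cinner_sol)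
    \<comment> \<open>F and G are the multiples \<open>i_pow (- \<alpha>)\<close> and -1 of one
      series, so the equation reduces to
      \<open>i_pow \<alpha> * i_pow (- \<alpha>) = 1\<close>.\<close>
    have "i_pow \<alpha> * F v + G v = 0" for v
    proof (cases "v \<in> H_pos lam phi (1 / \<alpha>)")
      case True
      define b where "b n = of_real (lam n) * (cinner u0 (phi n) * sol_coeff n t) * cnj (cinner v (phi n))" for n
      have "summable (\<lambda>n. norm (1 * of_real (lam n) * (cinner u0 (phi n) * sol_coeff n t) * cnj (cinner v (phi n))))"
        by (rule summable_dual_of(1)[OF summable_lam_sol True]) simp
      hence sb: "summable b" by (intro summable_norm_cancel[of b]) (simp add: b_def[abs_def])
      have "F v = (\<Sum>n. i_pow (- \<alpha>) * b n)" using True by (simp add: F_def dual_of_def b_def mult.assoc)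
      also have "\<dots> = i_pow (- \<alpha>) * suminf b" by (rule suminf_mult[OF sb])
      finally have Fv: "F v = i_pow (- \<alpha>) * suminf b" .
      have "G v = (\<Sum>n. - b n)" using True by (simp add: G_def dual_of_def b_def mult.assoc)
      also have "\<dots> = - suminf b" by (rule suminf_minus[OF sb])
      finally show ?thesis unfolding Fv by (simp add: mult.assoc[symmetric])
    qed (simp add: F_def G_def dual_of_def)
    thus "solves_at (sol u0) t"
      using F G has_caputo_derivative_sol[of t u0] t unfolding has_A_value_def F_def by fastforce
  qed
qed

section \<open>From weak solutions to scalar equations\<close>

lemma has_A_value_phi:
  assumes G: "has_A_value lam phi s u G"
  shows "G (phi n) = - (of_real (lam n) * cinner u (phi n))"
proof -
  define D where "D N v = G v - (- (\<Sum>n<N. of_real (lam n) * cinner u (phi n) * embed lam phi s (phi n) v))" for N v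
  have Dp: "D N (phi m) = G (phi m) + (if m < N then of_real (lam m) * cinner u (phi m) else 0)" for N m
    by (simp add: D_def sum_embed_phi)
  \<comment> \<open>The error differs from G in finitely many coefficients only. Without summability
    its \<open>norm_neg\<close> would be the sum of a divergent series and would bound
    nothing.\<close>
  have sD: "summable (\<lambda>m. (lam m powr (- s) * norm (D N (phi m)))\<^sup>2)" for N
  proof -
    have "eventually (\<lambda>m. (lam m powr (- s) * norm (D N (phi m)))\<^sup>2 = (lam m powr (- s) * norm (G (phi m)))\<^sup>2) sequentially"
      using eventually_ge_at_top[of N] by eventually_elim (simp add: Dp)
    from summable_cong[OF this] show ?thesis
      using H_neg_summable[of G s] G by (simp add: has_A_value_def)
  qed
  have lim: "(\<lambda>N. norm_neg lam phi s (D N)) \<longlonglongrightarrow> 0"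
    using G unfolding has_A_value_def D_def[abs_def] by simp
  \<comment> \<open>For N > n the n-th coefficient of the error no longer depends on N, while it is
    bounded by a multiple of a norm that tends to 0.\<close>
  have "(\<lambda>N::nat. norm (G (phi n) + of_real (lam n) * cinner u (phi n))) \<longlonglongrightarrow> 0"
  proof (rule Lim_null_comparison)
    show "(\<lambda>N. lam n powr s * norm_neg lam phi s (D N)) \<longlonglongrightarrow> 0"
      using tendsto_mult_left[OF lim] by simp
    show "\<forall>\<^sub>F N in sequentially. norm (norm (G (phi n) + of_real (lam n) * cinner u (phi n))) \<le> lam n powr s * norm_neg lam phi s (D N)"
      using eventually_gt_at_top[of n]
    proof eventually_elim
      case (elim N)
      thus ?case using norm_le_norm_neg[OF sD, of N n] by (simp add: Dp)
    qed
  qed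
  hence "norm (G (phi n) + of_real (lam n) * cinner u (phi n)) = 0"
    by (simp add: LIMSEQ_const_iff)
  thus ?thesis by (simp add: eq_neg_iff_add_eq_0)
qed

lemma H_neg_integrable_phi:
  assumes g: "H_neg_integrable lam phi s I g"
  shows "set_integrable lborel I (\<lambda>r. g r (phi n))"
proof -
  have 1: "integrable lborel (\<lambda>r. lam n powr s * (indicator I r *\<^sub>R norm_neg lam phi s (g r)))"
    using g unfolding H_neg_integrable_def set_integrable_def by (intro integrable_mult_right) auto
  show ?thesis
    unfolding set_integrable_def
  proof (rule Bochner_Integration.integrable_bound[OF 1])
    show "(\<lambda>r. indicator I r *\<^sub>R g r (phi n)) \<in> borel_measurable lborel"
      using g phi_in_H_pos unfolding H_neg_integrable_def set_borel_measurable_def by auto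
    show "AE r in lborel. norm (indicator I r *\<^sub>R g r (phi n)) \<le> norm (lam n powr s * (indicator I r *\<^sub>R norm_neg lam phi s (g r)))"
    proof (rule AE_I2)
      fix r
      show "norm (indicator I r *\<^sub>R g r (phi n)) \<le> norm (lam n powr s * (indicator I r *\<^sub>R norm_neg lam phi s (g r)))"
      proof (cases "r \<in> I")
        case True
        hence "norm (g r (phi n)) \<le> lam n powr s * norm_neg lam phi s (g r)"
          using g by (intro norm_le_norm_neg H_neg_summable) (auto simp: H_neg_integrable_def)
        also have "\<dots> \<le> \<bar>lam n powr s * norm_neg lam phi s (g r)\<bar>" by (rule abs_ge_self)
        finally show ?thesis using True by simp
      qed simp
    qed
  qed
qed

text \<open>Testing with \<open>phi n\<close> turns the equation into a scalar one. The factor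
  \<open>Gamma (1 - \<alpha>)\<close> is moved to the right so that the left side is an unnormalised
  Abel integral; its integrability is recorded because the integrals of two solutions are subtracted
  later.\<close>

lemma weak_solution_coeff:
  assumes F: "has_caputo_derivative lam phi (1 / \<alpha>) \<alpha> (\<lambda>r. embed lam phi (1 / \<alpha>) (w r)) t F"
    and G: "has_A_value lam phi (1 / \<alpha>) (w t) G" and eq: "\<And>v. i_pow \<alpha> * F v + G v = 0"
  obtains g where "set_integrable lborel {0..t} g"
    "\<And>r. r \<in> {0..t} \<Longrightarrow> cinner (w r) (phi n) = cinner (w 0) (phi n) + (LINT x:{0..r}|lborel. g x)"
    "set_integrable lborel {0..t} (\<lambda>r. of_real ((t - r) powr (- \<alpha>)) * g r)"
    "abel (- \<alpha>) g t = 
      of_real (Gamma (1 - \<alpha>)) * i_pow (- \<alpha>) * of_real (lam n) * cinner (w t) (phi n)"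
proof -
  obtain h where h: "H_neg_integrable lam phi (1 / \<alpha>) {0..t} h"
    "\<And>r v. r \<in> {0..t} \<Longrightarrow> embed lam phi (1 / \<alpha>) (w r) v = embed lam phi (1 / \<alpha>) (w 0) v + H_neg_integral {0..r} h v"
    "H_neg_integrable lam phi (1 / \<alpha>) {0..t} (\<lambda>r v. of_real ((t - r) powr (- \<alpha>)) * h r v)"
    "\<And>v. F v = of_real (1 / Gamma (1 - \<alpha>)) * H_neg_integral {0..t} (\<lambda>r v. of_real ((t - r) powr (- \<alpha>)) * h r v) v"
    using F unfolding has_caputo_derivative_def by blast
  show ?thesis
  proof (rule that[of "\<lambda>r. h r (phi n)"])
    show "set_integrable lborel {0..t} (\<lambda>r. h r (phi n))" by (rule H_neg_integrable_phi[OF h(1)])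
    show "set_integrable lborel {0..t} (\<lambda>r. of_real ((t - r) powr (- \<alpha>)) * h r (phi n))" by (rule H_neg_integrable_phi[OF h(3)])
    show "cinner (w r) (phi n) = cinner (w 0) (phi n) + (LINT x:{0..r}|lborel. h x (phi n))" if "r \<in> {0..t}" for r
      using h(2)[OF that, of "phi n"] by (simp add: embed_def phi_in_H_pos H_neg_integral_def)
    have G0: "Gamma (1 - \<alpha>) \<noteq> 0" by (rule less_imp_neq[THEN not_sym, OF Gamma_real_pos]) (use \<alpha> in simp)
    have "i_pow \<alpha> * F (phi n) = of_real (lam n) * cinner (w t) (phi n)"
      using eq[of "phi n"] has_A_value_phi[OF G, of n] by simp
    hence "i_pow (- \<alpha>) * (i_pow \<alpha> * F (phi n)) = i_pow (- \<alpha>) * (of_real (lam n) * cinner (w t) (phi n))" by simp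
    hence "F (phi n) = i_pow (- \<alpha>) * (of_real (lam n) * cinner (w t) (phi n))"
      unfolding mult.assoc[symmetric] by simp
    moreover have "of_real (Gamma (1 - \<alpha>)) * F (phi n) = abel (- \<alpha>) (\<lambda>r. h r (phi n)) t"
      unfolding h(4)[of "phi n"] using G0 by (simp add: H_neg_integral_def)
    ultimately show "abel (- \<alpha>) (\<lambda>r. h r (phi n)) t = 
      of_real (Gamma (1 - \<alpha>)) * i_pow (- \<alpha>) * of_real (lam n) * cinner (w t) (phi n)"
      by (simp add: mult.assoc)
  qed
qed

text \<open>The initial condition prescribes only a limit from the right, and continuity on the
  closed interval identifies it with the value at 0.\<close>

lemma weak_solution_at_0:
  assumes "weak_solution lam phi \<alpha> T u0 w"
  shows "w 0 = u0"
proof -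
  have "(w \<longlongrightarrow> w 0) (at 0 within {0..T})"
    using assms T by (auto simp: weak_solution_def continuous_on_def)
  hence "(w \<longlongrightarrow> w 0) (at_right 0)" using T by (simp add: at_within_Icc_at_right)
  moreover have "(w \<longlongrightarrow> u0) (at_right 0)"
    by (rule LIM_zero_cancel, rule tendsto_norm_zero_cancel) (use assms in \<open>simp add: weak_solution_def\<close>)
  ultimately show ?thesis using tendsto_unique trivial_limit_at_right_real by blast
qed

lemma weak_solution_unique:
  assumes u: "weak_solution lam phi \<alpha> T u0 u" and w: "weak_solution lam phi \<alpha> T u0 w" and t: "t \<in> {0..T}"
  shows "w t = u t"
proof -
  have "cinner (w t - u t) (phi n) = 0" for n
  proof (rule caputo_equation_unique[OF \<alpha> _ _ _ t, where f = "\<lambda>t. cinner (w t - u t) (phi n)"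
      and c = "of_real (Gamma (1 - \<alpha>)) * i_pow (- \<alpha>) * of_real (lam n)"])
    show "continuous_on {0..T} (\<lambda>t. cinner (w t - u t) (phi n))"
      using u w unfolding weak_solution_def by (intro continuous_intros) auto
    show "cinner (w 0 - u 0) (phi n) = 0"
      using weak_solution_at_0[OF u] weak_solution_at_0[OF w] by simp
    have "AE t in lborel. t \<in> {0<..<T} \<longrightarrow>
        solves_at w t"
      using w unfolding weak_solution_def by blast
    moreover have "AE t in lborel. t \<in> {0<..<T} \<longrightarrow>
        solves_at u t"
      using u unfolding weak_solution_def by blast
    ultimately show "AE t in lborel. t \<in> {0<..<T} \<longrightarrow> (\<exists>g. set_integrable lborel {0..t} g \<and>
       (\<forall>r\<in>{0..t}. cinner (w r - u r) (phi n) = (LINT x:{0..r}|lborel. g x)) \<and>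
       abel (- \<alpha>) g t = 
          of_real (Gamma (1 - \<alpha>)) * i_pow (- \<alpha>) * of_real (lam n) * cinner (w t - u t) (phi n))"
    proof eventually_elim
      case (elim t)
      show ?case
      proof
        assume t: "t \<in> {0<..<T}"
        obtain F1 G1 where 1: "has_caputo_derivative lam phi (1 / \<alpha>) \<alpha> (\<lambda>r. embed lam phi (1 / \<alpha>) (w r)) t F1"
           "has_A_value lam phi (1 / \<alpha>) (w t) G1" "\<And>v. i_pow \<alpha> * F1 v + G1 v = 0" using elim(1) t by blast
        obtain F2 G2 where 2: "has_caputo_derivative lam phi (1 / \<alpha>) \<alpha> (\<lambda>r. embed lam phi (1 / \<alpha>) (u r)) t F2"
           "has_A_value lam phi (1 / \<alpha>) (u t) G2" "\<And>v. i_pow \<alpha> * F2 v + G2 v = 0" using elim(2) t by blast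
        obtain g1 where g1: "set_integrable lborel {0..t} g1"
          "\<And>r. r \<in> {0..t} \<Longrightarrow> cinner (w r) (phi n) = cinner (w 0) (phi n) + (LINT x:{0..r}|lborel. g1 x)"
          "set_integrable lborel {0..t} (\<lambda>r. of_real ((t - r) powr (- \<alpha>)) * g1 r)"
          "(LINT r:{0..t}|lborel. of_real ((t - r) powr (- \<alpha>)) * g1 r) = 
            of_real (Gamma (1 - \<alpha>)) * i_pow (- \<alpha>) * of_real (lam n) * cinner (w t) (phi n)"
          using weak_solution_coeff[OF 1] by blast
        obtain g2 where g2: "set_integrable lborel {0..t} g2"
          "\<And>r. r \<in> {0..t} \<Longrightarrow> cinner (u r) (phi n) = cinner (u 0) (phi n) + (LINT x:{0..r}|lborel. g2 x)"
          "set_integrable lborel {0..t} (\<lambda>r. of_real ((t - r) powr (- \<alpha>)) * g2 r)"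
          "(LINT r:{0..t}|lborel. of_real ((t - r) powr (- \<alpha>)) * g2 r) = 
            of_real (Gamma (1 - \<alpha>)) * i_pow (- \<alpha>) * of_real (lam n) * cinner (u t) (phi n)"
          using weak_solution_coeff[OF 2] by blast
        \<comment> \<open>The initial values cancel, as both solutions start at \<open>u0\<close>;
          the difference is a pure primitive of \<open>g1 - g2\<close>.\<close>
        have "cinner (w r - u r) (phi n) = (LINT x:{0..r}|lborel. g1 x - g2 x)" if r: "r \<in> {0..t}" for r
        proof -
          have "set_integrable lborel {0..r} g1" "set_integrable lborel {0..r} g2"
            using r by (auto intro: set_integrable_subset[OF g1(1)] set_integrable_subset[OF g2(1)])
          thus ?thesis
            using g1(2)[OF r] g2(2)[OF r] weak_solution_at_0[OF u] weak_solution_at_0[OF w]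
            by (simp add: cinner_diff_left)
        qed
        moreover have "(LINT r:{0..t}|lborel. of_real ((t - r) powr (- \<alpha>)) * (g1 r - g2 r)) = 
            of_real (Gamma (1 - \<alpha>)) * i_pow (- \<alpha>) * of_real (lam n) * cinner (w t - u t) (phi n)"
          using set_integral_diff(2)[OF g1(3) g2(3)] unfolding g1(4) g2(4)
          by (simp add: right_diff_distrib cinner_diff_left)
        ultimately show "\<exists>g. set_integrable lborel {0..t} g \<and>
           (\<forall>r\<in>{0..t}. cinner (w r - u r) (phi n) = (LINT x:{0..r}|lborel. g x)) \<and>
           abel (- \<alpha>) g t = 
              of_real (Gamma (1 - \<alpha>)) * i_pow (- \<alpha>) * of_real (lam n) * cinner (w t - u t) (phi n)"
          using set_integral_diff(1)[OF g1(1) g2(1)] by blast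
      qed
    qed
  qed
  from eq_0_if_orthogonal[OF this] show ?thesis by simp
qed

end

theorem theorem4p3:
  fixes D :: "'a::chilbert_space set" and A :: "'a \<Rightarrow> 'a"
    and lam :: "nat \<Rightarrow> real" and phi :: "nat \<Rightarrow> 'a"
    and \<alpha> T s :: real
  assumes "self_adjoint D A" and "negative_definite D A" and "compact_resolvent D A"
    and "eigensystem D A lam phi"
    and "0 < \<alpha>" and "\<alpha> < 1" and "0 < T" and "0 \<le> s"
  shows "\<exists>C>0. \<forall>u0\<in>H_pos lam phi s. \<exists>u.
      weak_solution lam phi \<alpha> T u0 u \<and> u 0 = u0 \<and> u \<in> C_pos lam phi s T \<and>
      (\<forall>w. weak_solution lam phi \<alpha> T u0 w \<longrightarrow> (\<forall>t\<in>{0..T}. w t = u t)) \<and>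
      norm_C_pos lam phi s T u \<le> C * norm_pos lam phi s u0 \<and>
      (\<forall>t\<in>{0..T}. (\<lambda>n. (cinner u0 (phi n) *
          mittag_leffler \<alpha> 1 (i_pow (- \<alpha>) * of_real (lam n * t powr \<alpha>))) *\<^sub>C phi n) sums u t)"
proof -
  interpret fractional_problem lam phi \<alpha> T
    by unfold_locales (use assms in \<open>auto simp: eigensystem_def\<close>)
  \<comment> \<open>The bound of the Mittag-Leffler function on the whole critical ray serves as the
    constant for every \<open>u0\<close> at once.\<close>
  obtain M where M: "M > 0" "\<And>n t. norm (sol_coeff n t) \<le> M" using sol_coeff_bound by metis
  have "norm_C_pos lam phi s T (sol u0) \<le> M * norm_pos lam phi s u0" if "u0 \<in> H_pos lam phi s" for u0
    unfolding norm_C_pos_def by (rule cSUP_least) (use T norm_pos_sol_le[OF that M(2)] in auto)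
  thus ?thesis
    using M(1) weak_solution_sol sol_0 sol_in_C_pos weak_solution_unique[OF weak_solution_sol] sol_sums[unfolded sol_coeff_def]
    by (intro exI[of _ M] conjI ballI exI[of _ "sol _"]) auto
qed

end
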